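(* Let $U$ be a Haar distributed random matrix either in the unitary group $\mathbb U(n)$ (case $\beta=2$) or in the orthogonal group $\mathbb O(n)$ (case $\beta=1$). For $0\le p,q\le n$ put $$T_{p,q}=\sum_{1\le i\le p,\ 1\le j\le q}|U_{ij}|^2\qquad(T_{p,q}=0 \text{ if } p=0 \text{ or } q=0),$$ and define the two-parameter process $$W^{(n)}(s,t)=T_{\lfloor ns\rfloor,\lfloor nt\rfloor}-\mathbb E\,T_{\lfloor ns\rfloor,\lfloor nt\rfloor},\qquad s,t\in[0,1].$$ Then, as $n\to\infty$, $W^{(n)}$ converges in distribution in $D([0,1]^2)$ to $\sqrt{2/\beta}\,W^{(\infty)}$, where $W^{(\infty)}$ (the tied-down Brownian bridge) is a centered continuous Gaussian process on $[0,1]^2$ with covariance $$\mathbb E\big[W^{(\infty)}(s,t)W^{(\infty)}(s',t')\big]=(s\wedge s'-ss')(t\wedge t'-tt').$$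
   Context: $D([0,1]^2)$ is the two-parameter Skorokhod space of Bickel and Wichura: functions $[0,1]^2\to\mathbb R$ that are right continuous at each point with respect to the coordinatewise partial order of $[0,1]^2$ and admit limits in all orthants, endowed with the Skorokhod topology of Bickel–Wichura. *)

theory Defs
  imports "HOL-Probability.Probability"
begin

text \<open>An n x n complex matrix is represented as a function nat => nat => complex
  with indices 0..n-1 (entries outside are required to be 0 for group members).\<close>

type_synonym cmat = "nat \<Rightarrow> nat \<Rightarrow> complex"

definition mat_mult :: "nat \<Rightarrow> cmat \<Rightarrow> cmat \<Rightarrow> cmat" where
  "mat_mult n A B = (\<lambda>i j. if i < n \<and> j < n then (\<Sum>k<n. A i k * B k j) else 0)"

definition supported :: "nat \<Rightarrow> cmat \<Rightarrow> bool" where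
  "supported n U \<longleftrightarrow> (\<forall>i j. (i \<ge> n \<or> j \<ge> n) \<longrightarrow> U i j = 0)"

definition unitary_group :: "nat \<Rightarrow> cmat set" where
  "unitary_group n = {U. supported n U \<and>
     (\<forall>i<n. \<forall>j<n. (\<Sum>k<n. cnj (U k i) * U k j) = (if i = j then 1 else 0))}"

definition orthogonal_group :: "nat \<Rightarrow> cmat set" where
  "orthogonal_group n = {U. U \<in> unitary_group n \<and> (\<forall>i j. U i j \<in> \<real>)}"

definition beta_group :: "real \<Rightarrow> nat \<Rightarrow> cmat set" where
  "beta_group \<beta> n = (if \<beta> = 2 then unitary_group n else orthogonal_group n)"

text \<open>Haar measure on a compact group G of n x n matrices: a probability measure
  on the Borel sets of the matrix space, concentrated on G, invariant under left
  multiplication by elements of G (unique by the uniqueness of Haar measure).\<close>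
definition haar_on :: "nat \<Rightarrow> cmat set \<Rightarrow> cmat measure \<Rightarrow> bool" where
  "haar_on n G M \<longleftrightarrow> prob_space M \<and> sets M = sets borel \<and> G \<in> sets M \<and>
     emeasure M G = 1 \<and>
     (\<forall>V\<in>G. distr M borel (mat_mult n V) = M)"

definition T_pq :: "nat \<Rightarrow> nat \<Rightarrow> cmat \<Rightarrow> real" where
  "T_pq p q U = (\<Sum>i<p. \<Sum>j<q. (cmod (U i j))\<^sup>2)"

definition W_proc :: "nat \<Rightarrow> cmat measure \<Rightarrow> cmat \<Rightarrow> real \<times> real \<Rightarrow> real" where
  "W_proc n M U = (\<lambda>(s, t).
     let p = nat \<lfloor>real n * s\<rfloor>; q = nat \<lfloor>real n * t\<rfloor>
     in T_pq p q U - (\<integral>V. T_pq p q V \<partial>M))"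

definition unit_sq :: "(real \<times> real) set" where
  "unit_sq = {0..1} \<times> {0..1}"

definition quadrant :: "bool \<Rightarrow> bool \<Rightarrow> real \<times> real \<Rightarrow> (real \<times> real) set" where
  "quadrant a b st = {(s', t') \<in> unit_sq.
      (if a then s' \<ge> fst st else s' < fst st) \<and> (if b then t' \<ge> snd st else t' < snd st)}"

definition D2 :: "(real \<times> real \<Rightarrow> real) set" where
  "D2 = {x. \<forall>st\<in>unit_sq.
      (x \<longlongrightarrow> x st) (at st within quadrant True True st) \<and>
      (\<forall>a b. \<exists>l. (x \<longlongrightarrow> l) (at st within quadrant a b st))}"

definition time_changes :: "(real \<Rightarrow> real) set" where
  "time_changes = {g. strict_mono_on {0..1} g \<and> continuous_on {0..1} g \<and> g ` {0..1} = {0..1}}"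

text \<open>Bickel--Wichura Skorokhod metric on D([0,1]^2).\<close>
definition skorokhod_dist :: "(real \<times> real \<Rightarrow> real) \<Rightarrow> (real \<times> real \<Rightarrow> real) \<Rightarrow> real" where
  "skorokhod_dist x y = Inf {e. \<exists>l1\<in>time_changes. \<exists>l2\<in>time_changes. e \<ge> 0 \<and>
      (\<forall>s\<in>{0..1}. \<bar>l1 s - s\<bar> \<le> e) \<and> (\<forall>t\<in>{0..1}. \<bar>l2 t - t\<bar> \<le> e) \<and>
      (\<forall>(s, t)\<in>unit_sq. \<bar>x (s, t) - y (l1 s, l2 t)\<bar> \<le> e)}"

definition bounded_skorokhod_continuous :: "((real \<times> real \<Rightarrow> real) \<Rightarrow> real) \<Rightarrow> bool" where
  "bounded_skorokhod_continuous f \<longleftrightarrow>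
     (\<exists>B. \<forall>x\<in>D2. \<bar>f x\<bar> \<le> B) \<and>
     (\<forall>x\<in>D2. \<forall>e>0. \<exists>d>0. \<forall>y\<in>D2. skorokhod_dist x y < d \<longrightarrow> \<bar>f x - f y\<bar> < e)"

definition conv_distr_D2 ::
  "(nat \<Rightarrow> 'a measure) \<Rightarrow> (nat \<Rightarrow> 'a \<Rightarrow> real \<times> real \<Rightarrow> real) \<Rightarrow>
   'b measure \<Rightarrow> ('b \<Rightarrow> real \<times> real \<Rightarrow> real) \<Rightarrow> bool" where
  "conv_distr_D2 M X P Y \<longleftrightarrow>
     (\<forall>f. bounded_skorokhod_continuous f \<longrightarrow>
        (\<lambda>n. \<integral>u. f (X n u) \<partial>M n) \<longlonglongrightarrow> (\<integral>\<omega>. f (Y \<omega>) \<partial>P))"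

definition gaussian_rv :: "'a measure \<Rightarrow> ('a \<Rightarrow> real) \<Rightarrow> bool" where
  "gaussian_rv P X \<longleftrightarrow> X \<in> borel_measurable P \<and>
     ((\<exists>\<mu>. AE \<omega> in P. X \<omega> = \<mu>) \<or>
      (\<exists>\<mu> \<sigma>. \<sigma> > 0 \<and> distributed P lborel X (normal_density \<mu> \<sigma>)))"

definition tied_down_bridge :: "'a measure \<Rightarrow> (real \<times> real \<Rightarrow> 'a \<Rightarrow> real) \<Rightarrow> bool" where
  "tied_down_bridge P W \<longleftrightarrow> prob_space P \<and>
     (\<forall>ps :: (real \<times> real) list. \<forall>cs :: real list.
        set ps \<subseteq> unit_sq \<longrightarrow> length cs = length ps \<longrightarrow>
        gaussian_rv P (\<lambda>\<omega>. \<Sum>i<length ps. cs ! i * W (ps ! i) \<omega>)) \<and>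
     (\<forall>x\<in>unit_sq. integrable P (W x) \<and> (\<integral>\<omega>. W x \<omega> \<partial>P) = 0) \<and>
     (\<forall>(s, t)\<in>unit_sq. \<forall>(s', t')\<in>unit_sq.
        (\<integral>\<omega>. W (s, t) \<omega> * W (s', t') \<omega> \<partial>P) = (min s s' - s * s') * (min t t' - t * t')) \<and>
     (\<forall>\<omega>\<in>space P. continuous_on unit_sq (\<lambda>x. W x \<omega>))"

end

theory Submission
  imports Defs
begin

text \<open>
  Fix \<open>n\<close> and write \<open>Z\<^sup>J = U P\<^bsub>J\<^esub> U\<^sup>*\<close> for a set \<open>J\<close> of columns, so that \<open>T(A, J)\<close> is the trace of
  \<open>Z\<^sup>J\<close> over the rows in \<open>A\<close>.  Invariance of Haar measure under plane rotations of rows gives the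
  integration by parts formula \<open>E(L H) = 0\<close> for every infinitesimal rotation \<open>L\<close>.  Applied to
  \<open>Z\<^bsub>da\<^esub> h\<close> it yields, for a linear combination \<open>X\<close> of centred traces \<open>T\<close>,
  \<open>n E((T - E T) F(X)) = (2/\<beta>) E(F'(X) \<Gamma>)\<close>, where \<open>\<Gamma>\<close> is quadratic in the matrices \<open>Z\<close>.  With
  \<open>F\<close> a power and the deterministic bound \<open>\<Gamma> \<le> min |A| |J|\<close> this controls all moments, hence tightness by
  dyadic chaining.  With \<open>F(x) = exp(i \<xi> x)\<close> and a second integration by parts, applied to
  \<open>Z\<^bsub>db\<^esub> Z'\<^bsub>ba\<^esub> h\<close>, \<open>\<Gamma>/n\<close> may be replaced by a constant up to \<open>O(n\<^bsup>-1/2\<^esup>)\<close>, so the characteristic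
  function of \<open>X\<close> nearly satisfies the Gaussian differential equation.

  Since the limit is continuous it suffices to treat functionals that are Lipschitz for the supremum
  distance (the Pasch--Hausdorff envelopes of the given functional), and these only feel the process through
  its values on a finite grid.
\<close>

section \<open>Plane rotations of rows\<close>

text \<open>Of Haar measure only left invariance on the group is used, never an explicit moment
  formula. The bound on \<Gamma> suffices for moments but does not give the limiting variance:
  \<Gamma> is random, and it becomes deterministic only because the main term of the second identity
  is a polynomial in block sums, whose fluctuations are already known to be bounded. The power
  behind tightness is six: at mesh \<rho> there are about \<rho>^(-2) increments, each with 2p-th
  moment of order \<rho>^p, so p = 2 only breaks even while p = 3 leaves a positive power of \<rho>.
  On the functional side the obstacle is measurability. For the supremum distance the space is not
  separable, and a continuous functional need not be measurable. The processes at finite n, however,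
  are step functions of finitely many measurable coordinates, and the limit has continuous paths,
  which are uniform limits of their grid versions. Suprema over the square are never formed;
  integrable majorants take their place.\<close>

definition rot :: "complex \<Rightarrow> nat \<Rightarrow> nat \<Rightarrow> real \<Rightarrow> cmat \<Rightarrow> cmat" where
  "rot u a b \<theta> U = (\<lambda>i j.
     if i = a then of_real (cos \<theta>) * U a j + of_real (sin \<theta>) * u * U b j
     else if i = b then of_real (cos \<theta>) * U b j - of_real (sin \<theta>) * cnj u * U a j
     else U i j)"

definition id_mat :: "nat \<Rightarrow> cmat" where
  "id_mat n = (\<lambda>i j. if i = j \<and> i < n then 1 else 0)"

lemma rot_0 [simp]: "rot u a b 0 U = U"
  by (auto simp: rot_def fun_eq_iff)

lemma cmod_1_mult_cnj: "cmod u = 1 \<Longrightarrow> u * cnj u = 1"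
  by (simp add: complex_norm_square [symmetric])

text \<open>The phases cancel because \<open>u * cnj u = 1\<close>, so the rotations form a
  one-parameter group. Differentiating along an orbit at any time thereby reduces to time 0.\<close>

lemma rot_rot:
  assumes "a \<noteq> b" "cmod u = 1"
  shows "rot u a b s (rot u a b t U) = rot u a b (s + t) U"
proof -
  have u: "u * cnj u = 1" "\<And>z. u * (cnj u * z) = z" "\<And>z. cnj u * (u * z) = z"
    using cmod_1_mult_cnj[OF assms(2)] by (metis mult.assoc mult.commute mult.left_neutral)+
  show ?thesis
    using assms(1)
    by (auto simp: rot_def fun_eq_iff cos_add sin_add algebra_simps u)
qed

text \<open>Identifies the row operation with left multiplication by a matrix, the form in which
  invariance of the measure is given. The support condition enters because \<open>mat_mult\<close>
  truncates and \<open>rot\<close> does not.\<close>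

lemma mat_mult_rot:
  assumes "supported n U" "a < n" "b < n" "a \<noteq> b"
  shows "mat_mult n (rot u a b \<theta> (id_mat n)) U = rot u a b \<theta> U"
proof (intro ext)
  fix i j
  have S: "(\<Sum>k<n. (if x = k \<and> x < n then 1 else 0) * U k j) = U x j" if "x < n" for x
    using that by (simp add: if_distrib[where f = "\<lambda>y. y * _"] sum.delta' cong: if_cong)
  have "(\<Sum>k<n. rot u a b \<theta> (id_mat n) i k * U k j) = rot u a b \<theta> U i j" if "i < n"
  proof -
    consider "i = a" | "i = b" "i \<noteq> a" | "i \<noteq> a" "i \<noteq> b" by blast
    then show ?thesis
    proof cases
      case 1
      have "(\<Sum>k<n. rot u a b \<theta> (id_mat n) i k * U k j) =
         of_real (cos \<theta>) * (\<Sum>k<n. id_mat n a k * U k j) + of_real (sin \<theta>) * u * (\<Sum>k<n. id_mat n b k * U k j)"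
        using 1 by (simp add: rot_def ring_distribs sum.distrib sum_distrib_left mult.assoc)
      then show ?thesis using S[OF assms(2)] S[OF assms(3)] 1 by (simp add: id_mat_def rot_def)
    next
      case 2
      have "(\<Sum>k<n. rot u a b \<theta> (id_mat n) i k * U k j) =
         of_real (cos \<theta>) * (\<Sum>k<n. id_mat n b k * U k j) - of_real (sin \<theta>) * cnj u * (\<Sum>k<n. id_mat n a k * U k j)"
        using 2 by (simp add: rot_def ring_distribs sum_subtractf sum_distrib_left mult.assoc)
      then show ?thesis using S[OF assms(2)] S[OF assms(3)] 2 by (simp add: id_mat_def rot_def)
    next
      case 3
      then show ?thesis using S[OF that] by (simp add: id_mat_def rot_def)
    qed
  qed
  moreover have "rot u a b \<theta> U i j = 0" if "\<not> (i < n \<and> j < n)"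
    using that assms by (auto simp: rot_def supported_def)
  ultimately show "mat_mult n (rot u a b \<theta> (id_mat n)) U i j = rot u a b \<theta> U i j"
    by (simp add: mat_mult_def)
qed

lemma rot_unitary:
  assumes "U \<in> unitary_group n" "a < n" "b < n" "a \<noteq> b" "cmod u = 1"
  shows "rot u a b \<theta> U \<in> unitary_group n"
proof -
  have u: "u * cnj u = 1" "\<And>z. u * (cnj u * z) = z" "\<And>z. cnj u * (u * z) = z"
    using cmod_1_mult_cnj[OF assms(5)] by (metis mult.assoc mult.commute mult.left_neutral)+
  have cs: "complex_of_real (cos \<theta>) * of_real (cos \<theta>) = 1 - of_real (sin \<theta>) * of_real (sin \<theta>)"
    by (metis cos_squared_eq of_real_1 of_real_diff of_real_mult power2_eq_square)
  have sup: "supported n (rot u a b \<theta> U)"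
    using assms by (auto simp: rot_def supported_def unitary_group_def)
  have "(\<Sum>k<n. cnj (rot u a b \<theta> U k i) * rot u a b \<theta> U k j) = (\<Sum>k<n. cnj (U k i) * U k j)" for i j
  proof -
    have split: "(\<Sum>k<n. f k) = f a + f b + (\<Sum>k\<in>{..<n} - {a,b}. f k)" for f :: "nat \<Rightarrow> complex"
    proof -
      have "(\<Sum>k<n. f k) = sum f {a,b} + sum f ({..<n} - {a,b})"
        by (subst sum.union_disjoint [symmetric]) (use assms in \<open>auto intro!: sum.cong\<close>)
      then show ?thesis using assms by simp
    qed
    have rest: "(\<Sum>k\<in>{..<n} - {a,b}. cnj (rot u a b \<theta> U k i) * rot u a b \<theta> U k j) = (\<Sum>k\<in>{..<n} - {a,b}. cnj (U k i) * U k j)"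
      by (rule sum.cong) (auto simp: rot_def)
    have "cnj (rot u a b \<theta> U a i) * rot u a b \<theta> U a j + cnj (rot u a b \<theta> U b i) * rot u a b \<theta> U b j
      = (of_real (cos \<theta>) * of_real (cos \<theta>) + of_real (sin \<theta>) * of_real (sin \<theta>)) * (cnj (U a i) * U a j)
       + (of_real (cos \<theta>) * of_real (cos \<theta>) + of_real (sin \<theta>) * of_real (sin \<theta>)) * (cnj (U b i) * U b j)"
      using assms(4) by (auto simp: rot_def algebra_simps u)
    then show ?thesis unfolding split[of "\<lambda>k. cnj (rot u a b \<theta> U k i) * rot u a b \<theta> U k j"]
        split[of "\<lambda>k. cnj (U k i) * U k j"] rest cs by simp
  qed
  then show ?thesis using sup assms(1) by (simp add: unitary_group_def)
qed

text \<open>The phases whose rotations stay in the group: the whole unit circle in the unitary case,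
  only 1 and -1 in the orthogonal case.\<close>

definition adm :: "real \<Rightarrow> complex \<Rightarrow> bool" where
  "adm \<beta> u \<longleftrightarrow> cmod u = 1 \<and> (\<beta> \<noteq> 2 \<longrightarrow> u \<in> \<real>)"

lemma rot_beta_group:
  assumes "U \<in> beta_group \<beta> n" "a < n" "b < n" "a \<noteq> b" "adm \<beta> u"
  shows "rot u a b \<theta> U \<in> beta_group \<beta> n"
  using assms rot_unitary[of U n a b u \<theta>]
  by (auto simp: beta_group_def orthogonal_group_def adm_def rot_def Reals_cnj_iff split: if_splits)

lemma id_mat_beta_group: "id_mat n \<in> beta_group \<beta> n"
proof -
  have "(\<Sum>k<n. cnj (id_mat n k i) * id_mat n k j) = (if i = j then 1 else 0)" if "i < n" for i j
  proof -
    have "(\<Sum>k<n. cnj (id_mat n k i) * id_mat n k j) = (\<Sum>k<n. if k = i then id_mat n i j else 0)"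
      using that by (intro sum.cong) (auto simp: id_mat_def)
    then show ?thesis using that by (simp add: id_mat_def)
  qed
  then have "id_mat n \<in> unitary_group n"
    by (auto simp: unitary_group_def supported_def id_mat_def)
  then show ?thesis by (auto simp: beta_group_def orthogonal_group_def id_mat_def)
qed

section \<open>Measurability, and calculus along rotations\<close>

lemma measurable_entry [measurable]: "(\<lambda>U::cmat. U i j) \<in> borel_measurable borel"
proof -
  have "(\<lambda>U::cmat. U i) \<in> borel_measurable borel"
    by (intro borel_measurable_continuous_onI continuous_on_product_coordinates)
  moreover have "(\<lambda>V::nat \<Rightarrow> complex. V j) \<in> borel_measurable borel"
    by (intro borel_measurable_continuous_onI continuous_on_product_coordinates)
  ultimately show ?thesis by (rule measurable_compose)
qed

lemma measurable_cmatI: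
  assumes "\<And>i j. (\<lambda>x. f x i j) \<in> borel_measurable N"
  shows "(f :: 'x \<Rightarrow> cmat) \<in> borel_measurable N"
  using assms by (intro measurable_coordinatewise_then_product)

lemma measurable_mat_mult [measurable]: "mat_mult n V \<in> borel_measurable borel"
  by (rule measurable_cmatI) (simp add: mat_mult_def)

lemma measurable_rot [measurable]: "rot u a b \<theta> \<in> borel_measurable borel"
  by (rule measurable_cmatI) (simp add: rot_def)

text \<open>The derivative is asked for at every matrix, not only on the group: \<open>rot\<close>
  makes sense everywhere, so no differential geometry of the group is involved. As a relation
  between a function and its derivative, it composes under product and chain rules without separate
  differentiability conditions.\<close>

definition lie_deriv :: "complex \<Rightarrow> nat \<Rightarrow> nat \<Rightarrow> (cmat \<Rightarrow> complex) \<Rightarrow> (cmat \<Rightarrow> complex) \<Rightarrow> bool" where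
  "lie_deriv u a b H H' \<longleftrightarrow> (\<forall>U. ((\<lambda>\<theta>. H (rot u a b \<theta> U)) has_vector_derivative H' U) (at 0))"

lemma lie_deriv_const: "lie_deriv u a b (\<lambda>U. c) (\<lambda>U. 0)"
  by (simp add: lie_deriv_def)

lemma lie_deriv_mult:
  assumes "lie_deriv u a b F F'" "lie_deriv u a b H H'"
  shows "lie_deriv u a b (\<lambda>U. F U * H U) (\<lambda>U. F U * H' U + F' U * H U)"
  unfolding lie_deriv_def
proof
  fix U
  have "((\<lambda>\<theta>. F (rot u a b \<theta> U) * H (rot u a b \<theta> U)) has_vector_derivative
     F (rot u a b 0 U) * H' U + F' U * H (rot u a b 0 U)) (at 0)"
    using assms by (intro has_vector_derivative_mult) (auto simp: lie_deriv_def)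
  then show "((\<lambda>\<theta>. F (rot u a b \<theta> U) * H (rot u a b \<theta> U)) has_vector_derivative
     F U * H' U + F' U * H U) (at 0)" by simp
qed

lemma lie_deriv_cmult:
  assumes "lie_deriv u a b H H'"
  shows "lie_deriv u a b (\<lambda>U. c * H U) (\<lambda>U. c * H' U)"
  using lie_deriv_mult[OF lie_deriv_const assms, of c] by simp

lemma lie_deriv_sum:
  assumes "\<And>k. k \<in> K \<Longrightarrow> lie_deriv u a b (F k) (F' k)"
  shows "lie_deriv u a b (\<lambda>U. \<Sum>k\<in>K. F k U) (\<lambda>U. \<Sum>k\<in>K. F' k U)"
  using assms by (auto simp: lie_deriv_def intro!: has_vector_derivative_sum)

lemma lie_deriv_cnj:
  assumes "lie_deriv u a b H H'"
  shows "lie_deriv u a b (\<lambda>U. cnj (H U)) (\<lambda>U. cnj (H' U))"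
  using assms by (auto simp: lie_deriv_def intro!: has_vector_derivative_cnj)

lemma lie_deriv_chain:
  assumes "lie_deriv u a b H H'" "\<And>z. (f has_field_derivative f' z) (at z)"
  shows "lie_deriv u a b (\<lambda>U. f (H U)) (\<lambda>U. f' (H U) * H' U)"
  unfolding lie_deriv_def
proof
  fix U
  have "(f \<circ> (\<lambda>\<theta>. H (rot u a b \<theta> U)) has_vector_derivative H' U * f' (H (rot u a b 0 U))) (at 0)"
    using assms by (intro field_vector_diff_chain_at) (auto simp: lie_deriv_def)
  then show "((\<lambda>\<theta>. f (H (rot u a b \<theta> U))) has_vector_derivative f' (H U) * H' U) (at 0)"
    by (simp add: o_def mult.commute)
qed

lemma lie_deriv_entry:
  "lie_deriv u a b (\<lambda>U. U i j)
     (\<lambda>U. if i = a then u * U b j else if i = b then - (cnj u * U a j) else 0)"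
proof -
  have c: "((\<lambda>\<theta>. complex_of_real (cos \<theta>)) has_vector_derivative 0) (at 0)"
    using has_vector_derivative_of_real[OF DERIV_cos[of 0]] by simp
  have s: "((\<lambda>\<theta>. complex_of_real (sin \<theta>)) has_vector_derivative 1) (at 0)"
    using has_vector_derivative_of_real[OF DERIV_sin[of 0]] by simp
  have "((\<lambda>\<theta>. of_real (cos \<theta>) * x + of_real (sin \<theta>) * y) has_vector_derivative y) (at 0)" for x y :: complex
    using has_vector_derivative_add[OF has_vector_derivative_mult_left[OF c, of x] has_vector_derivative_mult_left[OF s, of y]]
    by simp
  from this[of "_ a _" "u * _"] this[of _ "- (cnj u * _)"] show ?thesis
    by (auto simp: lie_deriv_def rot_def mult.assoc)
qed

text \<open>For unitary \<open>U\<close> and \<open>J\<close> within the index range, these are the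
  entries of the orthogonal projection onto the span of the columns in \<open>J\<close>.\<close>

definition Zb :: "nat set \<Rightarrow> cmat \<Rightarrow> nat \<Rightarrow> nat \<Rightarrow> complex" where
  "Zb J U x y = (\<Sum>j\<in>J. U x j * cnj (U y j))"

lemma lie_deriv_Zb:
  assumes "a \<noteq> d"
  shows "lie_deriv u a d (\<lambda>U. Zb J U x y)
    (\<lambda>U. of_bool (x = a) * u * Zb J U d y - of_bool (x = d) * cnj u * Zb J U a y
       + of_bool (y = a) * cnj u * Zb J U x d - of_bool (y = d) * u * Zb J U x a)"
proof -
  let ?E = "\<lambda>U::cmat. \<lambda>x j. if x = a then u * U d j else if x = d then - (cnj u * U a j) else 0"
  have "lie_deriv u a d (\<lambda>U. Zb J U x y) (\<lambda>U. \<Sum>j\<in>J. U x j * cnj (?E U y j) + ?E U x j * cnj (U y j))"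
    unfolding Zb_def by (intro lie_deriv_sum lie_deriv_mult lie_deriv_cnj lie_deriv_entry)
  also have "(\<lambda>U. \<Sum>j\<in>J. U x j * cnj (?E U y j) + ?E U x j * cnj (U y j)) =
    (\<lambda>U. of_bool (x = a) * u * Zb J U d y - of_bool (x = d) * cnj u * Zb J U a y
       + of_bool (y = a) * cnj u * Zb J U x d - of_bool (y = d) * u * Zb J U x a)"
    using assms by (auto simp: fun_eq_iff Zb_def sum_distrib_left sum.distrib sum_negf algebra_simps)
  finally show ?thesis .
qed

section \<open>Integration by parts for Haar measure\<close>

text \<open>The uniform bound on the derivative makes the integrand Lipschitz in time, so dominated
  convergence applies with a constant as majorant.\<close>

lemma (in finite_measure) has_vector_derivative_integral:
  fixes F F' :: "real \<Rightarrow> 'a \<Rightarrow> complex"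
  assumes int: "\<And>t. integrable M (F t)" and meas: "F' t0 \<in> borel_measurable M"
    and deriv: "AE x in M. \<forall>t. ((\<lambda>t. F t x) has_vector_derivative F' t x) (at t) \<and> norm (F' t x) \<le> C"
  shows "((\<lambda>t. \<integral>x. F t x \<partial>M) has_vector_derivative (\<integral>x. F' t0 x \<partial>M)) (at t0)"
proof -
  have meas': "F t \<in> borel_measurable M" for t using int[of t] by auto
  have int': "integrable M (F' t0)"
    by (rule integrable_const_bound[of _ C]) (use deriv meas in \<open>auto elim: eventually_mono\<close>)
  have lip: "AE x in M. \<forall>t. norm (F t x - F t0 x) \<le> C * norm (t - t0)"
    using deriv
  proof eventually_elim
    case (elim x)
    show ?case
    proof
      fix t
      show "norm (F t x - F t0 x) \<le> C * norm (t - t0)"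
      proof (rule differentiable_bound[of UNIV "\<lambda>t. F t x" "\<lambda>t h. h *\<^sub>R F' t x"])
        show "((\<lambda>t. F t x) has_derivative (\<lambda>h. h *\<^sub>R F' t x)) (at t)" for t
          using elim by (simp add: has_vector_derivative_def)
        show "onorm (\<lambda>h. h *\<^sub>R F' t x) \<le> C" for t
          using elim by (intro onorm_bound) (auto intro: order_trans[OF norm_ge_zero] mult_left_mono simp: mult.commute[of C])
      qed auto
    qed
  qed
  \<comment> \<open>The normalised remainder of the first-order expansion: at most
    \<open>2 * C\<close> in norm, and null in the limit for almost every point.\<close>
  define Q where "Q = (\<lambda>t x. ((F t x - F t0 x) - (t - t0) *\<^sub>R F' t0 x) /\<^sub>R norm (t - t0))"
  have Qint: "(\<integral>x. Q t x \<partial>M) = ((\<integral>x. F t x \<partial>M) - (\<integral>x. F t0 x \<partial>M) - (t - t0) *\<^sub>R (\<integral>x. F' t0 x \<partial>M)) /\<^sub>R norm (t - t0)" for t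
    unfolding Q_def using int int' by simp
  have "((\<lambda>t. \<integral>x. Q t x \<partial>M) \<longlongrightarrow> 0) (at t0)"
    unfolding tendsto_at_iff_sequentially o_def
  proof (intro allI impI)
    fix X :: "nat \<Rightarrow> real" assume X: "\<forall>i. X i \<in> UNIV - {t0}" "X \<longlonglongrightarrow> t0"
    have "(\<lambda>i. \<integral>x. Q (X i) x \<partial>M) \<longlonglongrightarrow> (\<integral>x. 0 \<partial>M)"
    proof (rule integral_dominated_convergence[where w = "\<lambda>x. 2 * C"])
      show "AE x in M. (\<lambda>i. Q (X i) x) \<longlonglongrightarrow> 0"
        using deriv
      proof eventually_elim
        case (elim x)
        then have "((\<lambda>t. F t x) has_derivative (\<lambda>h. h *\<^sub>R F' t0 x)) (at t0)"
          by (simp add: has_vector_derivative_def)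
        then have "((\<lambda>t. Q t x) \<longlongrightarrow> 0) (at t0)"
          by (simp add: Q_def has_derivative_def)
        then show ?case using X by (auto simp: tendsto_at_iff_sequentially o_def)
      qed
      show "AE x in M. norm (Q (X i) x) \<le> 2 * C" for i
        using deriv lip
      proof eventually_elim
        case (elim x)
        have "norm (F (X i) x - F t0 x - (X i - t0) *\<^sub>R F' t0 x) \<le> C * norm (X i - t0) + norm (X i - t0) * C"
          using elim by (intro order_trans[OF norm_triangle_ineq4] add_mono spec[OF elim(2)]) (auto intro: mult_left_mono)
        then show ?case using X(1) by (auto simp: Q_def divide_simps)
      qed
    qed (use meas meas' in \<open>auto simp: Q_def\<close>)
    then show "(\<lambda>i. \<integral>x. Q (X i) x \<partial>M) \<longlonglongrightarrow> 0" by simp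
  qed
  then show ?thesis
    unfolding has_vector_derivative_def has_derivative_def Qint
    by (auto intro: bounded_linear_scaleR_left)
qed

section \<open>Haar measure and the algebra of admissible integrands\<close>

locale haar =
  fixes n :: nat and \<beta> :: real and M :: "cmat measure"
  assumes haar_on: "haar_on n (beta_group \<beta> n) M"
begin

abbreviation "G \<equiv> beta_group \<beta> n"

sublocale prob_space M
  using haar_on by (simp add: haar_on_def)

lemma sets_M [measurable_cong]: "sets M = sets borel"
  using haar_on by (simp add: haar_on_def)

lemmas measurable_M = measurable_cong_sets[OF sets_M refl]

lemma AE_G: "AE U in M. U \<in> G"
proof -
  have "AE U in M. U \<in> G" if "emeasure M G = 1" "G \<in> sets M"
    using that by (subst AE_in_set_eq_1) (auto simp: measure_def)
  then show ?thesis using haar_on by (auto simp: haar_on_def)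
qed

text \<open>Measurable and bounded on the group, which has full measure. All integrands below lie in
  this algebra, so integrability becomes a matter of closure rules.\<close>

definition nice :: "(cmat \<Rightarrow> complex) \<Rightarrow> bool" where
  "nice f \<longleftrightarrow> f \<in> borel_measurable borel \<and> (\<exists>C. \<forall>U\<in>G. cmod (f U) \<le> C)"

lemma nice_measurable: "nice f \<Longrightarrow> f \<in> borel_measurable borel"
  by (simp add: nice_def)

lemma nice_integrable: "nice f \<Longrightarrow> integrable M f"
  unfolding nice_def
  by (elim conjE exE, rule integrable_const_bound)
     (use AE_G in \<open>auto elim!: eventually_mono simp: measurable_M\<close>)

lemma nice_const [simp]: "nice (\<lambda>U. c)"
  by (auto simp: nice_def)

lemma nice_mult [intro]:
  assumes "nice f" "nice g" shows "nice (\<lambda>U. f U * g U)"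
proof -
  from assms obtain C D where "\<forall>U\<in>G. cmod (f U) \<le> C" "\<forall>U\<in>G. cmod (g U) \<le> D" by (auto simp: nice_def)
  then have "\<forall>U\<in>G. cmod (f U * g U) \<le> \<bar>C\<bar> * \<bar>D\<bar>"
    by (auto simp: norm_mult abs_of_nonneg[OF order_trans[OF norm_ge_zero]] intro!: mult_mono)
  then show ?thesis using assms by (auto simp: nice_def)
qed

lemma nice_add [intro]:
  assumes "nice f" "nice g" shows "nice (\<lambda>U. f U + g U)"
proof -
  from assms obtain C D where "\<forall>U\<in>G. cmod (f U) \<le> C" "\<forall>U\<in>G. cmod (g U) \<le> D" by (auto simp: nice_def)
  then have "\<forall>U\<in>G. cmod (f U + g U) \<le> C + D"
    by (auto intro!: order_trans[OF norm_triangle_ineq] add_mono)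
  then show ?thesis using assms by (auto simp: nice_def)
qed

lemma nice_minus [intro]: "nice f \<Longrightarrow> nice (\<lambda>U. - f U)"
  by (auto simp: nice_def)

lemma nice_diff [intro]: "nice f \<Longrightarrow> nice g \<Longrightarrow> nice (\<lambda>U. f U - g U)"
  using nice_add[of f "\<lambda>U. - g U"] by auto

lemma nice_sum [intro]: "(\<And>k. k \<in> K \<Longrightarrow> nice (f k)) \<Longrightarrow> nice (\<lambda>U. \<Sum>k\<in>K. f k U)"
  by (induction K rule: infinite_finite_induct) auto

lemma nice_power [intro]: "nice f \<Longrightarrow> nice (\<lambda>U. f U ^ k)"
  by (induction k) auto

lemma nice_exp [intro]:
  assumes "nice f" shows "nice (\<lambda>U. exp (f U))"
proof -
  from assms obtain C where "\<forall>U\<in>G. cmod (f U) \<le> C" by (auto simp: nice_def)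
  then have "\<forall>U\<in>G. cmod (exp (f U)) \<le> exp C"
    by (metis norm_exp order_trans exp_le_cancel_iff)
  then show ?thesis using assms by (auto simp: nice_def)
qed

lemma G_unitary: "U \<in> G \<Longrightarrow> U \<in> unitary_group n"
  by (auto simp: beta_group_def orthogonal_group_def split: if_splits)

lemma G_supported: "U \<in> G \<Longrightarrow> supported n U"
  using G_unitary by (auto simp: unitary_group_def)

lemma G_cols: "U \<in> G \<Longrightarrow> i < n \<Longrightarrow> j < n \<Longrightarrow> (\<Sum>k<n. cnj (U k i) * U k j) = of_bool (i = j)"
  using G_unitary by (auto simp: unitary_group_def)

lemma integral_rot:
  assumes "a < n" "b < n" "a \<noteq> b" "adm \<beta> u" "H \<in> borel_measurable borel"
  shows "(\<integral>U. H (rot u a b \<theta> U) \<partial>M) = (\<integral>U. H U \<partial>M :: complex)"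
proof -
  have [measurable]: "H \<in> borel_measurable borel" by fact
  let ?R = "rot u a b \<theta> (id_mat n)"
  have "?R \<in> G" by (intro rot_beta_group id_mat_beta_group assms)
  then have "distr M borel (mat_mult n ?R) = M" using haar_on by (auto simp: haar_on_def)
  then have "(\<integral>U. H U \<partial>M) = (\<integral>U. H U \<partial>distr M borel (mat_mult n ?R))" by simp
  also have "\<dots> = (\<integral>U. H (mat_mult n ?R U) \<partial>M)" by (rule integral_distr) measurable
  also have "\<dots> = (\<integral>U. H (rot u a b \<theta> U) \<partial>M)"
  proof (rule integral_cong_AE)
    show "AE U in M. H (mat_mult n ?R U) = H (rot u a b \<theta> U)"
      using AE_G by eventually_elim (use assms in \<open>simp add: mat_mult_rot G_supported\<close>)
  qed measurable
  finally show ?thesis ..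
qed

text \<open>By invariance the mean of \<open>H\<close> along an orbit is constant in time, while its
  derivative at 0 is the mean of \<open>H'\<close>. The bound needed for differentiation under the
  integral holds at all times because orbits stay in the group.\<close>

lemma integral_lie_deriv:
  assumes "a < n" "b < n" "a \<noteq> b" "adm \<beta> u" "nice H" "nice H'" and d: "lie_deriv u a b H H'"
  shows "(\<integral>U. H' U \<partial>M) = 0"
proof -
  have [measurable]: "H \<in> borel_measurable borel" "H' \<in> borel_measurable borel"
    using assms by (auto dest: nice_measurable)
  obtain C where C: "\<forall>U\<in>G. cmod (H' U) \<le> C" using \<open>nice H'\<close> by (auto simp: nice_def)
  obtain D where D: "\<forall>U\<in>G. cmod (H U) \<le> D" using \<open>nice H\<close> by (auto simp: nice_def)
  have u: "cmod u = 1" using assms by (simp add: adm_def)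
  have rotG: "U \<in> G \<Longrightarrow> rot u a b t U \<in> G" for U t
    using assms by (intro rot_beta_group)
  have "((\<lambda>t. \<integral>U. H (rot u a b t U) \<partial>M) has_vector_derivative (\<integral>U. H' (rot u a b 0 U) \<partial>M)) (at 0)"
  proof (rule has_vector_derivative_integral[where C = C])
    show "integrable M (\<lambda>U. H (rot u a b t U))" for t
      by (rule integrable_const_bound[of _ D]) (use AE_G D rotG in \<open>auto elim!: eventually_mono\<close>)
    show "AE U in M. \<forall>t. ((\<lambda>t. H (rot u a b t U)) has_vector_derivative H' (rot u a b t U)) (at t) \<and>
            cmod (H' (rot u a b t U)) \<le> C"
      using AE_G
    proof eventually_elim
      case (elim U)
      have "((\<lambda>t. H (rot u a b t U)) has_vector_derivative H' (rot u a b t U)) (at t)" for t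
      proof -
        \<comment> \<open>The derivative at time \<open>t\<close> is the derivative at time 0 at the
          rotated matrix; the shift by \<open>t\<close> is undone by the group law.\<close>
        have "((\<lambda>h. H (rot u a b h (rot u a b t U))) has_vector_derivative H' (rot u a b t U)) (at (t - t))"
          using d by (simp add: lie_deriv_def)
        then have "(((\<lambda>h. H (rot u a b h (rot u a b t U))) \<circ> (\<lambda>s. s - t)) has_vector_derivative 1 *\<^sub>R H' (rot u a b t U)) (at t)"
          by (intro vector_diff_chain_at) (auto intro!: derivative_eq_intros)
        then show ?thesis
          by (simp add: o_def rot_rot[OF assms(3) u])
      qed
      then show ?case using C rotG[OF elim] by auto
    qed
  qed measurable
  then have "((\<lambda>t. \<integral>U. H U \<partial>M) has_vector_derivative (\<integral>U. H' U \<partial>M)) (at (0::real))"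
    using assms by (simp add: integral_rot)
  moreover have "((\<lambda>t. \<integral>U. H U \<partial>M) has_vector_derivative 0) (at (0::real))"
    by simp
  ultimately show ?thesis by (rule vector_derivative_unique_at)
qed

section \<open>Bounds on entries and the algebra of column projections\<close>

lemma nice_entry [simp]: "nice (\<lambda>U. U i j)"
proof -
  have "cmod (U i j) \<le> 1" if "U \<in> G" for U
  proof (cases "i < n \<and> j < n")
    case True
    have "(\<Sum>k<n. complex_of_real ((cmod (U k j))\<^sup>2)) = 1"
      using G_cols[OF that, of j j] True by (subst complex_norm_square) (simp add: mult.commute)
    then have "(\<Sum>k<n. (cmod (U k j))\<^sup>2) = 1"
      by (metis of_real_eq_1_iff of_real_sum)
    moreover have "(cmod (U i j))\<^sup>2 \<le> (\<Sum>k<n. (cmod (U k j))\<^sup>2)"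
      using True by (intro member_le_sum) auto
    ultimately show ?thesis by (simp add: abs_square_le_1)
  next
    case False
    then show ?thesis using G_supported[OF that] by (auto simp: supported_def)
  qed
  then show ?thesis by (auto simp: nice_def)
qed

lemma nice_cnj [intro]: "nice f \<Longrightarrow> nice (\<lambda>U. cnj (f U))"
  using measurable_compose[of f borel borel cnj] borel_measurable_continuous_onI[OF continuous_on_cnj[OF continuous_on_id]]
  by (simp add: nice_def)

lemma nice_Zb [simp]: "nice (\<lambda>U. Zb J U x y)"
  unfolding Zb_def by (intro nice_sum nice_mult nice_cnj nice_entry)

text \<open>Orthonormality of the columns turns the product of two projections into the projection
  on the common columns; for \<open>J = J'\<close> this is idempotence.\<close>

lemma Zb_parseval:
  assumes U: "U \<in> G" and "J \<subseteq> {..<n}" "J' \<subseteq> {..<n}"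
  shows "(\<Sum>y<n. Zb J U x y * Zb J' U y z) = Zb (J \<inter> J') U x z"
proof -
  have fin: "finite J" "finite J'" using assms finite_subset by blast+
  have "(\<Sum>y<n. Zb J U x y * Zb J' U y z) = (\<Sum>y<n. \<Sum>j\<in>J. \<Sum>l\<in>J'. U x j * cnj (U z l) * (cnj (U y j) * U y l))"
    unfolding Zb_def sum_product by (intro sum.cong refl) (simp add: mult_ac)
  also have "\<dots> = (\<Sum>j\<in>J. \<Sum>l\<in>J'. U x j * cnj (U z l) * (\<Sum>y<n. cnj (U y j) * U y l))"
    by (subst sum.swap, rule sum.cong[OF refl], subst sum.swap) (simp add: sum_distrib_left)
  also have "\<dots> = (\<Sum>j\<in>J. \<Sum>l\<in>J'. if j = l then U x j * cnj (U z l) else 0)"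
    using assms by (intro sum.cong refl, subst G_cols[OF U]) auto
  also have "\<dots> = (\<Sum>j\<in>J. if j \<in> J' then U x j * cnj (U z j) else 0)"
    using fin by (simp add: sum.delta)
  also have "\<dots> = Zb (J \<inter> J') U x z"
    using fin by (simp add: Zb_def sum.inter_restrict)
  finally show ?thesis .
qed

lemma cnj_Zb: "cnj (Zb J U x y) = Zb J U y x"
  by (simp add: Zb_def mult.commute)

lemma Zb_diag: "Zb J U x x = of_real (\<Sum>j\<in>J. (cmod (U x j))\<^sup>2)"
  by (simp add: Zb_def complex_norm_square[symmetric])

lemma Zb_trace:
  assumes U: "U \<in> G" and "J \<subseteq> {..<n}"
  shows "(\<Sum>x<n. Zb J U x x) = of_nat (card J)"
proof -
  have "(\<Sum>x<n. Zb J U x x) = (\<Sum>j\<in>J. \<Sum>x<n. cnj (U x j) * U x j)"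
    unfolding Zb_def by (subst sum.swap) (simp add: mult.commute)
  also have "\<dots> = (\<Sum>j\<in>J. 1)" using assms by (intro sum.cong) (auto simp: G_cols[OF U])
  finally show ?thesis by simp
qed

lemma Zb_row_eq:
  assumes "U \<in> G" "J \<subseteq> {..<n}"
  shows "(\<Sum>y<n. (cmod (Zb J U x y))\<^sup>2) = (\<Sum>j\<in>J. (cmod (U x j))\<^sup>2)"
proof -
  have "complex_of_real (\<Sum>y<n. (cmod (Zb J U x y))\<^sup>2) = (\<Sum>y<n. Zb J U x y * Zb J U y x)"
    by (simp add: complex_norm_square cnj_Zb del: of_real_power)
  also have "\<dots> = of_real (\<Sum>j\<in>J. (cmod (U x j))\<^sup>2)"
    using assms by (simp add: Zb_parseval Zb_diag)
  finally show ?thesis using of_real_eq_iff by blast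
qed

text \<open>The group is defined through its columns only. The bound on rows comes from idempotence:
  \<open>Z_xx^2 \<le> sum_y |Z_xy|^2 = Z_xx\<close> forces \<open>Z_xx \<le> 1\<close>. Rows outside
  the range are zero.\<close>

lemma row_norm_le:
  assumes "U \<in> G" "J \<subseteq> {..<n}"
  shows "(\<Sum>j\<in>J. (cmod (U x j))\<^sup>2) \<le> 1"
proof (cases "x < n")
  case True
  let ?S = "\<Sum>j\<in>J. (cmod (U x j))\<^sup>2"
  have "(cmod (Zb J U x x))\<^sup>2 \<le> ?S"
    unfolding Zb_row_eq[OF assms, symmetric] using True by (intro member_le_sum) auto
  then have "?S * ?S \<le> 1 * ?S" by (simp add: Zb_diag power2_eq_square norm_mult[symmetric] del: of_real_sum)
  then show ?thesis by (cases "?S > 0") (simp_all add: not_less sum_nonneg)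
next
  case False
  then show ?thesis using G_supported[OF assms(1)] by (simp add: supported_def)
qed

lemma Zb_row_le: "U \<in> G \<Longrightarrow> J \<subseteq> {..<n} \<Longrightarrow> (\<Sum>y<n. (cmod (Zb J U x y))\<^sup>2) \<le> 1"
  by (simp add: Zb_row_eq row_norm_le)

lemma Zb_col_le: "U \<in> G \<Longrightarrow> J \<subseteq> {..<n} \<Longrightarrow> (\<Sum>y<n. (cmod (Zb J U y x))\<^sup>2) \<le> 1"
  using Zb_row_le[of U J x] cnj_Zb[of J U x] by (metis (no_types, lifting) complex_mod_cnj sum.cong)

end

section \<open>Schwinger--Dyson equations\<close>

context haar
begin

lemma nice_integral_sum: "(\<And>k. k \<in> K \<Longrightarrow> nice (f k)) \<Longrightarrow> (\<integral>U. (\<Sum>k\<in>K. f k U) \<partial>M) = (\<Sum>k\<in>K. \<integral>U. f k U \<partial>M)"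
  by (rule Bochner_Integration.integral_sum) (rule nice_integrable)

lemma nice_measurable_M: "nice f \<Longrightarrow> f \<in> borel_measurable M"
  using nice_measurable by (simp add: measurable_M)

text \<open>The trace of the projection over the rows in \<open>A\<close>, kept complex valued so
  that the calculus of derivatives applies to it.\<close>

definition blk :: "nat set \<Rightarrow> nat set \<Rightarrow> cmat \<Rightarrow> complex" where
  "blk A J U = (\<Sum>x\<in>A. Zb J U x x)"

text \<open>The weight with which mixing rows \<open>a\<close> and \<open>b\<close> changes a trace
  over \<open>A\<close>: nonzero only if exactly one of the two rows lies in
  \<open>A\<close>.\<close>

definition cw :: "nat set \<Rightarrow> nat \<Rightarrow> nat \<Rightarrow> complex" where
  "cw A a b = of_bool (a \<in> A) - of_bool (b \<in> A)"

lemma cw_same [simp]: "cw A a a = 0" by (simp add: cw_def)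

lemma norm_cw: "cmod (cw A a b) \<le> 1" by (simp add: cw_def)

lemma nice_blk [simp]: "nice (blk A J)"
  unfolding blk_def by (intro nice_sum nice_Zb)

lemma lie_deriv_blk:
  assumes "finite A" "a \<noteq> d"
  shows "lie_deriv u a d (blk A J) (\<lambda>U. cw A a d * (u * Zb J U d a + cnj u * Zb J U a d))"
proof -
  have "lie_deriv u a d (\<lambda>U. \<Sum>x\<in>A. Zb J U x x)
    (\<lambda>U. \<Sum>x\<in>A. of_bool (x = a) * u * Zb J U d x - of_bool (x = d) * cnj u * Zb J U a x
       + of_bool (x = a) * cnj u * Zb J U x d - of_bool (x = d) * u * Zb J U x a)"
    by (intro lie_deriv_sum lie_deriv_Zb assms)
  also have "(\<lambda>U. \<Sum>x\<in>A. of_bool (x = a) * u * Zb J U d x - of_bool (x = d) * cnj u * Zb J U a x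
       + of_bool (x = a) * cnj u * Zb J U x d - of_bool (x = d) * u * Zb J U x a) =
     (\<lambda>U. cw A a d * (u * Zb J U d a + cnj u * Zb J U a d))"
  proof
    fix U
    have *: "(\<Sum>x\<in>A. of_bool (x = y) * v * f x) = of_bool (y \<in> A) * v * f y" for y and v :: complex and f
      using assms(1) by (simp add: of_bool_def if_distrib[where f = "\<lambda>t. t * _"] cong: if_cong)
    show "(\<Sum>x\<in>A. of_bool (x = a) * u * Zb J U d x - of_bool (x = d) * cnj u * Zb J U a x
       + of_bool (x = a) * cnj u * Zb J U x d - of_bool (x = d) * u * Zb J U x a) =
       cw A a d * (u * Zb J U d a + cnj u * Zb J U a d)"
      unfolding sum.distrib sum_subtractf * by (simp add: cw_def algebra_simps)
  qed
  finally show ?thesis by (simp add: blk_def[abs_def])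
qed

definition lin :: "('k \<Rightarrow> complex) \<Rightarrow> ('k \<Rightarrow> nat set) \<Rightarrow> ('k \<Rightarrow> nat set) \<Rightarrow> 'k set \<Rightarrow> cmat \<Rightarrow> complex" where
  "lin c A J K U = (\<Sum>k\<in>K. c k * blk (A k) (J k) U)"

lemma nice_lin [simp]: "nice (lin c A J K)"
  unfolding lin_def by (intro nice_sum nice_mult nice_const nice_blk)

definition dlin :: "('k \<Rightarrow> complex) \<Rightarrow> ('k \<Rightarrow> nat set) \<Rightarrow> ('k \<Rightarrow> nat set) \<Rightarrow> 'k set \<Rightarrow> complex \<Rightarrow> nat \<Rightarrow> nat \<Rightarrow> cmat \<Rightarrow> complex" where
  "dlin c A J K u a d U = (\<Sum>k\<in>K. c k * (cw (A k) a d * (u * Zb (J k) U d a + cnj u * Zb (J k) U a d)))"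

lemma nice_dlin [simp]: "nice (dlin c A J K u a d)"
  unfolding dlin_def by (intro nice_sum nice_mult nice_add nice_const nice_Zb)

lemma dlin_same [simp]: "dlin c A J K u a a U = 0"
  by (simp add: dlin_def)

lemma lie_deriv_lin:
  assumes "\<And>k. k \<in> K \<Longrightarrow> finite (A k)" "a \<noteq> d"
  shows "lie_deriv u a d (lin c A J K) (dlin c A J K u a d)"
  unfolding lin_def[abs_def] dlin_def[abs_def]
  by (intro lie_deriv_sum lie_deriv_cmult lie_deriv_blk assms)

text \<open>Differentiating \<open>Z\<^bsub>da\<^esub>\<close> along the rotation of the rows
  \<open>a\<close>, \<open>d\<close> and summing over \<open>d\<close> reproduces the centred diagonal entry \<open>Z\<^bsub>aa\<^esub>\<close>.\<close>

lemma sd_diag: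
  assumes a: "a < n" and u: "adm \<beta> u" and J: "J \<subseteq> {..<n}" and A: "\<And>k. k \<in> K \<Longrightarrow> finite (A k)"
    and F: "\<And>z. (F has_field_derivative F' z) (at z)"
    and nF: "nice (\<lambda>U. F (lin c A B K U))" "nice (\<lambda>U. F' (lin c A B K U))"
  shows "(\<integral>U. (of_nat n * Zb J U a a - of_nat (card J)) * F (lin c A B K U) \<partial>M) =
    (\<integral>U. F' (lin c A B K U) * (\<Sum>d<n. u * Zb J U d a * dlin c A B K u a d U) \<partial>M)"
proof -
  let ?X = "lin c A B K"
  \<comment> \<open>The factor \<open>u\<close> in the test function cancels the conjugate phase
    produced by differentiation, so \<open>u * Zb J U d a\<close> has the phase-free derivative
    \<open>Zb J U d d - Zb J U a a\<close>.\<close>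
  let ?D = "\<lambda>d U. u * Zb J U d a * (F' (?X U) * dlin c A B K u a d U) + (Zb J U d d - Zb J U a a) * F (?X U)"
  have uu: "u * (cnj u * z) = z" for z
    using u cmod_1_mult_cnj[of u] by (simp add: adm_def mult.assoc[symmetric])
  have nice_D: "nice (?D d)" for d
    by (intro nice_add nice_mult nice_diff nice_const nice_Zb nF nice_dlin)
  have 0: "(\<integral>U. ?D d U \<partial>M) = 0" if "d \<in> {..<n} - {a}" for d
  proof (rule integral_lie_deriv)
    have ad: "a \<noteq> d" using that by auto
    have "lie_deriv u a d (\<lambda>U. (u * Zb J U d a) * F (?X U))
      (\<lambda>U. (u * Zb J U d a) * (F' (?X U) * dlin c A B K u a d U)
       + (u * (of_bool (d = a) * u * Zb J U d a - of_bool (d = d) * cnj u * Zb J U a a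
       + of_bool (a = a) * cnj u * Zb J U d d - of_bool (a = d) * u * Zb J U d a)) * F (?X U))"
      by (intro lie_deriv_mult lie_deriv_cmult lie_deriv_Zb lie_deriv_chain[where f = F] lie_deriv_lin F A ad)
    also have "(\<lambda>U. (u * Zb J U d a) * (F' (?X U) * dlin c A B K u a d U)
       + (u * (of_bool (d = a) * u * Zb J U d a - of_bool (d = d) * cnj u * Zb J U a a
       + of_bool (a = a) * cnj u * Zb J U d d - of_bool (a = d) * u * Zb J U d a)) * F (?X U)) = ?D d"
      using ad by (auto simp: fun_eq_iff algebra_simps uu)
    finally show "lie_deriv u a d (\<lambda>U. (u * Zb J U d a) * F (?X U)) (?D d)" .
    show "nice (\<lambda>U. (u * Zb J U d a) * F (?X U))"
      by (intro nice_mult nice_const nice_Zb nF)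
  qed (use that a u nice_D in auto)
  have "(\<integral>U. (\<Sum>d\<in>{..<n} - {a}. ?D d U) \<partial>M) = (\<Sum>d\<in>{..<n} - {a}. \<integral>U. ?D d U \<partial>M)"
    by (rule nice_integral_sum) (rule nice_D)
  also have "\<dots> = 0" by (rule sum.neutral) (use 0 in blast)
  finally have int0: "(\<integral>U. (\<Sum>d\<in>{..<n} - {a}. ?D d U) \<partial>M) = 0" .
  note int0
  also have "(\<integral>U. (\<Sum>d\<in>{..<n} - {a}. ?D d U) \<partial>M) =
     (\<integral>U. F' (?X U) * (\<Sum>d<n. u * Zb J U d a * dlin c A B K u a d U)
         - (of_nat n * Zb J U a a - of_nat (card J)) * F (?X U) \<partial>M)"
  proof (rule integral_cong_AE)
    show "AE U in M. (\<Sum>d\<in>{..<n} - {a}. ?D d U) = F' (?X U) * (\<Sum>d<n. u * Zb J U d a * dlin c A B K u a d U)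
         - (of_nat n * Zb J U a a - of_nat (card J)) * F (?X U)"
      using AE_G
    proof eventually_elim
      case (elim U)
      \<comment> \<open>The summand vanishes at \<open>d = a\<close>, so the sum may run over all
        rows and the full trace appears.\<close>
      have "(\<Sum>d\<in>{..<n} - {a}. ?D d U) = (\<Sum>d<n. ?D d U)"
        by (rule sum.mono_neutral_left) auto
      also have "\<dots> = F' (?X U) * (\<Sum>d<n. u * Zb J U d a * dlin c A B K u a d U)
         + ((\<Sum>d<n. Zb J U d d) - of_nat n * Zb J U a a) * F (?X U)"
        by (simp add: sum.distrib sum_subtractf sum_distrib_left sum_distrib_right algebra_simps)
      finally show ?case using Zb_trace[OF elim J] by (simp add: algebra_simps)
    qed
  qed (rule nice_measurable_M, intro nice_sum nice_diff nice_mult nF nice_add nice_const nice_Zb nice_dlin)+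
  also have "\<dots> = (\<integral>U. F' (?X U) * (\<Sum>d<n. u * Zb J U d a * dlin c A B K u a d U) \<partial>M)
         - (\<integral>U. (of_nat n * Zb J U a a - of_nat (card J)) * F (?X U) \<partial>M)"
    by (intro Bochner_Integration.integral_diff nice_integrable nice_mult nice_sum nF nice_diff nice_const nice_Zb nice_dlin)
  finally show ?thesis by simp
qed

text \<open>The random quantity \<Gamma> for a pair of block sums: \<open>n\<close> times the
  covariance of the two sums is \<open>2 / \<beta>\<close> times its mean.\<close>

definition gam :: "nat set \<Rightarrow> nat set \<Rightarrow> nat set \<Rightarrow> nat set \<Rightarrow> cmat \<Rightarrow> complex" where
  "gam A J A' J' U = (\<Sum>a\<in>A. \<Sum>b<n. cw A' a b * (Zb J' U a b * Zb J U b a))"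

lemma nice_gam [simp]: "nice (gam A J A' J')"
  unfolding gam_def by (intro nice_sum nice_mult nice_const nice_Zb)

text \<open>The origin of \<open>2 / \<beta>\<close>. Multiplying \<open>dlin\<close> by
  \<open>u * Zb J U d a\<close> gives one term with phase \<open>u^2\<close> and one without phase.
  For real matrices the two coincide, which yields 2. In the unitary case both phases 1 and \<i> are
  admissible, and adding the two identities cancels the \<open>u^2\<close> terms.\<close>

lemma sd_diag_avg:
  assumes b: "\<beta> = 1 \<or> \<beta> = 2" and a: "a < n" and J: "J \<subseteq> {..<n}" and A: "\<And>k. k \<in> K \<Longrightarrow> finite (A k)"
    and F: "\<And>z. (F has_field_derivative F' z) (at z)"
    and nF: "nice (\<lambda>U. F (lin c A B K U))" "nice (\<lambda>U. F' (lin c A B K U))"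
  shows "(\<integral>U. (of_nat n * Zb J U a a - of_nat (card J)) * F (lin c A B K U) \<partial>M) =
    of_real (2 / \<beta>) * (\<integral>U. F' (lin c A B K U) * (\<Sum>d<n. \<Sum>k\<in>K. c k * (cw (A k) a d * (Zb (B k) U a d * Zb J U d a))) \<partial>M)"
proof -
  let ?X = "lin c A B K"
  let ?L = "\<integral>U. (of_nat n * Zb J U a a - of_nat (card J)) * F (?X U) \<partial>M"
  let ?f = "\<lambda>u U. F' (?X U) * (\<Sum>d<n. u * Zb J U d a * dlin c A B K u a d U)"
  let ?g = "\<lambda>U. F' (?X U) * (\<Sum>d<n. \<Sum>k\<in>K. c k * (cw (A k) a d * (Zb (B k) U a d * Zb J U d a)))"
  have nf: "nice (?f u)" for u
    by (intro nice_mult nice_sum nF nice_diff nice_const nice_Zb nice_dlin)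
  have ng: "nice ?g"
    by (intro nice_mult nice_sum nF nice_diff nice_const nice_Zb)
  have L: "?L = (\<integral>U. ?f u U \<partial>M)" if "adm \<beta> u" for u
    by (rule sd_diag[OF a that J A F nF])
  from b show ?thesis
  proof
    assume b: "\<beta> = 1"
    have "(\<integral>U. ?f 1 U \<partial>M) = (\<integral>U. 2 * ?g U \<partial>M)"
    proof (rule integral_cong_AE)
      show "AE U in M. ?f 1 U = 2 * ?g U"
        using AE_G
      proof eventually_elim
        case (elim U)
        have "U i j \<in> \<real>" for i j
          using elim b by (simp add: beta_group_def orthogonal_group_def)
        then have "Zb B U x y = Zb B U y x" for B x y
          by (simp add: Zb_def Reals_cnj_iff mult.commute)
        then have "Zb J U d a * dlin c A B K 1 a d U = 2 * (\<Sum>k\<in>K. c k * (cw (A k) a d * (Zb (B k) U a d * Zb J U d a)))" for d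
          by (simp add: dlin_def sum_distrib_left algebra_simps)
        then show ?case by (simp add: sum_distrib_left[symmetric] mult.left_commute)
      qed
    qed (use nf[of 1] ng in \<open>auto dest!: nice_measurable simp: measurable_M\<close>)
    then show ?thesis using L[of 1] b by (simp add: adm_def)
  next
    assume b: "\<beta> = 2"
    have "?f 1 U + ?f \<i> U = 2 * ?g U" for U
    proof -
      have "1 * Zb J U d a * dlin c A B K 1 a d U + \<i> * Zb J U d a * dlin c A B K \<i> a d U =
         2 * (\<Sum>k\<in>K. c k * (cw (A k) a d * (Zb (B k) U a d * Zb J U d a)))" for d
        by (simp add: dlin_def sum_distrib_left sum.distrib[symmetric] algebra_simps)
      then have "(\<Sum>d<n. 1 * Zb J U d a * dlin c A B K 1 a d U) + (\<Sum>d<n. \<i> * Zb J U d a * dlin c A B K \<i> a d U) =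
          2 * (\<Sum>d<n. \<Sum>k\<in>K. c k * (cw (A k) a d * (Zb (B k) U a d * Zb J U d a)))"
        unfolding sum.distrib[symmetric] sum_distrib_left by simp
      then show ?thesis unfolding distrib_left[symmetric] by (simp add: mult.left_commute)
    qed
    then have "(\<integral>U. 2 * ?g U \<partial>M) = (\<integral>U. ?f 1 U + ?f \<i> U \<partial>M)" by simp
    also have "\<dots> = (\<integral>U. ?f 1 U \<partial>M) + (\<integral>U. ?f \<i> U \<partial>M)"
      by (intro Bochner_Integration.integral_add nice_integrable nf)
    also have "\<dots> = 2 * ?L" using L[of 1] L[of \<i>] b by (simp add: adm_def)
    finally have "2 * ?L = 2 * (\<integral>U. ?g U \<partial>M)" by simp
    then show ?thesis using b by simp
  qed
qed

lemma sd_blk: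
  assumes b: "\<beta> = 1 \<or> \<beta> = 2" and J: "J \<subseteq> {..<n}" "A0 \<subseteq> {..<n}" and A: "\<And>k. k \<in> K \<Longrightarrow> finite (A k)"
    and F: "\<And>z. (F has_field_derivative F' z) (at z)"
    and nF: "nice (\<lambda>U. F (lin c A B K U))" "nice (\<lambda>U. F' (lin c A B K U))"
  shows "(\<integral>U. (of_nat n * blk A0 J U - of_nat (card A0 * card J)) * F (lin c A B K U) \<partial>M) =
    of_real (2 / \<beta>) * (\<integral>U. F' (lin c A B K U) * (\<Sum>k\<in>K. c k * gam A0 J (A k) (B k) U) \<partial>M)"
proof -
  let ?X = "lin c A B K"
  let ?g = "\<lambda>a U. F' (?X U) * (\<Sum>d<n. \<Sum>k\<in>K. c k * (cw (A k) a d * (Zb (B k) U a d * Zb J U d a)))"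
  have ng: "nice (?g a)" for a
    by (intro nice_mult nice_sum nF nice_diff nice_const nice_Zb)
  have "(of_nat n * blk A0 J U - of_nat (card A0 * card J)) * F (?X U) =
     (\<Sum>a\<in>A0. (of_nat n * Zb J U a a - of_nat (card J)) * F (?X U))" for U
    by (simp add: blk_def sum_distrib_left sum_distrib_right sum_subtractf left_diff_distrib)
  then have "(\<integral>U. (of_nat n * blk A0 J U - of_nat (card A0 * card J)) * F (?X U) \<partial>M) =
     (\<Sum>a\<in>A0. (\<integral>U. (of_nat n * Zb J U a a - of_nat (card J)) * F (?X U) \<partial>M))"
    by (simp add: Bochner_Integration.integral_sum nice_integrable nice_mult nice_diff nF)
  also have "\<dots> = (\<Sum>a\<in>A0. of_real (2 / \<beta>) * (\<integral>U. ?g a U \<partial>M))"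
    using J by (intro sum.cong refl sd_diag_avg[OF b _ _ A F nF]) auto
  also have "\<dots> = of_real (2 / \<beta>) * (\<integral>U. (\<Sum>a\<in>A0. ?g a U) \<partial>M)"
    by (subst nice_integral_sum[where f = ?g, OF ng]) (rule sum_distrib_left[symmetric])
  also have "(\<lambda>U. \<Sum>a\<in>A0. ?g a U) = (\<lambda>U. F' (?X U) * (\<Sum>k\<in>K. c k * gam A0 J (A k) (B k) U))"
  proof
    fix U
    have "(\<Sum>k\<in>K. c k * gam A0 J (A k) (B k) U) = (\<Sum>k\<in>K. \<Sum>a\<in>A0. \<Sum>d<n. c k * (cw (A k) a d * (Zb (B k) U a d * Zb J U d a)))"
      by (simp add: gam_def sum_distrib_left)
    also have "\<dots> = (\<Sum>a\<in>A0. \<Sum>d<n. \<Sum>k\<in>K. c k * (cw (A k) a d * (Zb (B k) U a d * Zb J U d a)))"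
      by (subst sum.swap) (intro sum.cong refl sum.swap)
    finally show "(\<Sum>a\<in>A0. ?g a U) = F' (?X U) * (\<Sum>k\<in>K. c k * gam A0 J (A k) (B k) U)"
      by (simp add: sum_distrib_left)
  qed
  finally show ?thesis .
qed


text \<open>The test function is \<open>Zb J' U d b * Zb J U b a\<close>, rotated in the rows
  \<open>a\<close> and \<open>d\<close>. Summing over \<open>d\<close> contracts a product of
  projections to \<open>Zb (J' \<inter> J)\<close>, while \<open>Zb J' U a b * Zb J U b a\<close> is
  subtracted \<open>n\<close> times in total. So the off-diagonal products that make up \<Gamma> are
  expressed through diagonal entries. The phase 1 is enough here because the extra term
  \<open>Zb J' U b a * Zb J U b a\<close> turns out to be of lower order.\<close>

lemma sd_off_diag:
  assumes ab: "a < n" "b < n" "a \<noteq> b" and J: "J \<subseteq> {..<n}" "J' \<subseteq> {..<n}" and A: "\<And>k. k \<in> K \<Longrightarrow> finite (A k)"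
    and F: "\<And>z. (F has_field_derivative F' z) (at z)"
    and nF: "nice (\<lambda>U. F (lin c A B K U))" "nice (\<lambda>U. F' (lin c A B K U))"
  shows "(\<integral>U. (Zb (J' \<inter> J) U b b - Zb J' U b b * Zb J U a a - Zb J' U b a * Zb J U b a
       - of_nat n * (Zb J' U a b * Zb J U b a)) * F (lin c A B K U)
     + F' (lin c A B K U) * (\<Sum>d<n. Zb J' U d b * Zb J U b a * dlin c A B K 1 a d U) \<partial>M) = 0"
proof -
  let ?X = "lin c A B K"
  \<comment> \<open>At \<open>d = b\<close> the row \<open>b\<close> is itself rotated and each of
    its occurrences contributes; every other \<open>d\<close> gives the generic derivative.\<close>
  let ?E = "\<lambda>d U. of_bool (d = b) * (Zb J' U b b * (Zb J U b b - Zb J U a a) - (Zb J' U a b + Zb J' U b a) * Zb J U b a)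
       + of_bool (d \<noteq> b) * (Zb J' U d b * Zb J U b d - Zb J' U a b * Zb J U b a)"
  let ?D = "\<lambda>d U. Zb J' U d b * Zb J U b a * (F' (?X U) * dlin c A B K 1 a d U) + ?E d U * F (?X U)"
  have nice_D: "nice (?D d)" for d
    by (intro nice_add nice_mult nice_diff nice_const nice_Zb nF nice_dlin)
  have 0: "(\<integral>U. ?D d U \<partial>M) = 0" if "d \<in> {..<n} - {a}" for d
  proof (rule integral_lie_deriv)
    have ad: "a \<noteq> d" using that by auto
    let ?Z = "\<lambda>J x y U. of_bool (x = a) * 1 * Zb J U d y - of_bool (x = d) * cnj 1 * Zb J U a y
       + of_bool (y = a) * cnj 1 * Zb J U x d - of_bool (y = d) * 1 * Zb J U x a"
    have "lie_deriv 1 a d (\<lambda>U. (Zb J' U d b * Zb J U b a) * F (?X U))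
      (\<lambda>U. (Zb J' U d b * Zb J U b a) * (F' (?X U) * dlin c A B K 1 a d U)
       + (Zb J' U d b * ?Z J b a U + ?Z J' d b U * Zb J U b a) * F (?X U))"
      by (intro lie_deriv_mult lie_deriv_cmult lie_deriv_Zb lie_deriv_chain[where f = F] lie_deriv_lin F A ad)
    also have "(\<lambda>U. (Zb J' U d b * Zb J U b a) * (F' (?X U) * dlin c A B K 1 a d U)
       + (Zb J' U d b * ?Z J b a U + ?Z J' d b U * Zb J U b a) * F (?X U)) = ?D d"
      using ad ab by (auto simp: fun_eq_iff algebra_simps)
    finally show "lie_deriv 1 a d (\<lambda>U. (Zb J' U d b * Zb J U b a) * F (?X U)) (?D d)" .
    show "nice (\<lambda>U. (Zb J' U d b * Zb J U b a) * F (?X U))"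
      by (intro nice_mult nice_const nice_Zb nF)
  qed (use that ab nice_D in \<open>auto simp: adm_def\<close>)
  have "(\<integral>U. (\<Sum>d\<in>{..<n} - {a}. ?D d U) \<partial>M) = (\<Sum>d\<in>{..<n} - {a}. \<integral>U. ?D d U \<partial>M)"
    by (rule nice_integral_sum) (rule nice_D)
  also have "\<dots> = 0" by (rule sum.neutral) (use 0 in blast)
  finally have int0: "(\<integral>U. (\<Sum>d\<in>{..<n} - {a}. ?D d U) \<partial>M) = 0" .
  have eqI: "(\<integral>U. (\<Sum>d\<in>{..<n} - {a}. ?D d U) \<partial>M) =
     (\<integral>U. (Zb (J' \<inter> J) U b b - Zb J' U b b * Zb J U a a - Zb J' U b a * Zb J U b a
       - of_nat n * (Zb J' U a b * Zb J U b a)) * F (?X U)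
     + F' (?X U) * (\<Sum>d<n. Zb J' U d b * Zb J U b a * dlin c A B K 1 a d U) \<partial>M)"
  proof (rule integral_cong_AE)
    show "AE U in M. (\<Sum>d\<in>{..<n} - {a}. ?D d U) =
      (Zb (J' \<inter> J) U b b - Zb J' U b b * Zb J U a a - Zb J' U b a * Zb J U b a
       - of_nat n * (Zb J' U a b * Zb J U b a)) * F (?X U)
     + F' (?X U) * (\<Sum>d<n. Zb J' U d b * Zb J U b a * dlin c A B K 1 a d U)"
      using AE_G
    proof eventually_elim
      case (elim U)
      have 1: "(\<Sum>d\<in>{..<n} - {a}. Zb J' U d b * Zb J U b a * (F' (?X U) * dlin c A B K 1 a d U))
        = F' (?X U) * (\<Sum>d<n. Zb J' U d b * Zb J U b a * dlin c A B K 1 a d U)"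
      proof -
        have "(\<Sum>d\<in>{..<n} - {a}. Zb J' U d b * Zb J U b a * (F' (?X U) * dlin c A B K 1 a d U))
          = (\<Sum>d<n. Zb J' U d b * Zb J U b a * (F' (?X U) * dlin c A B K 1 a d U))"
          by (rule sum.mono_neutral_left) auto
        then show ?thesis by (simp add: sum_distrib_left mult_ac)
      qed
      have "(\<Sum>d<n. Zb J' U d b * Zb J U b d) = Zb (J' \<inter> J) U b b"
        using Zb_parseval[OF elim J, of b b] by (simp add: mult.commute Int_commute)
      also have "(\<Sum>d<n. Zb J' U d b * Zb J U b d) =
         Zb J' U a b * Zb J U b a + Zb J' U b b * Zb J U b b + (\<Sum>d\<in>{..<n} - {a} - {b}. Zb J' U d b * Zb J U b d)"
        using ab by (subst sum.remove[of _ a]; simp; subst sum.remove[of _ b]; simp)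
      finally have rest: "(\<Sum>d\<in>{..<n} - {a} - {b}. Zb J' U d b * Zb J U b d) =
         Zb (J' \<inter> J) U b b - Zb J' U a b * Zb J U b a - Zb J' U b b * Zb J U b b"
        by (simp add: algebra_simps)
      \<comment> \<open>The count falls short of \<open>n\<close> by two; one further copy of
        \<open>Zb J' U a b * Zb J U b a\<close> comes from the contraction and one from the term
        \<open>d = b\<close>, which restores the factor \<open>n\<close>.\<close>
      have "card ({..<n} - {a} - {b}) = n - 2"
        using ab by (simp add: card_Diff_subset)
      then have card: "of_nat (card ({..<n} - {a} - {b})) = (of_nat n - 2 :: complex)"
        using ab by (simp add: of_nat_diff)
      have "(\<Sum>d\<in>{..<n} - {a}. ?E d U) = ?E b U + (\<Sum>d\<in>{..<n} - {a} - {b}. ?E d U)"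
        using ab by (subst sum.remove[of _ b]) auto
      also have "(\<Sum>d\<in>{..<n} - {a} - {b}. ?E d U) = (\<Sum>d\<in>{..<n} - {a} - {b}. Zb J' U d b * Zb J U b d - Zb J' U a b * Zb J U b a)"
        by (rule sum.cong) auto
      also have "\<dots> = Zb (J' \<inter> J) U b b - Zb J' U a b * Zb J U b a - Zb J' U b b * Zb J U b b - (of_nat n - 2) * (Zb J' U a b * Zb J U b a)"
        by (simp add: sum_subtractf rest card)
      finally have 2: "(\<Sum>d\<in>{..<n} - {a}. ?E d U) =
         Zb (J' \<inter> J) U b b - Zb J' U b b * Zb J U a a - Zb J' U b a * Zb J U b a
         - of_nat n * (Zb J' U a b * Zb J U b a)"
        by (simp add: algebra_simps)
      show ?case
        unfolding sum.distrib[of "\<lambda>d. Zb J' U d b * Zb J U b a * (F' (?X U) * dlin c A B K 1 a d U)"] 1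
          sum_distrib_right[symmetric] 2 by simp
    qed
  qed (rule nice_measurable_M, intro nice_sum nice_diff nice_mult nF nice_add nice_const nice_Zb nice_dlin)+
  show ?thesis by (rule trans[OF eqI[symmetric] int0])
qed

text \<open>The part of the second identity that survives in the limit. Only diagonal entries occur,
  so it is a polynomial in block sums, of order \<open>n^2\<close>.\<close>

definition gamR :: "nat set \<Rightarrow> nat set \<Rightarrow> nat set \<Rightarrow> nat set \<Rightarrow> cmat \<Rightarrow> complex" where
  "gamR A J A' J' U = (\<Sum>a\<in>A. \<Sum>b<n. cw A' a b * (Zb (J' \<inter> J) U b b - Zb J' U b b * Zb J U a a))"

text \<open>The part left over from using the single phase 1; it is of order \<open>n\<close> and
  hence negligible against \<open>gamR\<close>.\<close>

definition gamE :: "nat set \<Rightarrow> nat set \<Rightarrow> nat set \<Rightarrow> nat set \<Rightarrow> cmat \<Rightarrow> complex" where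
  "gamE A J A' J' U = (\<Sum>a\<in>A. \<Sum>b<n. cw A' a b * (Zb J' U b a * Zb J U b a))"

lemma nice_gamR [simp]: "nice (gamR A J A' J')" and nice_gamE [simp]: "nice (gamE A J A' J')"
  unfolding gamR_def gamE_def by (intro nice_sum nice_mult nice_const nice_Zb nice_diff)+

text \<open>The off-diagonal identity summed with the weights \<open>cw\<close>; the excluded case
  \<open>a = b\<close> carries weight 0. For bounded \<open>F\<close> and \<open>F'\<close> the
  three terms on the right have orders \<open>n^2\<close>, \<open>n\<close> and
  \<open>n^(3/2)\<close>.\<close>

lemma sd_gam:
  assumes J: "A0 \<subseteq> {..<n}" "J \<subseteq> {..<n}" "J' \<subseteq> {..<n}" and A: "\<And>k. k \<in> K \<Longrightarrow> finite (A k)"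
    and F: "\<And>z. (F has_field_derivative F' z) (at z)"
    and nF: "nice (\<lambda>U. F (lin c A B K U))" "nice (\<lambda>U. F' (lin c A B K U))"
  shows "of_nat n * (\<integral>U. gam A0 J A' J' U * F (lin c A B K U) \<partial>M) =
    (\<integral>U. gamR A0 J A' J' U * F (lin c A B K U) \<partial>M) - (\<integral>U. gamE A0 J A' J' U * F (lin c A B K U) \<partial>M) +
    (\<integral>U. F' (lin c A B K U) * (\<Sum>a\<in>A0. \<Sum>d<n. (\<Sum>b<n. cw A' a b * (Zb J' U d b * Zb J U b a)) * dlin c A B K 1 a d U) \<partial>M)"
proof -
  let ?X = "lin c A B K"
  let ?g = "\<lambda>a b U. cw A' a b * ((Zb (J' \<inter> J) U b b - Zb J' U b b * Zb J U a a - Zb J' U b a * Zb J U b a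
       - of_nat n * (Zb J' U a b * Zb J U b a)) * F (?X U)
     + F' (?X U) * (\<Sum>d<n. Zb J' U d b * Zb J U b a * dlin c A B K 1 a d U))"
  let ?H = "\<lambda>U. gamR A0 J A' J' U * F (?X U) - gamE A0 J A' J' U * F (?X U) - of_nat n * (gam A0 J A' J' U * F (?X U))"
  let ?W = "\<lambda>U. F' (?X U) * (\<Sum>a\<in>A0. \<Sum>d<n. (\<Sum>b<n. cw A' a b * (Zb J' U d b * Zb J U b a)) * dlin c A B K 1 a d U)"
  have ng: "nice (?g a b)" for a b
    by (intro nice_add nice_mult nice_diff nice_const nice_Zb nF nice_dlin nice_sum)
  have nW: "nice ?W"
    by (intro nice_add nice_mult nice_diff nice_const nice_Zb nF nice_dlin nice_sum)
  have g0: "(\<integral>U. ?g a b U \<partial>M) = 0" if "a < n" "b < n" for a b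
  proof (cases "a = b")
    case False
    show ?thesis
      using sd_off_diag[OF that False J(2,3) A F nF] by simp
  qed simp
  have "(\<integral>U. (\<Sum>a\<in>A0. \<Sum>b<n. ?g a b U) \<partial>M) = (\<Sum>a\<in>A0. \<integral>U. (\<Sum>b<n. ?g a b U) \<partial>M)"
    by (intro Bochner_Integration.integral_sum nice_integrable nice_sum ng)
  also have "\<dots> = (\<Sum>a\<in>A0. \<Sum>b<n. \<integral>U. ?g a b U \<partial>M)"
    by (intro sum.cong refl Bochner_Integration.integral_sum nice_integrable ng)
  also have "\<dots> = 0"
    using J(1) by (intro sum.neutral ballI g0) auto
  also have "(\<lambda>U. (\<Sum>a\<in>A0. \<Sum>b<n. ?g a b U)) = (\<lambda>U. ?H U + ?W U)"
  proof
    fix U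
    have "?g a b U = cw A' a b * (Zb (J' \<inter> J) U b b - Zb J' U b b * Zb J U a a) * F (?X U)
       - cw A' a b * (Zb J' U b a * Zb J U b a) * F (?X U)
       - of_nat n * (cw A' a b * (Zb J' U a b * Zb J U b a) * F (?X U))
       + F' (?X U) * (\<Sum>d<n. cw A' a b * (Zb J' U d b * Zb J U b a) * dlin c A B K 1 a d U)" for a b
      by (simp add: algebra_simps sum_distrib_left)
    then have "(\<Sum>a\<in>A0. \<Sum>b<n. ?g a b U) = ?H U +
      F' (?X U) * (\<Sum>a\<in>A0. \<Sum>b<n. \<Sum>d<n. cw A' a b * (Zb J' U d b * Zb J U b a) * dlin c A B K 1 a d U)"
      by (simp only: sum.distrib sum_subtractf sum_distrib_left[symmetric] sum_distrib_right[symmetric] gam_def gamR_def gamE_def)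
    also have "(\<Sum>a\<in>A0. \<Sum>b<n. \<Sum>d<n. cw A' a b * (Zb J' U d b * Zb J U b a) * dlin c A B K 1 a d U)
      = (\<Sum>a\<in>A0. \<Sum>d<n. (\<Sum>b<n. cw A' a b * (Zb J' U d b * Zb J U b a)) * dlin c A B K 1 a d U)"
      unfolding sum_distrib_right by (intro sum.cong refl sum.swap)
    finally show "(\<Sum>a\<in>A0. \<Sum>b<n. ?g a b U) = ?H U + ?W U" .
  qed
  also have "(\<integral>U. ?H U + ?W U \<partial>M) =
    (\<integral>U. gamR A0 J A' J' U * F (?X U) \<partial>M) - (\<integral>U. gamE A0 J A' J' U * F (?X U) \<partial>M)
     - of_nat n * (\<integral>U. gam A0 J A' J' U * F (?X U) \<partial>M) + (\<integral>U. ?W U \<partial>M)"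
    by (simp only: Bochner_Integration.integral_add Bochner_Integration.integral_diff integral_mult_right_zero
       nice_integrable nice_mult nice_add nice_diff nice_const nice_gam nice_gamR nice_gamE nF nW)
  finally show ?thesis by (simp add: algebra_simps)
qed

end

section \<open>Moments of block sums\<close>

definition Tr :: "nat set \<Rightarrow> nat set \<Rightarrow> cmat \<Rightarrow> real" where
  "Tr A J U = (\<Sum>x\<in>A. \<Sum>j\<in>J. (cmod (U x j))\<^sup>2)"

lemma T_pq_eq_Tr: "T_pq p q = Tr {..<p} {..<q}"
  by (simp add: T_pq_def Tr_def fun_eq_iff)

lemma Tr_nonneg: "0 \<le> Tr A J U"
  by (simp add: Tr_def sum_nonneg)

lemma measurable_Tr [measurable]: "Tr A J \<in> borel_measurable borel"
  unfolding Tr_def[abs_def] by measurable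

context haar
begin

lemma blk_eq_Tr: "blk A J U = of_real (Tr A J U)"
  by (simp add: blk_def Zb_diag Tr_def)

lemma Tr_le_rows: "U \<in> G \<Longrightarrow> J \<subseteq> {..<n} \<Longrightarrow> Tr A J U \<le> card A"
  unfolding Tr_def using sum_bounded_above[of A "\<lambda>x. \<Sum>j\<in>J. (cmod (U x j))\<^sup>2" 1] row_norm_le[of U J]
  by simp

lemma Tr_le_cols:
  assumes U: "U \<in> G" and J: "J \<subseteq> {..<n}" and A: "A \<subseteq> {..<n}"
  shows "Tr A J U \<le> card J"
proof -
  have "of_real (Tr {..<n} J U) = complex_of_real (card J)"
    using Zb_trace[OF U J] by (simp add: blk_eq_Tr[symmetric] blk_def)
  then have "Tr {..<n} J U = card J" by (simp only: of_real_eq_iff)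
  moreover have "Tr A J U \<le> Tr {..<n} J U"
    unfolding Tr_def using A by (intro sum_mono2) (auto intro: sum_nonneg)
  ultimately show ?thesis by simp
qed

lemma nice_of_real:
  assumes "nice (\<lambda>U. complex_of_real (f U))"
  shows "integrable M f" "(\<integral>U. complex_of_real (f U) \<partial>M) = of_real (\<integral>U. f U \<partial>M)"
proof -
  from nice_integrable[OF assms] show *: "integrable M f"
    using integrable_Re by fastforce
  show "(\<integral>U. complex_of_real (f U) \<partial>M) = of_real (\<integral>U. f U \<partial>M)"
    by simp
qed

lemma nice_Re:
  assumes "nice f" shows "nice (\<lambda>U. complex_of_real (Re (f U)))"
proof -
  have "complex_of_real (Re (f U)) = (1/2) * (f U + cnj (f U))" for U
    by (simp add: complex_add_cnj)
  then show ?thesis using assms by (simp only:) (intro nice_mult nice_add nice_cnj nice_const)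
qed

lemma nice_Tr: "nice (\<lambda>U. complex_of_real (Tr A J U))"
  using nice_blk[of A J] by (simp add: blk_eq_Tr[abs_def])

end

locale haar12 = haar +
  assumes beta: "\<beta> = 1 \<or> \<beta> = 2" and n: "0 < n"
begin

text \<open>The first identity for an empty linear combination with \<open>F = 1\<close> and
  \<open>F' = 0\<close>: nothing remains on the right.\<close>

lemma expectation_Tr:
  assumes "A \<subseteq> {..<n}" "J \<subseteq> {..<n}"
  shows "(\<integral>U. Tr A J U \<partial>M) = real (card A) * real (card J) / real n"
proof -
  have "(\<integral>U. (of_nat n * blk A J U - of_nat (card A * card J)) * 1 \<partial>M) = 0"
    using sd_blk[OF beta assms(2,1), of "{}" "\<lambda>_. {}" "\<lambda>_. 1" "\<lambda>_. 0" "\<lambda>_. 0 :: complex" "\<lambda>_. {} :: nat set"]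
    by simp
  also have "(\<integral>U. (of_nat n * blk A J U - of_nat (card A * card J)) * 1 \<partial>M) =
     (\<integral>U. complex_of_real (n * Tr A J U - card A * card J) \<partial>M)"
    by (simp add: blk_eq_Tr)
  also have "\<dots> = of_real (\<integral>U. n * Tr A J U - card A * card J \<partial>M)"
    by (rule nice_of_real, unfold of_real_diff of_real_mult) (intro nice_diff nice_mult nice_const nice_Tr)
  also have "(\<integral>U. n * Tr A J U - card A * card J \<partial>M) = n * (\<integral>U. Tr A J U \<partial>M) - card A * card J"
    by (subst Bochner_Integration.integral_diff) (use nice_of_real(1)[OF nice_Tr] prob_space in auto)
  finally have "n * (\<integral>U. Tr A J U \<partial>M) - card A * card J = 0" by (metis of_real_eq_0_iff)
  then show ?thesis using n by (simp add: field_simps)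
qed

definition Tc :: "nat set \<Rightarrow> nat set \<Rightarrow> cmat \<Rightarrow> real" where
  "Tc A J U = Tr A J U - real (card A) * real (card J) / real n"

lemma measurable_Tc [measurable]: "Tc A J \<in> borel_measurable borel"
  unfolding Tc_def[abs_def] by measurable

lemma nice_Tc: "nice (\<lambda>U. complex_of_real (Tc A J U))"
  unfolding Tc_def of_real_diff by (intro nice_diff nice_Tr nice_const)

lemma integrable_Tc_power: "integrable M (\<lambda>U. Tc A J U ^ k)"
  by (rule nice_of_real) (simp add: nice_power nice_Tc)

text \<open>Because the projection is Hermitian, only \<open>|Z_ab|^2\<close> with \<open>a\<close>
  inside and \<open>b\<close> outside \<open>A\<close> survives. Extending the sum to all
  \<open>b\<close> gives full row sums, which idempotence evaluates.\<close>

lemma gam_self: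
  assumes "U \<in> G" "A \<subseteq> {..<n}" "J \<subseteq> {..<n}"
  shows "\<exists>x. gam A J A J U = of_real x \<and> x \<le> Tr A J U"
proof -
  let ?x = "\<Sum>a\<in>A. \<Sum>b<n. (of_bool (a \<in> A) - of_bool (b \<in> A)) * (cmod (Zb J U a b))\<^sup>2"
  have *: "complex_of_real ((cmod (Zb J U a b))\<^sup>2) = Zb J U a b * Zb J U b a" for a b
    using complex_norm_square[of "Zb J U a b"] by (simp add: cnj_Zb)
  have "gam A J A J U = of_real ?x"
    unfolding gam_def cw_def of_real_sum of_real_mult * by (intro sum.cong refl) (auto simp: of_bool_def)
  moreover have "?x \<le> (\<Sum>a\<in>A. \<Sum>b<n. (cmod (Zb J U a b))\<^sup>2)"
    by (intro sum_mono) (auto simp: mult_le_0_iff)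
  then have "?x \<le> Tr A J U" using assms by (simp add: Zb_row_eq Tr_def)
  ultimately show ?thesis by blast
qed

text \<open>For \<open>F\<close> an odd power of the centred sum, \<open>F'\<close> is a nonnegative
  even power, so \<Gamma> may be replaced by an upper bound. The bound \<open>r\<close> is left
  open: it will be the number of rows for row increments and the number of columns for column
  increments.\<close>

lemma moment_step:
  assumes AJ: "A \<subseteq> {..<n}" "J \<subseteq> {..<n}" and r: "\<And>U. U \<in> G \<Longrightarrow> Tr A J U \<le> r"
  shows "(\<integral>U. Tc A J U ^ (2 * m + 2) \<partial>M) \<le> (2 * m + 1) * (2 * r / n) * (\<integral>U. Tc A J U ^ (2 * m) \<partial>M)"
proof -
  let ?K = "{()}" and ?c = "\<lambda>_::unit. 1::complex"
  let ?L = "lin ?c (\<lambda>_. A) (\<lambda>_. J) ?K"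
  let ?t = "of_real (real (card A) * real (card J) / real n) :: complex"
  let ?F = "\<lambda>z. (z - ?t) ^ (2 * m + 1)" and ?F' = "\<lambda>z. of_nat (2 * m + 1) * (z - ?t) ^ (2 * m)"
  have lin: "lin ?c (\<lambda>_. A) (\<lambda>_. J) ?K = blk A J" by (simp add: lin_def fun_eq_iff)
  have Tc: "blk A J U - ?t = of_real (Tc A J U)" for U by (simp add: blk_eq_Tr Tc_def)
  have fA: "finite A" using AJ finite_subset by blast
  define g where "g = (\<lambda>U. Re (gam A J A J U))"
  have g: "gam A J A J U = of_real (g U)" "g U \<le> r" if "U \<in> G" for U
    using gam_self[OF that AJ] r[OF that] by (auto simp: g_def)
  have mg: "g \<in> borel_measurable borel"
    unfolding g_def using nice_measurable[OF nice_gam] by measurable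
  have nTg: "integrable M (\<lambda>U. Tc A J U ^ (2 * m) * g U)"
    by (rule nice_of_real, unfold of_real_mult of_real_power g_def) (intro nice_mult nice_power nice_Tc nice_Re nice_gam)
  have "(\<integral>U. (of_nat n * blk A J U - of_nat (card A * card J)) * ?F (?L U) \<partial>M) =
    of_real (2 / \<beta>) * (\<integral>U. ?F' (?L U) * (\<Sum>k\<in>?K. ?c k * gam A J A J U) \<partial>M)"
  proof (rule sd_blk[OF beta AJ(2,1) fA, where F = ?F and F' = ?F'])
    show "(?F has_field_derivative ?F' z) (at z)" for z
      by (rule derivative_eq_intros refl | simp)+
  qed (use lin in \<open>auto intro!: nice_power nice_diff\<close>)
  also have "(\<integral>U. (of_nat n * blk A J U - of_nat (card A * card J)) * ?F (?L U) \<partial>M)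
     = (\<integral>U. complex_of_real (n * Tc A J U ^ (2 * m + 2)) \<partial>M)"
  proof -
    have "of_nat n * blk A J U - of_nat (card A * card J) = of_nat n * of_real (Tc A J U)" for U
      using n by (simp add: blk_eq_Tr Tc_def field_simps)
    then have "(of_nat n * blk A J U - of_nat (card A * card J)) * ?F (?L U) =
      complex_of_real (n * Tc A J U ^ (2 * m + 2))" for U
      unfolding lin Tc by (simp add: mult_ac)
    then show ?thesis by simp
  qed
  also have "\<dots> = of_real (n * (\<integral>U. Tc A J U ^ (2 * m + 2) \<partial>M))"
    by (simp only: integral_complex_of_real integral_mult_right_zero)
  also have "(\<integral>U. ?F' (?L U) * (\<Sum>k\<in>?K. ?c k * gam A J A J U) \<partial>M) =
     (\<integral>U. complex_of_real ((2 * m + 1) * (Tc A J U ^ (2 * m) * g U)) \<partial>M)"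
  proof (rule integral_cong_AE)
    show "AE U in M. ?F' (?L U) * (\<Sum>k\<in>?K. ?c k * gam A J A J U) = complex_of_real ((2 * m + 1) * (Tc A J U ^ (2 * m) * g U))"
      using AE_G unfolding lin Tc by eventually_elim (simp add: g)
    show "(\<lambda>U. ?F' (?L U) * (\<Sum>k\<in>?K. ?c k * gam A J A J U)) \<in> borel_measurable M"
      unfolding lin by (intro nice_measurable_M nice_mult nice_sum nice_const nice_power nice_diff nice_blk nice_gam)
    show "(\<lambda>U. complex_of_real ((2 * m + 1) * (Tc A J U ^ (2 * m) * g U))) \<in> borel_measurable M"
      using borel_measurable_integrable[OF nTg] by measurable
  qed
  also have "\<dots> = of_real ((2 * m + 1) * (\<integral>U. Tc A J U ^ (2 * m) * g U \<partial>M))"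
    by (simp only: integral_complex_of_real integral_mult_right_zero)
  finally have eq: "n * (\<integral>U. Tc A J U ^ (2 * m + 2) \<partial>M) = 2 / \<beta> * ((2 * m + 1) * (\<integral>U. Tc A J U ^ (2 * m) * g U \<partial>M))"
    by (simp only: of_real_eq_iff of_real_mult[symmetric])
  have "(\<integral>U. Tc A J U ^ (2 * m) * g U \<partial>M) \<le> (\<integral>U. Tc A J U ^ (2 * m) * r \<partial>M)"
    by (rule integral_mono_AE) (use nTg AE_G g in \<open>auto intro!: integrable_Tc_power mult_left_mono elim!: eventually_mono\<close>)
  then have le: "(\<integral>U. Tc A J U ^ (2 * m) * g U \<partial>M) \<le> r * (\<integral>U. Tc A J U ^ (2 * m) \<partial>M)" by (simp add: mult.commute)
  have r0: "0 \<le> r" using r[OF id_mat_beta_group] Tr_nonneg order_trans by blast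
  have I0: "0 \<le> (\<integral>U. Tc A J U ^ (2 * m) \<partial>M)" by simp
  have "n * (\<integral>U. Tc A J U ^ (2 * m + 2) \<partial>M) \<le> 2 / \<beta> * ((2 * m + 1) * (r * (\<integral>U. Tc A J U ^ (2 * m) \<partial>M)))"
    unfolding eq using beta le by (intro mult_left_mono) auto
  also have "\<dots> \<le> 2 * ((2 * m + 1) * (r * (\<integral>U. Tc A J U ^ (2 * m) \<partial>M)))"
    using beta r0 I0 by (intro mult_right_mono) auto
  finally show ?thesis using n by (simp add: field_simps)
qed

lemma moment2:
  assumes "A \<subseteq> {..<n}" "J \<subseteq> {..<n}" and r: "\<And>U. U \<in> G \<Longrightarrow> Tr A J U \<le> r"
  shows "(\<integral>U. Tc A J U ^ 2 \<partial>M) \<le> 2 * r / n"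
  using moment_step[OF assms, of 0] prob_space by (simp add: power2_eq_square)

text \<open>The constant is \<open>120 = 2 * 6 * 10\<close>, the product of
  \<open>2 * (2 * m + 1)\<close> over \<open>m = 0, 1, 2\<close>.\<close>

lemma moment6:
  assumes "A \<subseteq> {..<n}" "J \<subseteq> {..<n}" and r: "\<And>U. U \<in> G \<Longrightarrow> Tr A J U \<le> r"
  shows "(\<integral>U. Tc A J U ^ 6 \<partial>M) \<le> 120 * (r / n) ^ 3"
proof -
  have r0: "0 \<le> r" using r[OF id_mat_beta_group] Tr_nonneg order_trans by blast
  have "(\<integral>U. Tc A J U ^ 4 \<partial>M) \<le> 6 * r / n * (\<integral>U. Tc A J U ^ 2 \<partial>M)"
    using moment_step[OF assms(1,2), of r 1] r by simp
  also have "\<dots> \<le> 6 * r / n * (2 * r / n)"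
    using moment2[OF assms(1,2), of r] r r0 by (intro mult_left_mono) auto
  finally have 4: "(\<integral>U. Tc A J U ^ 4 \<partial>M) \<le> 6 * r / n * (2 * r / n)" .
  have "(\<integral>U. Tc A J U ^ 6 \<partial>M) \<le> 10 * r / n * (\<integral>U. Tc A J U ^ 4 \<partial>M)"
    using moment_step[OF assms(1,2), of r 2] r by simp
  also have "\<dots> \<le> 10 * r / n * (6 * r / n * (2 * r / n))"
    using 4 r0 by (intro mult_left_mono) auto
  also have "\<dots> = 120 * (r / n) ^ 3" by (simp add: power3_eq_cube)
  finally show ?thesis .
qed

end

section \<open>Size of the terms in the second identity\<close>

context haar12
begin

text \<open>The weight \<open>cw\<close> splits each double sum into products of a sum over a block
  of rows and a sum over all rows; the latter are traces of projections and hence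
  cardinalities.\<close>

lemma gamR_eq:
  assumes U: "U \<in> G" and "A \<subseteq> {..<n}" "A' \<subseteq> {..<n}" "J \<subseteq> {..<n}" "J' \<subseteq> {..<n}"
  shows "gamR A J A' J' U = of_nat (card (A \<inter> A') * card (J \<inter> J')) - of_nat (card A) * blk A' (J \<inter> J') U
      - of_nat (card J') * blk (A \<inter> A') J U + blk A J U * blk A' J' U"
proof -
  have fin: "finite A" "finite A'" using assms finite_subset by blast+
  have sA': "(\<Sum>b<n. of_bool (b \<in> A') * f b) = sum f A'" for f :: "nat \<Rightarrow> complex"
    using assms(3) by (simp add: of_bool_def if_distrib[where f = "\<lambda>t. t * _"] sum.inter_restrict[symmetric] Int_absorb1 cong: if_cong)
  have sA: "(\<Sum>a\<in>A. of_bool (a \<in> A') * f a) = sum f (A \<inter> A')" for f :: "nat \<Rightarrow> complex"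
    using fin by (simp add: of_bool_def if_distrib[where f = "\<lambda>t. t * _"] sum.inter_restrict[symmetric] cong: if_cong)
  have tr: "(\<Sum>b<n. Zb J' U b b) = of_nat (card J')" "(\<Sum>b<n. Zb (J' \<inter> J) U b b) = of_nat (card (J' \<inter> J))"
    using assms by (intro Zb_trace[OF U]; auto)+
  have "gamR A J A' J' U = (\<Sum>a\<in>A. \<Sum>b<n. of_bool (a \<in> A') * Zb (J' \<inter> J) U b b - of_bool (b \<in> A') * Zb (J' \<inter> J) U b b
     - of_bool (a \<in> A') * Zb J U a a * Zb J' U b b + Zb J U a a * (of_bool (b \<in> A') * Zb J' U b b))"
    unfolding gamR_def cw_def by (intro sum.cong refl) (simp add: algebra_simps)
  also have "\<dots> = (\<Sum>a\<in>A. of_bool (a \<in> A') * of_nat (card (J' \<inter> J)) - blk A' (J' \<inter> J) U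
     - of_bool (a \<in> A') * Zb J U a a * of_nat (card J') + Zb J U a a * blk A' J' U)"
    by (simp only: sum.distrib sum_subtractf sum_distrib_left[symmetric] sA' tr blk_def)
  also have "\<dots> = of_nat (card (A \<inter> A')) * of_nat (card (J' \<inter> J)) - of_nat (card A) * blk A' (J' \<inter> J) U
     - blk (A \<inter> A') J U * of_nat (card J') + blk A J U * blk A' J' U"
    using sA[of "\<lambda>_. 1"] by (simp add: sum.distrib sum_subtractf sum_distrib_right[symmetric] sA blk_def)
  finally show ?thesis by (simp add: Int_commute mult_ac)
qed

text \<open>What \<open>gamR\<close> becomes when every block sum is replaced by its mean. For
  blocks of initial indices, division by \<open>n^2\<close> gives the bridge covariance at the
  relative block sizes.\<close>

definition covn :: "nat set \<Rightarrow> nat set \<Rightarrow> nat set \<Rightarrow> nat set \<Rightarrow> real" where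
  "covn A J A' J' = (real (card (A \<inter> A')) - real (card A) * real (card A') / n) *
     (real (card (J \<inter> J')) - real (card J) * real (card J') / n)"

lemma card_le: "A \<subseteq> {..<n} \<Longrightarrow> real (card A) \<le> n"
  using card_mono[of "{..<n}" A] by simp

text \<open>Block sums are exchanged for their means one at a time, the product through
  \<open>T T' - E T E T' = (T - E T) T' + E T (T' - E T')\<close>. Every coefficient that arises is
  at most \<open>n\<close>.\<close>

lemma covn_dev:
  assumes U: "U \<in> G" and AJ: "A \<subseteq> {..<n}" "A' \<subseteq> {..<n}" "J \<subseteq> {..<n}" "J' \<subseteq> {..<n}"
  shows "cmod (gamR A J A' J' U - of_real (covn A J A' J')) \<le>
     n * (\<bar>Tc A' (J \<inter> J') U\<bar> + \<bar>Tc (A \<inter> A') J U\<bar> + \<bar>Tc A J U\<bar> + \<bar>Tc A' J' U\<bar>)"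
proof -
  have "gamR A J A' J' U - of_real (covn A J A' J') = of_real (- card A * Tc A' (J \<inter> J') U
     - card J' * Tc (A \<inter> A') J U + Tc A J U * Tr A' J' U + (real (card A) * real (card J) / n) * Tc A' J' U)"
    using n by (simp add: gamR_eq[OF assms] covn_def blk_eq_Tr Tc_def field_simps)
  also have "cmod \<dots> = \<bar>- card A * Tc A' (J \<inter> J') U
     - card J' * Tc (A \<inter> A') J U + Tc A J U * Tr A' J' U + (real (card A) * real (card J) / n) * Tc A' J' U\<bar>"
    by (rule norm_of_real)
  also have "\<dots> \<le> card A * \<bar>Tc A' (J \<inter> J') U\<bar> + card J' * \<bar>Tc (A \<inter> A') J U\<bar> + Tr A' J' U * \<bar>Tc A J U\<bar>
     + (real (card A) * real (card J) / n) * \<bar>Tc A' J' U\<bar>"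
    by (intro order_trans[OF abs_triangle_ineq] order_trans[OF abs_triangle_ineq4] add_mono)
       (auto simp: abs_mult Tr_nonneg mult.commute)
  also have "\<dots> \<le> n * \<bar>Tc A' (J \<inter> J') U\<bar> + n * \<bar>Tc (A \<inter> A') J U\<bar> + n * \<bar>Tc A J U\<bar> + n * \<bar>Tc A' J' U\<bar>"
  proof (intro add_mono mult_right_mono card_le AJ abs_ge_zero)
    show "Tr A' J' U \<le> n" using Tr_le_rows[OF U AJ(4)] card_le[OF AJ(2)] order_trans by blast
    have "real (card A) * real (card J) \<le> real n * real n" using AJ by (intro mult_mono card_le) auto
    then show "real (card A) * real (card J) / n \<le> n" using n by (simp add: divide_simps)
  qed
  finally show ?thesis by (simp add: distrib_left)
qed

text \<open>Fluctuations of block sums stay bounded as \<open>n\<close> grows; this is what makes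
  \<open>gamR\<close> deterministic up to order \<open>n\<close>.\<close>

lemma abs_Tc_le:
  assumes AJ: "A \<subseteq> {..<n}" "J \<subseteq> {..<n}"
  shows "integrable M (\<lambda>U. \<bar>Tc A J U\<bar>)" "(\<integral>U. \<bar>Tc A J U\<bar> \<partial>M) \<le> 3 / 2"
proof -
  show int: "integrable M (\<lambda>U. \<bar>Tc A J U\<bar>)"
    using integrable_Tc_power[of A J 1] by (intro integrable_abs) simp
  have "(\<integral>U. Tc A J U ^ 2 \<partial>M) \<le> 2 * real n / n"
    using Tr_le_rows[OF _ AJ(2)] card_le[OF AJ(1)] by (intro moment2[OF AJ]) (blast intro: order_trans)
  then have 2: "(\<integral>U. Tc A J U ^ 2 \<partial>M) \<le> 2" using n by simp
  have "\<bar>x\<bar> \<le> 1 / 2 + x ^ 2 / 2" for x :: real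
    using zero_le_power2[of "\<bar>x\<bar> - 1"] by (simp add: power2_eq_square algebra_simps abs_mult_self_eq)
  moreover have "integrable M (\<lambda>U. 1 / 2 + Tc A J U ^ 2 / 2)"
    using integrable_Tc_power[of A J 2] by simp
  ultimately have "(\<integral>U. \<bar>Tc A J U\<bar> \<partial>M) \<le> (\<integral>U. 1 / 2 + Tc A J U ^ 2 / 2 \<partial>M)"
    by (intro integral_mono int)
  also have "\<dots> = 1 / 2 + (\<integral>U. Tc A J U ^ 2 \<partial>M) / 2"
    using integrable_Tc_power[of A J 2] prob_space by simp
  finally show "(\<integral>U. \<bar>Tc A J U\<bar> \<partial>M) \<le> 3 / 2" using 2 by simp
qed

lemma norm_integral_le:
  assumes "nice f" "\<And>U. U \<in> G \<Longrightarrow> cmod (f U) \<le> C"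
  shows "cmod (\<integral>U. f U \<partial>M) \<le> C"
proof -
  have "cmod (\<integral>U. f U \<partial>M) \<le> (\<integral>U. cmod (f U) \<partial>M)" by (rule integral_norm_bound)
  also have "\<dots> \<le> (\<integral>U. C \<partial>M)"
    by (rule integral_mono_AE) (use assms AE_G in \<open>auto intro: nice_integrable integrable_norm elim!: eventually_mono\<close>)
  finally show ?thesis using prob_space by simp
qed

text \<open>Cauchy--Schwarz for a column of \<open>n\<close> entries and norm at most 1, carried out
  termwise by completing the square with weight \<open>sqrt n\<close>.\<close>

lemma sum_norm_Zb_le:
  assumes "U \<in> G" "J \<subseteq> {..<n}"
  shows "(\<Sum>d<n. cmod (Zb J U d a)) \<le> sqrt n"
proof -
  have *: "x \<le> (sqrt n * x\<^sup>2 + 1 / sqrt n) / 2" for x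
    using zero_le_power2[of "sqrt n * x - 1"] n by (simp add: field_simps power2_eq_square)
  have "(\<Sum>d<n. cmod (Zb J U d a)) \<le> (\<Sum>d<n. (sqrt n * (cmod (Zb J U d a))\<^sup>2 + 1 / sqrt n) / 2)"
    by (intro sum_mono *)
  also have "\<dots> = (sqrt n * (\<Sum>d<n. (cmod (Zb J U d a))\<^sup>2) + n / sqrt n) / 2"
    by (simp add: sum_distrib_left sum.distrib sum_divide_distrib[symmetric])
  also have "\<dots> \<le> (sqrt n * 1 + n / sqrt n) / 2"
    using Zb_col_le[OF assms] by (intro divide_right_mono add_right_mono mult_left_mono) auto
  also have "\<dots> = sqrt n" by (simp add: real_div_sqrt)
  finally show ?thesis .
qed

lemma norm_sum_Zb_Zb_le:
  assumes "U \<in> G" "J \<subseteq> {..<n}" "J' \<subseteq> {..<n}" "\<And>b. cmod (w b) \<le> 1"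
  shows "(\<Sum>b<n. cmod (w b * (Zb J' U x b * Zb J U b y))) \<le> 1"
proof -
  have *: "p * q \<le> (p\<^sup>2 + q\<^sup>2) / 2" for p q :: real
    using zero_le_power2[of "p - q"] by (simp add: field_simps power2_eq_square)
  have "(\<Sum>b<n. cmod (w b * (Zb J' U x b * Zb J U b y))) \<le> (\<Sum>b<n. ((cmod (Zb J' U x b))\<^sup>2 + (cmod (Zb J U b y))\<^sup>2) / 2)"
    unfolding norm_mult[of "w _"] norm_mult[of "Zb _ _ _ _"]
    by (intro sum_mono order_trans[OF mult_left_le_one_le *] mult_nonneg_nonneg norm_ge_zero assms(4))
  also have "\<dots> = ((\<Sum>b<n. (cmod (Zb J' U x b))\<^sup>2) + (\<Sum>b<n. (cmod (Zb J U b y))\<^sup>2)) / 2"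
    by (simp add: sum.distrib sum_divide_distrib[symmetric])
  also have "\<dots> \<le> (1 + 1) / 2"
    using Zb_row_le[of U J' x] Zb_col_le[of U J y] assms by (intro divide_right_mono add_mono) auto
  finally show ?thesis by simp
qed

lemma sum_norm_cmult_le:
  fixes f :: "nat \<Rightarrow> real"
  assumes "A \<subseteq> {..<n}" "\<And>a. a < n \<Longrightarrow> f a \<le> C" "0 \<le> C"
  shows "sum f A \<le> real n * C"
proof -
  have "sum f A \<le> card A * C" using sum_bounded_above[of A f C] assms by auto
  also have "\<dots> \<le> n * C" using card_le[OF assms(1)] assms(3) by (intro mult_right_mono) auto
  finally show ?thesis .
qed

lemma norm_gamE_le:
  assumes "U \<in> G" "A \<subseteq> {..<n}" "J \<subseteq> {..<n}" "J' \<subseteq> {..<n}"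
  shows "cmod (gamE A J A' J' U) \<le> n"
proof -
  have "cmod (gamE A J A' J' U) \<le> (\<Sum>a\<in>A. \<Sum>b<n. cmod (cw A' a b * (Zb J' U a b * Zb J U b a)))"
    unfolding gamE_def
  proof (intro order_trans[OF norm_sum sum_mono] order_trans[OF norm_sum])
    fix a b
    have "cmod (Zb J' U b a) = cmod (Zb J' U a b)" using cnj_Zb complex_mod_cnj by metis
    then show "cmod (cw A' a b * (Zb J' U b a * Zb J U b a)) \<le> cmod (cw A' a b * (Zb J' U a b * Zb J U b a))"
      by (simp add: norm_mult)
  qed
  also have "\<dots> \<le> real n * 1"
    by (rule sum_norm_cmult_le[OF assms(2)]) (auto intro!: norm_sum_Zb_Zb_le norm_cw assms)
  finally show ?thesis by simp
qed

text \<open>The dominant error. For fixed \<open>a\<close> and \<open>d\<close> the sum over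
  \<open>b\<close> pairs a row and a column of norm at most 1 and is at most 1. Summing the
  remaining entries over \<open>d\<close> costs \<open>sqrt n\<close>, and summing over
  \<open>a\<close> costs \<open>n\<close>.\<close>

lemma norm_drift_le:
  assumes U: "U \<in> G" and A0: "A0 \<subseteq> {..<n}" and J: "J \<subseteq> {..<n}" "J' \<subseteq> {..<n}" and B: "\<And>k. k \<in> K \<Longrightarrow> B k \<subseteq> {..<n}"
  shows "cmod (\<Sum>a\<in>A0. \<Sum>d<n. (\<Sum>b<n. cw A' a b * (Zb J' U d b * Zb J U b a)) * dlin c A B K 1 a d U)
    \<le> 2 * (\<Sum>k\<in>K. cmod (c k)) * (n * sqrt n)"
proof -
  have d: "cmod (dlin c A B K 1 a d U) \<le> (\<Sum>k\<in>K. cmod (c k) * (2 * cmod (Zb (B k) U d a)))" for a d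
    unfolding dlin_def
  proof (intro order_trans[OF norm_sum sum_mono])
    fix k
    have "cmod (Zb (B k) U a d) = cmod (Zb (B k) U d a)" using cnj_Zb complex_mod_cnj by metis
    then have "cmod (1 * Zb (B k) U d a + cnj 1 * Zb (B k) U a d) \<le> 2 * cmod (Zb (B k) U d a)"
      using norm_triangle_ineq[of "Zb (B k) U d a" "Zb (B k) U a d"] by simp
    then show "cmod (c k * (cw (A k) a d * (1 * Zb (B k) U d a + cnj 1 * Zb (B k) U a d))) \<le> cmod (c k) * (2 * cmod (Zb (B k) U d a))"
      unfolding norm_mult[of "c k"] norm_mult[of "cw (A k) a d"]
      by (intro mult_left_mono order_trans[OF mult_left_le_one_le]) (auto simp: norm_cw)
  qed
  have "cmod (\<Sum>a\<in>A0. \<Sum>d<n. (\<Sum>b<n. cw A' a b * (Zb J' U d b * Zb J U b a)) * dlin c A B K 1 a d U) \<le>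
    (\<Sum>a\<in>A0. \<Sum>d<n. \<Sum>k\<in>K. cmod (c k) * (2 * cmod (Zb (B k) U d a)))"
  proof (intro order_trans[OF norm_sum sum_mono] order_trans[OF norm_sum])
    fix a d
    have "cmod (\<Sum>b<n. cw A' a b * (Zb J' U d b * Zb J U b a)) \<le> 1"
      by (intro order_trans[OF norm_sum] norm_sum_Zb_Zb_le U J norm_cw)
    then show "cmod ((\<Sum>b<n. cw A' a b * (Zb J' U d b * Zb J U b a)) * dlin c A B K 1 a d U) \<le> (\<Sum>k\<in>K. cmod (c k) * (2 * cmod (Zb (B k) U d a)))"
      unfolding norm_mult by (intro order_trans[OF mult_left_le_one_le d]) auto
  qed
  also have "\<dots> = (\<Sum>a\<in>A0. \<Sum>k\<in>K. cmod (c k) * (2 * (\<Sum>d<n. cmod (Zb (B k) U d a))))"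
    by (subst sum.swap[of _ K]) (simp add: sum_distrib_left)
  also have "\<dots> \<le> n * (\<Sum>k\<in>K. cmod (c k) * (2 * sqrt n))"
    by (rule sum_norm_cmult_le[OF A0]) (auto intro!: sum_mono mult_left_mono sum_nonneg sum_norm_Zb_le[OF U B])
  also have "\<dots> = 2 * (\<Sum>k\<in>K. cmod (c k)) * (n * sqrt n)"
    by (simp add: sum_distrib_right[symmetric] sum_distrib_left[symmetric])
  finally show ?thesis .
qed

end

section \<open>Characteristic functions\<close>

locale char_haar = haar12 +
  fixes K :: "'k set" and c :: "'k \<Rightarrow> real" and A B :: "'k \<Rightarrow> nat set"
  assumes K: "finite K" and A: "\<And>k. k \<in> K \<Longrightarrow> A k \<subseteq> {..<n}" and B: "\<And>k. k \<in> K \<Longrightarrow> B k \<subseteq> {..<n}"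
begin

definition X :: "cmat \<Rightarrow> real" where "X U = (\<Sum>k\<in>K. c k * Tc (A k) (B k) U)"
definition mean :: real where "mean = (\<Sum>k\<in>K. c k * (real (card (A k)) * real (card (B k)) / n))"
definition L :: "cmat \<Rightarrow> complex" where "L = lin (\<lambda>k. of_real (c k)) A B K"
text \<open>Defined on all complex numbers because the identities ask for a complex derivative. The
  centring sits in the exponent, as \<open>L\<close> is built from uncentred sums; at values of
  \<open>L\<close> the modulus is 1.\<close>

definition E :: "real \<Rightarrow> complex \<Rightarrow> complex" where "E \<xi> z = exp (\<i> * of_real \<xi> * (z - of_real mean))"
definition \<phi> :: "real \<Rightarrow> complex" where "\<phi> \<xi> = (\<integral>U. E \<xi> (L U) \<partial>M)"
definition C :: real where "C = (\<Sum>k\<in>K. \<bar>c k\<bar>)"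
text \<open>Takes the role of the Gaussian variance at size \<open>n\<close>.\<close>

definition s :: real where "s = 2 / \<beta> * (\<Sum>l\<in>K. \<Sum>k\<in>K. c l * c k * (covn (A l) (B l) (A k) (B k) / n\<^sup>2))"

lemma L_eq: "L U = of_real (X U) + of_real mean"
  unfolding L_def lin_def X_def mean_def of_real_add[symmetric] sum.distrib[symmetric]
  by (simp add: blk_eq_Tr Tc_def algebra_simps)

lemma E_L: "E \<xi> (L U) = exp (\<i> * of_real (\<xi> * X U))"
  by (simp add: E_def L_eq mult.assoc)

lemma norm_E_L [simp]: "cmod (E \<xi> (L U)) = 1"
  by (simp add: E_L)

lemma finA: "k \<in> K \<Longrightarrow> finite (A k)"
  using A finite_subset by blast

lemma nice_L [simp]: "nice L"
  by (simp add: L_def)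

lemma nice_E [simp]: "nice (\<lambda>U. E \<xi> (L U))"
  unfolding E_def by (intro nice_exp nice_mult nice_diff nice_L nice_const)

lemma E_deriv: "(E \<xi> has_field_derivative \<i> * of_real \<xi> * E \<xi> z) (at z)"
  unfolding E_def by (rule derivative_eq_intros refl | simp)+

lemma C_nonneg: "0 \<le> C" by (simp add: C_def sum_nonneg)

text \<open>The 7 is \<open>4 * 3/2 + 1\<close>: four block fluctuations from \<open>gamR\<close>
  and one unit from \<open>gamE\<close>, both of order \<open>n\<close> only. The term
  \<open>2 * C * \<bar>\<xi>\<bar>\<close> comes from the drift, which dictates the order
  \<open>n * sqrt n\<close>.\<close>

lemma gam_char:
  assumes "A0 \<subseteq> {..<n}" "J \<subseteq> {..<n}" "A' \<subseteq> {..<n}" "J' \<subseteq> {..<n}"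
  shows "cmod (of_nat n * (\<integral>U. gam A0 J A' J' U * E \<xi> (L U) \<partial>M) - of_real (covn A0 J A' J') * \<phi> \<xi>) \<le>
     (7 + 2 * C * \<bar>\<xi>\<bar>) * (n * sqrt n)"
proof -
  let ?W = "\<lambda>U. \<i> * of_real \<xi> * E \<xi> (L U) * (\<Sum>a\<in>A0. \<Sum>d<n. (\<Sum>b<n. cw A' a b * (Zb J' U d b * Zb J U b a)) * dlin (\<lambda>k. of_real (c k)) A B K 1 a d U)"
  let ?S = "\<lambda>U. \<bar>Tc A' (J \<inter> J') U\<bar> + \<bar>Tc (A0 \<inter> A') J U\<bar> + \<bar>Tc A0 J U\<bar> + \<bar>Tc A' J' U\<bar>"
  let ?R = "\<lambda>U. (gamR A0 J A' J' U - of_real (covn A0 J A' J')) * E \<xi> (L U)"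
  let ?E = "\<lambda>U. gamE A0 J A' J' U * E \<xi> (L U)"
  have nW: "nice ?W" and nR: "nice ?R" and nE: "nice ?E"
    by (intro nice_mult nice_add nice_sum nice_const nice_E nice_Zb nice_dlin nice_diff nice_gamR nice_gamE)+
  have bE: "cmod (\<integral>U. ?E U \<partial>M) \<le> n"
    by (rule norm_integral_le[OF nE]) (simp add: norm_mult norm_gamE_le assms)
  have bW: "cmod (\<integral>U. ?W U \<partial>M) \<le> \<bar>\<xi>\<bar> * (2 * C * (n * sqrt n))"
  proof (rule norm_integral_le[OF nW])
    fix U assume U: "U \<in> G"
    have w: "cmod (\<i> * of_real \<xi> * E \<xi> (L U)) = \<bar>\<xi>\<bar>" by (simp add: norm_mult)
    have C: "C = (\<Sum>k\<in>K. cmod (complex_of_real (c k)))" by (simp add: C_def)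
    show "cmod (?W U) \<le> \<bar>\<xi>\<bar> * (2 * C * (n * sqrt n))"
      unfolding norm_mult[of "\<i> * of_real \<xi> * E \<xi> (L U)"] w C
      by (rule mult_left_mono[OF norm_drift_le[OF U assms(1,2,4) B]]) auto
  qed
  have int: "integrable M (\<lambda>U. \<bar>Tc A' (J \<inter> J') U\<bar>)" "integrable M (\<lambda>U. \<bar>Tc (A0 \<inter> A') J U\<bar>)"
     "integrable M (\<lambda>U. \<bar>Tc A0 J U\<bar>)" "integrable M (\<lambda>U. \<bar>Tc A' J' U\<bar>)"
    using assms by (intro abs_Tc_le; auto)+
  have "cmod (\<integral>U. ?R U \<partial>M) \<le> (\<integral>U. cmod (?R U) \<partial>M)" by (rule integral_norm_bound)
  also have "\<dots> \<le> (\<integral>U. n * ?S U \<partial>M)"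
  proof (rule integral_mono_AE)
    show "AE U in M. cmod (?R U) \<le> n * ?S U"
      using AE_G by eventually_elim (use covn_dev assms in \<open>simp add: norm_mult\<close>)
  qed (use nR int in \<open>auto intro!: nice_integrable integrable_norm\<close>)
  also have "\<dots> = n * ((\<integral>U. \<bar>Tc A' (J \<inter> J') U\<bar> \<partial>M) + (\<integral>U. \<bar>Tc (A0 \<inter> A') J U\<bar> \<partial>M) + (\<integral>U. \<bar>Tc A0 J U\<bar> \<partial>M) + (\<integral>U. \<bar>Tc A' J' U\<bar> \<partial>M))"
    using int by simp
  also have "\<dots> \<le> n * (3 / 2 + 3 / 2 + 3 / 2 + 3 / 2)"
    using assms by (intro mult_left_mono add_mono abs_Tc_le) auto
  finally have bR: "cmod (\<integral>U. ?R U \<partial>M) \<le> 6 * real n" by simp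
  have "of_nat n * (\<integral>U. gam A0 J A' J' U * E \<xi> (L U) \<partial>M) =
    (\<integral>U. gamR A0 J A' J' U * E \<xi> (L U) \<partial>M) - (\<integral>U. ?E U \<partial>M) + (\<integral>U. ?W U \<partial>M)"
    unfolding L_def by (rule sd_gam[OF assms(1,2,4) finA E_deriv]) (auto intro!: nice_mult nice_E[unfolded L_def])
  also have "(\<integral>U. gamR A0 J A' J' U * E \<xi> (L U) \<partial>M) = (\<integral>U. ?R U \<partial>M) + of_real (covn A0 J A' J') * \<phi> \<xi>"
  proof -
    have "(\<integral>U. gamR A0 J A' J' U * E \<xi> (L U) \<partial>M) = (\<integral>U. ?R U + of_real (covn A0 J A' J') * E \<xi> (L U) \<partial>M)"
      by (simp add: algebra_simps)
    also have "\<dots> = (\<integral>U. ?R U \<partial>M) + (\<integral>U. of_real (covn A0 J A' J') * E \<xi> (L U) \<partial>M)"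
      by (intro Bochner_Integration.integral_add nice_integrable nR nice_mult nice_const nice_E)
    finally show ?thesis by (simp add: \<phi>_def)
  qed
  finally have eq: "of_nat n * (\<integral>U. gam A0 J A' J' U * E \<xi> (L U) \<partial>M) - of_real (covn A0 J A' J') * \<phi> \<xi> =
     (\<integral>U. ?R U \<partial>M) - (\<integral>U. ?E U \<partial>M) + (\<integral>U. ?W U \<partial>M)" by simp
  have "cmod ((\<integral>U. ?R U \<partial>M) - (\<integral>U. ?E U \<partial>M) + (\<integral>U. ?W U \<partial>M)) \<le> cmod (\<integral>U. ?R U \<partial>M) + cmod (\<integral>U. ?E U \<partial>M) + cmod (\<integral>U. ?W U \<partial>M)"
    by (intro order_trans[OF norm_triangle_ineq] add_right_mono norm_triangle_ineq4)
  also have "\<dots> \<le> 6 * real n + real n + \<bar>\<xi>\<bar> * (2 * C * (n * sqrt n))"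
    by (rule add_mono[OF add_mono[OF bR bE] bW])
  also have "\<dots> \<le> 7 * (n * sqrt n) + \<bar>\<xi>\<bar> * (2 * C * (n * sqrt n))"
    using n by (simp add: mult_le_cancel_left1)
  finally show ?thesis unfolding eq by (simp add: algebra_simps)
qed

text \<open>Since the derivative of \<phi> is \<i> times this integral, the statement is
  \<open>\<phi>' = - \<xi> s \<phi>\<close> up to order \<open>n^(-1/2)\<close>. Each of the two
  identities carries one factor \<open>n\<close>, so the comparison is made after multiplication by
  \<open>n^2\<close>.\<close>

lemma char_ode:
  "cmod ((\<integral>U. of_real (X U) * E \<xi> (L U) \<partial>M) - \<i> * of_real (\<xi> * s) * \<phi> \<xi>) \<le> 2 * \<bar>\<xi>\<bar> * C\<^sup>2 * (7 + 2 * C * \<bar>\<xi>\<bar>) / sqrt n"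
proof -
  let ?g = "\<lambda>l k. (\<integral>U. gam (A l) (B l) (A k) (B k) U * E \<xi> (L U) \<partial>M)"
  let ?z = "\<i> * of_real (2 / \<beta> * \<xi>)"
  let ?I = "\<integral>U. of_real (X U) * E \<xi> (L U) \<partial>M" and ?r = "\<lambda>l k. covn (A l) (B l) (A k) (B k)"
  have 1: "of_nat n * (\<integral>U. of_real (Tc (A l) (B l) U) * E \<xi> (L U) \<partial>M) = ?z * (\<Sum>k\<in>K. of_real (c k) * ?g l k)" if l: "l \<in> K" for l
  proof -
    have "(of_nat n * blk (A l) (B l) U - of_nat (card (A l) * card (B l))) * E \<xi> (L U) = of_nat n * (of_real (Tc (A l) (B l) U) * E \<xi> (L U))" for U
      using n by (simp add: blk_eq_Tr Tc_def field_simps)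
    then have "of_nat n * (\<integral>U. of_real (Tc (A l) (B l) U) * E \<xi> (L U) \<partial>M) =
      (\<integral>U. (of_nat n * blk (A l) (B l) U - of_nat (card (A l) * card (B l))) * E \<xi> (L U) \<partial>M)" by (simp only: integral_mult_right_zero)
    also have "\<dots> = of_real (2 / \<beta>) * (\<integral>U. \<i> * of_real \<xi> * E \<xi> (L U) * (\<Sum>k\<in>K. of_real (c k) * gam (A l) (B l) (A k) (B k) U) \<partial>M)"
      unfolding L_def by (rule sd_blk[OF beta B[OF l] A[OF l] finA E_deriv]) (auto intro!: nice_mult nice_E[unfolded L_def])
    also have "(\<integral>U. \<i> * of_real \<xi> * E \<xi> (L U) * (\<Sum>k\<in>K. of_real (c k) * gam (A l) (B l) (A k) (B k) U) \<partial>M) =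
       (\<integral>U. (\<Sum>k\<in>K. \<i> * of_real \<xi> * (of_real (c k) * (gam (A l) (B l) (A k) (B k) U * E \<xi> (L U)))) \<partial>M)"
      by (simp add: sum_distrib_left mult_ac)
    also have "\<dots> = (\<Sum>k\<in>K. (\<integral>U. \<i> * of_real \<xi> * (of_real (c k) * (gam (A l) (B l) (A k) (B k) U * E \<xi> (L U))) \<partial>M))"
      by (intro nice_integral_sum nice_mult nice_const nice_gam nice_E)
    also have "\<dots> = \<i> * of_real \<xi> * (\<Sum>k\<in>K. of_real (c k) * ?g l k)"
      by (simp add: sum_distrib_left)
    finally show ?thesis by (simp add: mult_ac)
  qed
  have X: "?I = (\<Sum>l\<in>K. of_real (c l) * (\<integral>U. of_real (Tc (A l) (B l) U) * E \<xi> (L U) \<partial>M))"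
  proof -
    have "?I = (\<integral>U. (\<Sum>l\<in>K. of_real (c l) * (of_real (Tc (A l) (B l) U) * E \<xi> (L U))) \<partial>M)"
      by (simp add: X_def sum_distrib_right mult.assoc)
    also have "\<dots> = (\<Sum>l\<in>K. \<integral>U. of_real (c l) * (of_real (Tc (A l) (B l) U) * E \<xi> (L U)) \<partial>M)"
      by (intro nice_integral_sum nice_mult nice_const nice_Tc nice_E)
    finally show ?thesis by simp
  qed
  have "of_nat n * (of_nat n * ?I) = (\<Sum>l\<in>K. of_real (c l) * (of_nat n * (of_nat n * (\<integral>U. of_real (Tc (A l) (B l) U) * E \<xi> (L U) \<partial>M))))"
    unfolding X by (simp add: sum_distrib_left mult_ac)
  also have "\<dots> = (\<Sum>l\<in>K. of_real (c l) * (of_nat n * (?z * (\<Sum>k\<in>K. of_real (c k) * ?g l k))))"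
    by (intro sum.cong refl) (simp only: 1)
  also have "\<dots> = ?z * (\<Sum>l\<in>K. \<Sum>k\<in>K. of_real (c l * c k) * (of_nat n * ?g l k))"
    by (simp add: sum_distrib_left mult_ac)
  finally have 2: "of_nat n * (of_nat n * ?I) = ?z * (\<Sum>l\<in>K. \<Sum>k\<in>K. of_real (c l * c k) * (of_nat n * ?g l k))" .
  have 3: "of_nat n * (of_nat n * (\<i> * of_real (\<xi> * s) * \<phi> \<xi>)) = ?z * (\<Sum>l\<in>K. \<Sum>k\<in>K. of_real (c l * c k) * (of_real (?r l k) * \<phi> \<xi>))"
  proof -
    have "n\<^sup>2 * s = 2 / \<beta> * (\<Sum>l\<in>K. \<Sum>k\<in>K. c l * c k * ?r l k)"
      unfolding s_def sum_divide_distrib[symmetric] times_divide_eq_right using n by simp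
    then have "complex_of_real (n\<^sup>2 * s) = of_real (2 / \<beta> * (\<Sum>l\<in>K. \<Sum>k\<in>K. c l * c k * ?r l k))" by simp
    then have s: "of_nat n * (of_nat n * complex_of_real s) = of_real (2 / \<beta>) * (\<Sum>l\<in>K. \<Sum>k\<in>K. of_real (c l * c k) * of_real (?r l k))"
      by (simp add: power2_eq_square mult.assoc)
    have "of_nat n * (of_nat n * (\<i> * of_real (\<xi> * s) * \<phi> \<xi>)) = \<i> * of_real \<xi> * (of_nat n * (of_nat n * complex_of_real s)) * \<phi> \<xi>"
      by (simp add: mult_ac)
    also have "\<dots> = ?z * (\<Sum>l\<in>K. \<Sum>k\<in>K. of_real (c l * c k) * (of_real (?r l k) * \<phi> \<xi>))"
      unfolding s by (simp add: sum_distrib_left sum_distrib_right mult_ac)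
    finally show ?thesis .
  qed
  have "of_nat n * (of_nat n * (?I - \<i> * of_real (\<xi> * s) * \<phi> \<xi>)) =
    ?z * (\<Sum>l\<in>K. \<Sum>k\<in>K. of_real (c l * c k) * (of_nat n * ?g l k - of_real (?r l k) * \<phi> \<xi>))"
    unfolding right_diff_distrib sum_subtractf 2 3 ..
  from arg_cong[OF this, of cmod] have "n * (n * cmod (?I - \<i> * of_real (\<xi> * s) * \<phi> \<xi>)) =
     cmod ?z * cmod (\<Sum>l\<in>K. \<Sum>k\<in>K. of_real (c l * c k) * (of_nat n * ?g l k - of_real (?r l k) * \<phi> \<xi>))"
    unfolding norm_mult[of "of_nat n"] norm_mult[of ?z] norm_of_nat .
  also have "\<dots> \<le> (2 * \<bar>\<xi>\<bar>) * (\<Sum>l\<in>K. \<Sum>k\<in>K. \<bar>c l\<bar> * \<bar>c k\<bar> * ((7 + 2 * C * \<bar>\<xi>\<bar>) * (n * sqrt n)))"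
  proof (intro mult_mono order_trans[OF norm_sum sum_mono] order_trans[OF norm_sum])
    show "cmod ?z \<le> 2 * \<bar>\<xi>\<bar>" using beta by (auto simp: norm_mult)
    fix l k assume "l \<in> K" "k \<in> K"
    then show "cmod (of_real (c l * c k) * (of_nat n * ?g l k - of_real (?r l k) * \<phi> \<xi>)) \<le> \<bar>c l\<bar> * \<bar>c k\<bar> * ((7 + 2 * C * \<bar>\<xi>\<bar>) * (n * sqrt n))"
      using gam_char[of "A l" "B l" "A k" "B k" \<xi>] A B unfolding norm_mult[of "of_real (c l * c k)"] norm_of_real abs_mult
      by (intro mult_left_mono) auto
  qed auto
  also have "\<dots> = 2 * \<bar>\<xi>\<bar> * C\<^sup>2 * (7 + 2 * C * \<bar>\<xi>\<bar>) * (n * sqrt n)"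
    by (simp add: sum_distrib_left[symmetric] sum_distrib_right[symmetric] C_def[symmetric] power2_eq_square)
  also have "\<dots> = n * (n * (2 * \<bar>\<xi>\<bar> * C\<^sup>2 * (7 + 2 * C * \<bar>\<xi>\<bar>) / sqrt n))"
  proof -
    have "Y * (n * sqrt n) = n * (n * (Y / sqrt n))" for Y
    proof -
      have "Y * (n * sqrt n) = Y * (n * (n / sqrt n))" by (simp only: real_div_sqrt of_nat_0_le_iff)
      then show ?thesis by (simp only: times_divide_eq_right mult.commute mult.left_commute)
    qed
    then show ?thesis .
  qed
  finally show ?thesis using n by (simp only: mult_le_cancel_left_pos of_nat_0_less_iff)
qed

lemma abs_covn_le:
  assumes "A1 \<subseteq> {..<n}" "J1 \<subseteq> {..<n}" "A' \<subseteq> {..<n}" "J' \<subseteq> {..<n}"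
  shows "\<bar>covn A1 J1 A' J'\<bar> \<le> n\<^sup>2"
proof -
  have *: "\<bar>real (card (S \<inter> S')) - real (card S) * real (card S') / n\<bar> \<le> n" if "S \<subseteq> {..<n}" "S' \<subseteq> {..<n}" for S S'
  proof -
    have "real (card S) * real (card S') \<le> real n * real n" using that by (intro mult_mono card_le) auto
    then have "real (card S) * real (card S') / n \<le> n" using n by (simp add: divide_simps)
    moreover have "real (card (S \<inter> S')) \<le> n" using that by (intro card_le) auto
    moreover have "0 \<le> real (card S) * real (card S') / n" by simp
    ultimately show ?thesis by linarith
  qed
  show ?thesis unfolding covn_def abs_mult power2_eq_square of_nat_mult using assms by (intro mult_mono *) auto
qed

lemma abs_s_le: "\<bar>s\<bar> \<le> 2 * C\<^sup>2"
proof -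
  have "\<bar>s\<bar> = 2 / \<beta> * \<bar>\<Sum>l\<in>K. \<Sum>k\<in>K. c l * c k * (covn (A l) (B l) (A k) (B k) / n\<^sup>2)\<bar>"
    using beta by (auto simp: s_def abs_mult)
  also have "\<dots> \<le> 2 * (\<Sum>l\<in>K. \<Sum>k\<in>K. \<bar>c l\<bar> * \<bar>c k\<bar> * 1)"
  proof (intro mult_mono order_trans[OF sum_abs sum_mono] order_trans[OF sum_abs])
    fix l k assume "l \<in> K" "k \<in> K"
    then show "\<bar>c l * c k * (covn (A l) (B l) (A k) (B k) / n\<^sup>2)\<bar> \<le> \<bar>c l\<bar> * \<bar>c k\<bar> * 1"
      unfolding abs_mult using abs_covn_le[of "A l" "B l" "A k" "B k"] A B n
      by (intro mult_left_mono) (auto simp: divide_simps)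
  qed (use beta in auto)
  also have "\<dots> = 2 * C\<^sup>2"
    by (simp add: sum_distrib_left[symmetric] sum_distrib_right[symmetric] C_def[symmetric] power2_eq_square)
  finally show ?thesis .
qed

lemma \<phi>_deriv: "(\<phi> has_vector_derivative \<i> * (\<integral>U. of_real (X U) * E \<xi> (L U) \<partial>M)) (at \<xi>)"
proof -
  have nX: "nice (\<lambda>U. of_real (X U))"
    unfolding X_def of_real_sum of_real_mult by (intro nice_sum nice_mult nice_const nice_Tc)
  then obtain D where D: "\<And>U. U \<in> G \<Longrightarrow> \<bar>X U\<bar> \<le> D" by (auto simp: nice_def)
  have "((\<lambda>\<xi>. \<integral>U. E \<xi> (L U) \<partial>M) has_vector_derivative (\<integral>U. \<i> * (of_real (X U) * E \<xi> (L U)) \<partial>M)) (at \<xi>)"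
  proof (rule has_vector_derivative_integral[where C = D])
    show "AE U in M. \<forall>t. ((\<lambda>t. E t (L U)) has_vector_derivative \<i> * (of_real (X U) * E t (L U))) (at t) \<and> cmod (\<i> * (of_real (X U) * E t (L U))) \<le> D"
      using AE_G
    proof eventually_elim
      case (elim U)
      have "((\<lambda>t. E t (L U)) has_vector_derivative \<i> * (of_real (X U) * E t (L U))) (at t)" for t
      proof -
        have "((\<lambda>z. exp (\<i> * (z * of_real (X U)))) has_field_derivative \<i> * (of_real (X U) * exp (\<i> * (of_real t * of_real (X U))))) (at (of_real t))"
          by (rule derivative_eq_intros refl | simp)+
        then have "((\<lambda>t. exp (\<i> * (of_real t * of_real (X U)))) has_vector_derivative \<i> * (of_real (X U) * exp (\<i> * (of_real t * of_real (X U))))) (at t)"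
          by (rule has_vector_derivative_real_field)
        then show ?thesis by (simp add: E_L)
      qed
      then show ?case using D[OF elim] by (simp add: norm_mult)
    qed
    show "(\<lambda>U. \<i> * (of_real (X U) * E \<xi> (L U))) \<in> borel_measurable M"
      by (intro nice_measurable_M nice_mult nice_const nX nice_E)
  qed (intro nice_integrable nice_E)
  then show ?thesis by (simp add: \<phi>_def[abs_def])
qed

text \<open>The integrating factor \<open>exp (s \<xi>^2 / 2)\<close> turns the approximate equation
  into a function with small derivative on the unit interval. The value at 1 is all that is wanted,
  because the coefficients \<open>c\<close> are arbitrary. One factor \<open>exp (C^2)\<close>
  bounds the integrating factor, the other pays for removing it at the end.\<close>

lemma char_bound: "cmod (\<phi> 1 - exp (- of_real (s / 2))) \<le> exp (C\<^sup>2) * (exp (C\<^sup>2) * (2 * C\<^sup>2 * (7 + 2 * C) / sqrt n))"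
proof -
  let ?I = "\<lambda>\<xi>. \<integral>U. of_real (X U) * E \<xi> (L U) \<partial>M"
  let ?D = "exp (C\<^sup>2) * (2 * C\<^sup>2 * (7 + 2 * C) / sqrt n)"
  define \<psi> where "\<psi> = (\<lambda>\<xi>. exp (of_real (s * \<xi>\<^sup>2 / 2)) * \<phi> \<xi>)"
  define \<psi>' where "\<psi>' = (\<lambda>\<xi>. exp (of_real (s * \<xi>\<^sup>2 / 2)) * (\<i> * (?I \<xi> - \<i> * of_real (\<xi> * s) * \<phi> \<xi>)))"
  have d: "(\<psi> has_vector_derivative \<psi>' \<xi>) (at \<xi>)" for \<xi>
  proof -
    have "((\<lambda>\<xi>. exp (s * \<xi>\<^sup>2 / 2)) has_real_derivative (\<xi> * s * exp (s * \<xi>\<^sup>2 / 2))) (at \<xi>)"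
      by (rule derivative_eq_intros refl | simp)+
    then have "((\<lambda>\<xi>. complex_of_real (exp (s * \<xi>\<^sup>2 / 2))) has_vector_derivative of_real (\<xi> * s * exp (s * \<xi>\<^sup>2 / 2))) (at \<xi>)"
      by (rule has_vector_derivative_of_real)
    from has_vector_derivative_mult[OF this \<phi>_deriv[of \<xi>]]
    show ?thesis unfolding \<psi>_def \<psi>'_def exp_of_real by (simp add: algebra_simps)
  qed
  have b: "cmod (\<psi>' \<xi>) \<le> ?D" if "\<xi> \<in> {0..1}" for \<xi>
  proof -
    have sq: "\<xi>\<^sup>2 \<le> 1" "0 \<le> \<xi>" "\<xi> \<le> 1" using that by (auto simp: power_le_one)
    have "cmod (\<psi>' \<xi>) = exp (s * \<xi>\<^sup>2 / 2) * cmod (?I \<xi> - \<i> * of_real (\<xi> * s) * \<phi> \<xi>)"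
      by (simp add: \<psi>'_def norm_mult exp_of_real[symmetric] del: of_real_mult)
    also have "\<dots> \<le> exp (C\<^sup>2) * (2 * \<bar>\<xi>\<bar> * C\<^sup>2 * (7 + 2 * C * \<bar>\<xi>\<bar>) / sqrt n)"
    proof (intro mult_mono char_ode)
      have "s * \<xi>\<^sup>2 \<le> 2 * C\<^sup>2 * 1" using abs_s_le sq by (intro mult_mono) auto
      then show "exp (s * \<xi>\<^sup>2 / 2) \<le> exp (C\<^sup>2)" by simp
    qed auto
    also have "\<dots> \<le> ?D"
    proof (intro mult_left_mono divide_right_mono)
      have "2 * \<bar>\<xi>\<bar> * C\<^sup>2 * (7 + 2 * C * \<bar>\<xi>\<bar>) \<le> 2 * 1 * C\<^sup>2 * (7 + 2 * C * 1)"
        using sq C_nonneg by (intro mult_mono add_mono) auto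
      then show "2 * \<bar>\<xi>\<bar> * C\<^sup>2 * (7 + 2 * C * \<bar>\<xi>\<bar>) \<le> 2 * C\<^sup>2 * (7 + 2 * C)" by simp
    qed auto
    finally show ?thesis .
  qed
  have "cmod (\<psi> 1 - \<psi> 0) \<le> ?D * norm (1 - 0 :: real)"
  proof (rule differentiable_bound[of "{0..1}" \<psi> "\<lambda>\<xi> h. h *\<^sub>R \<psi>' \<xi>"])
    show "(\<psi> has_derivative (\<lambda>h. h *\<^sub>R \<psi>' \<xi>)) (at \<xi> within {0..1})" for \<xi>
      using d[of \<xi>] by (auto simp: has_vector_derivative_def intro: has_derivative_at_withinI)
    show "onorm (\<lambda>h. h *\<^sub>R \<psi>' \<xi>) \<le> ?D" if "\<xi> \<in> {0..1}" for \<xi>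
    proof (rule onorm_bound)
      show "0 \<le> ?D" using b[OF that] norm_ge_zero order_trans by blast
      show "norm (h *\<^sub>R \<psi>' \<xi>) \<le> ?D * norm h" for h
        unfolding norm_scaleR real_norm_def mult.commute[of "\<bar>h\<bar>"] by (intro mult_right_mono b that) auto
    qed
  qed auto
  moreover have "\<psi> 0 = 1" by (simp add: \<psi>_def \<phi>_def E_def prob_space)
  moreover have "\<phi> 1 - exp (- of_real (s / 2)) = exp (- of_real (s / 2)) * (\<psi> 1 - 1)"
    by (simp add: \<psi>_def right_diff_distrib mult.assoc[symmetric] exp_add[symmetric])
  moreover have "cmod (exp (- of_real (s / 2))) \<le> exp (C\<^sup>2)"
    using abs_s_le by simp
  ultimately show ?thesis by (simp only: norm_mult) (intro mult_mono; simp)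
qed

end

section \<open>Tightness by dyadic chaining\<close>

lemma adjacent_diff:
  fixes V :: "nat \<Rightarrow> nat \<Rightarrow> real"
  assumes 1: "\<And>x y. d * (x + 1) \<le> n \<Longrightarrow> d * y \<le> n \<Longrightarrow> \<bar>V (d * (x + 1)) (d * y) - V (d * x) (d * y)\<bar> \<le> a"
    and 2: "\<And>x y. d * x \<le> n \<Longrightarrow> d * (y + 1) \<le> n \<Longrightarrow> \<bar>V (d * x) (d * (y + 1)) - V (d * x) (d * y)\<bar> \<le> a"
    and a: "0 \<le> a" and x: "x = x' \<or> x = x' + 1" and y: "y = y' \<or> y = y' + 1" and n: "d * x \<le> n" "d * y \<le> n"
  shows "\<bar>V (d * x) (d * y) - V (d * x') (d * y')\<bar> \<le> 2 * a"
proof -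
  have "d * x' \<le> d * x" using x by auto
  then have "d * x' \<le> n" using n by linarith
  then have "\<bar>V (d * x') (d * y) - V (d * x') (d * y')\<bar> \<le> a"
    using y 2[of x' y'] n(2) a by auto
  moreover have "\<bar>V (d * x) (d * y) - V (d * x') (d * y)\<bar> \<le> a"
    using x 1[of x' y] n a by auto
  ultimately show ?thesis by linarith
qed

text \<open>A point is rounded down to multiples of \<open>2 ^ m\<close> for increasing
  \<open>m\<close>; passing to the next level moves each coordinate by zero or one step of length
  \<open>2 ^ m\<close>. At level \<open>M\<close> the two rounded points agree or are neighbours in
  each coordinate. The 4 counts two coordinates and two end points.\<close>

lemma dyadic_chaining:
  fixes V :: "nat \<Rightarrow> nat \<Rightarrow> real"
  assumes 1: "\<And>m x y. 2 ^ m * (x + 1) \<le> n \<Longrightarrow> 2 ^ m * y \<le> n \<Longrightarrow> \<bar>V (2 ^ m * (x + 1)) (2 ^ m * y) - V (2 ^ m * x) (2 ^ m * y)\<bar> \<le> a m"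
    and 2: "\<And>m x y. 2 ^ m * x \<le> n \<Longrightarrow> 2 ^ m * (y + 1) \<le> n \<Longrightarrow> \<bar>V (2 ^ m * x) (2 ^ m * (y + 1)) - V (2 ^ m * x) (2 ^ m * y)\<bar> \<le> a m"
    and a: "\<And>m. 0 \<le> a m"
    and p: "p' \<le> p" "p \<le> p' + 2 ^ M" "p \<le> n" and q: "q' \<le> q" "q \<le> q' + 2 ^ M" "q \<le> n"
  shows "\<bar>V p q - V p' q'\<bar> \<le> 4 * (\<Sum>m\<le>M. a m)"
proof -
  have le: "d * (x div d) \<le> n" if "x \<le> n" for d x :: nat
    using that times_div_less_eq_dividend order_trans by blast
  have chain: "\<bar>V p q - V (2 ^ m * (p div 2 ^ m)) (2 ^ m * (q div 2 ^ m))\<bar> \<le> 2 * (\<Sum>i<m. a i)"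
    if "p \<le> n" "q \<le> n" for p q m
  proof (induction m)
    case (Suc m)
    have half: "x = 2 * (x div 2) \<or> x = 2 * (x div 2) + 1" for x :: nat by auto
    have split: "2 ^ Suc m * (x div 2 ^ Suc m) = 2 ^ m * (2 * (x div 2 ^ m div 2))" for x :: nat
      unfolding power_Suc2 div_mult2_eq by simp
    have "\<bar>V (2 ^ m * (p div 2 ^ m)) (2 ^ m * (q div 2 ^ m)) - V (2 ^ Suc m * (p div 2 ^ Suc m)) (2 ^ Suc m * (q div 2 ^ Suc m))\<bar> \<le> 2 * a m"
      unfolding split by (rule adjacent_diff[OF 1 2 a half half]) (use that le in auto)
    then show ?case using Suc by (simp add: algebra_simps)
  qed simp
  have adj: "x div 2 ^ M = x' div 2 ^ M \<or> x div 2 ^ M = x' div 2 ^ M + 1" if "x' \<le> x" "x \<le> x' + 2 ^ M" for x x' :: nat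
  proof -
    have "x' div 2 ^ M \<le> x div 2 ^ M" "x div 2 ^ M \<le> (x' + 2 ^ M) div 2 ^ M"
      using div_le_mono[OF that(1), of "2 ^ M"] div_le_mono[OF that(2), of "2 ^ M"] by auto
    then show ?thesis by auto
  qed
  have "\<bar>V (2 ^ M * (p div 2 ^ M)) (2 ^ M * (q div 2 ^ M)) - V (2 ^ M * (p' div 2 ^ M)) (2 ^ M * (q' div 2 ^ M))\<bar> \<le> 2 * a M"
    by (rule adjacent_diff[OF 1 2 a adj adj]) (use p q le in auto)
  moreover have "\<bar>V p q - V (2 ^ M * (p div 2 ^ M)) (2 ^ M * (q div 2 ^ M))\<bar> \<le> 2 * (\<Sum>i<M. a i)"
    "\<bar>V p' q' - V (2 ^ M * (p' div 2 ^ M)) (2 ^ M * (q' div 2 ^ M))\<bar> \<le> 2 * (\<Sum>i<M. a i)"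
    using p q by (auto intro!: chain)
  moreover have "(\<Sum>m\<le>M. a m) = (\<Sum>i<M. a i) + a M"
    by (simp add: lessThan_Suc_atMost[symmetric])
  ultimately show ?thesis using a[of M] by linarith
qed

text \<open>Beyond \<open>d\<close> the factor \<open>(\<bar>w\<bar> / d)^5\<close> is at least 1.
  Thus the maximum of many increments is at most \<open>d\<close> plus a sum of sixth powers, whose
  mean is under control.\<close>

lemma le_add_power6_div:
  fixes w d :: real
  assumes "0 < d" shows "\<bar>w\<bar> \<le> d + w ^ 6 / d ^ 5"
proof (cases "\<bar>w\<bar> \<le> d")
  case True
  then show ?thesis using assms by (simp add: add_increasing2)
next
  case False
  then have "d ^ 5 \<le> \<bar>w\<bar> ^ 5" using assms by (intro power_mono) auto
  then have "\<bar>w\<bar> * d ^ 5 \<le> \<bar>w\<bar> * \<bar>w\<bar> ^ 5" by (intro mult_left_mono) auto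
  also have "\<dots> = \<bar>w ^ 6\<bar>" by (simp add: power_abs power_numeral_reduce abs_mult)
  finally have "\<bar>w\<bar> \<le> w ^ 6 / d ^ 5" using assms by (simp add: pos_le_divide_eq)
  then show ?thesis using assms by simp
qed

text \<open>The 4 comes from chaining, \<open>481 = 1 + 480\<close> from a single level, and the
  last factor from summing a geometric progression of ratio \<open>2 powr (1/6)\<close>.\<close>

definition chain_const :: real where
  "chain_const = 4 * (481 * (2 powr (1/6) / (2 powr (1/6) - 1)))"

section \<open>Chaining for the centred block sums\<close>

context haar12
begin

definition Vp :: "cmat \<Rightarrow> nat \<Rightarrow> nat \<Rightarrow> real" where "Vp U p q = Tc {..<p} {..<q} U"

lemma Vp_row_diff: "Vp U (p + r) q - Vp U p q = Tc {p..<p + r} {..<q} U"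
proof -
  have "Tr {..<p + r} {..<q} U = Tr {..<p} {..<q} U + Tr {p..<p + r} {..<q} U"
    unfolding Tr_def by (subst sum.union_disjoint[symmetric]) (auto intro!: sum.cong)
  then show ?thesis by (simp add: Vp_def Tc_def algebra_simps add_divide_distrib)
qed

lemma Vp_col_diff: "Vp U p (q + r) - Vp U p q = Tc {..<p} {q..<q + r} U"
proof -
  have "(\<Sum>j<q + r. f j) = (\<Sum>j<q. f j) + (\<Sum>j\<in>{q..<q + r}. f j)" for f :: "nat \<Rightarrow> real"
    by (subst sum.union_disjoint[symmetric]) (auto intro!: sum.cong)
  then have "Tr {..<p} {..<q + r} U = Tr {..<p} {..<q} U + Tr {..<p} {q..<q + r} U"
    unfolding Tr_def by (simp add: sum.distrib)
  then show ?thesis by (simp add: Vp_def Tc_def algebra_simps add_divide_distrib)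
qed

lemma Vp_moment6:
  assumes "p + r \<le> n" "q \<le> n"
  shows "(\<integral>U. (Vp U (p + r) q - Vp U p q) ^ 6 \<partial>M) \<le> 120 * (r / n) ^ 3"
    and "(\<integral>U. (Vp U q (p + r) - Vp U q p) ^ 6 \<partial>M) \<le> 120 * (r / n) ^ 3"
proof -
  have sub: "{p..<p + r} \<subseteq> {..<n}" "{..<q} \<subseteq> {..<n}" using assms by auto
  show "(\<integral>U. (Vp U (p + r) q - Vp U p q) ^ 6 \<partial>M) \<le> 120 * (r / n) ^ 3"
    unfolding Vp_row_diff using Tr_le_rows[OF _ sub(2), of _ "{p..<p + r}"] by (intro moment6 sub) auto
  show "(\<integral>U. (Vp U q (p + r) - Vp U q p) ^ 6 \<partial>M) \<le> 120 * (r / n) ^ 3"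
    unfolding Vp_col_diff using Tr_le_cols[OF _ sub] by (intro moment6 sub) auto
qed

lemma integrable_Vp_power: "integrable M (\<lambda>U. (Vp U (p + r) q - Vp U p q) ^ k)"
    "integrable M (\<lambda>U. (Vp U q (p + r) - Vp U q p) ^ k)"
  unfolding Vp_row_diff Vp_col_diff by (rule integrable_Tc_power)+

text \<open>At mesh \<rho> there are at most \<open>2 / \<rho>^2\<close> index pairs, each
  contributing a sixth moment of order \<open>\<rho>^3\<close>, so a level costs a multiple of
  \<open>\<rho>^(1/6)\<close> in mean. The costs grow geometrically with the level, hence the
  coarsest one dominates.\<close>

lemma chaining_bound:
  assumes M: "2 ^ m0 \<le> n"
  shows "\<exists>S. integrable M S \<and> (\<integral>U. S U \<partial>M) \<le> chain_const * (2 ^ m0 / n) powr (1/6) \<and>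
    (\<forall>U p q p' q'. p' \<le> p \<longrightarrow> p \<le> p' + 2 ^ m0 \<longrightarrow> p \<le> n \<longrightarrow> q' \<le> q \<longrightarrow> q \<le> q' + 2 ^ m0 \<longrightarrow> q \<le> n
       \<longrightarrow> \<bar>Vp U p q - Vp U p' q'\<bar> \<le> S U)"
proof -
  define N where "N = (\<lambda>m::nat. n div 2 ^ m)"
  define \<rho> where "\<rho> = (\<lambda>m::nat. 2 ^ m / real n)"
  \<comment> \<open>Balances the two parts of the cost of a level, \<delta> itself and
    \<open>\<rho> / \<delta>^5\<close>.\<close>
  define \<delta> where "\<delta> = (\<lambda>m. \<rho> m powr (1/6))"
  \<comment> \<open>The first entry indexes the step that is taken, hence the strict bound; the
    second indexes the line on which it is taken. Since \<open>w\<close> adds a step along rows and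
    one along columns, one index set serves both directions.\<close>
  define I where "I = (\<lambda>m. {..<N m} \<times> {..N m})"
  define w where "w = (\<lambda>m (x, y) U. (Vp U (2 ^ m * x + 2 ^ m) (2 ^ m * y) - Vp U (2 ^ m * x) (2 ^ m * y)) ^ 6
     + (Vp U (2 ^ m * y) (2 ^ m * x + 2 ^ m) - Vp U (2 ^ m * y) (2 ^ m * x)) ^ 6)"
  define a where "a = (\<lambda>m U. \<delta> m + (\<Sum>i\<in>I m. w m i U) / \<delta> m ^ 5)"
  have \<rho>0: "0 < \<rho> m" for m using n by (simp add: \<rho>_def)
  have \<delta>0: "0 < \<delta> m" for m using \<rho>0[of m] by (simp add: \<delta>_def)
  have \<delta>6: "\<delta> m ^ 6 = \<rho> m" for m
    using \<rho>0[of m] by (simp add: \<delta>_def powr_realpow[symmetric] powr_powr)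
  have w0: "0 \<le> w m i U" for m i U by (auto simp: w_def split: prod.splits)
  have a0: "0 \<le> a m U" for m U
    using \<delta>0[of m] by (auto simp: a_def intro!: add_nonneg_nonneg divide_nonneg_nonneg sum_nonneg w0)
  have fin: "finite (I m)" for m by (simp add: I_def)
  have mem: "(x, y) \<in> I m" if "2 ^ m * (x + 1) \<le> n" "2 ^ m * y \<le> n" for m x y
  proof -
    have "x + 1 \<le> N m" "y \<le> N m" using that unfolding N_def by (simp_all add: less_eq_div_iff_mult_less_eq mult.commute)
    then show ?thesis by (simp add: I_def)
  qed
  have le_a: "\<bar>z\<bar> \<le> a m U" if "i \<in> I m" "z ^ 6 \<le> w m i U" for z m i U
  proof -
    have "w m i U \<le> (\<Sum>i\<in>I m. w m i U)" using that fin w0 by (intro member_le_sum) auto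
    then have "z ^ 6 / \<delta> m ^ 5 \<le> (\<Sum>i\<in>I m. w m i U) / \<delta> m ^ 5"
      using that \<delta>0[of m] by (intro divide_right_mono) auto
    then show ?thesis using le_add_power6_div[OF \<delta>0[of m], of z] by (simp add: a_def)
  qed
  have det: "\<bar>Vp U p q - Vp U p' q'\<bar> \<le> 4 * (\<Sum>m\<le>m0. a m U)"
    if "p' \<le> p" "p \<le> p' + 2 ^ m0" "p \<le> n" "q' \<le> q" "q \<le> q' + 2 ^ m0" "q \<le> n" for U p q p' q'
  proof (rule dyadic_chaining[OF _ _ a0 that])
    show "\<bar>Vp U (2 ^ m * (x + 1)) (2 ^ m * y) - Vp U (2 ^ m * x) (2 ^ m * y)\<bar> \<le> a m U"
      if "2 ^ m * (x + 1) \<le> n" "2 ^ m * y \<le> n" for m x y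
      unfolding distrib_left mult_1_right by (rule le_a[OF mem[OF that]]) (simp add: w_def)
    show "\<bar>Vp U (2 ^ m * x) (2 ^ m * (y + 1)) - Vp U (2 ^ m * x) (2 ^ m * y)\<bar> \<le> a m U"
      if "2 ^ m * x \<le> n" "2 ^ m * (y + 1) \<le> n" for m x y
      unfolding distrib_left mult_1_right by (rule le_a[OF mem[OF that(2,1)]]) (simp add: w_def)
  qed
  have intw: "integrable M (w m i)" for m i
    unfolding w_def by (cases i) (auto intro!: Bochner_Integration.integrable_add integrable_Vp_power)
  have inta: "integrable M (a m)" for m
    unfolding a_def by (auto intro!: Bochner_Integration.integrable_add integrable_divide Bochner_Integration.integrable_sum intw)
  have Ew: "(\<integral>U. w m i U \<partial>M) \<le> 240 * \<rho> m ^ 3" if iI: "i \<in> I m" for m i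
  proof -
    obtain x y where i: "i = (x, y)" "x < N m" "y \<le> N m" using iI by (cases i) (auto simp: I_def)
    then have "2 ^ m * (x + 1) \<le> n" "2 ^ m * y \<le> n" unfolding N_def
      by (metis Suc_eq_plus1 Suc_leI mult_le_mono2 order_trans times_div_less_eq_dividend)
         (metis i(3) N_def mult_le_mono2 order_trans times_div_less_eq_dividend)
    then have b: "2 ^ m * x + 2 ^ m \<le> n" "2 ^ m * y \<le> n" by (auto simp: distrib_left)
    have "(\<integral>U. w m i U \<partial>M) = (\<integral>U. (Vp U (2 ^ m * x + 2 ^ m) (2 ^ m * y) - Vp U (2 ^ m * x) (2 ^ m * y)) ^ 6 \<partial>M)
     + (\<integral>U. (Vp U (2 ^ m * y) (2 ^ m * x + 2 ^ m) - Vp U (2 ^ m * y) (2 ^ m * x)) ^ 6 \<partial>M)"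
      unfolding w_def i by (simp add: integrable_Vp_power)
    also have "\<dots> \<le> 120 * \<rho> m ^ 3 + 120 * \<rho> m ^ 3"
      using Vp_moment6[OF b] by (intro add_mono) (simp_all add: \<rho>_def)
    finally show ?thesis by simp
  qed
  have Ea: "(\<integral>U. a m U \<partial>M) \<le> 481 * \<delta> m" if "m \<le> m0" for m
  proof -
    have "2 ^ m \<le> (2::nat) ^ m0" using that by simp
    then have "2 ^ m \<le> n" using M by linarith
    then have "real (2 ^ m) \<le> real n" by (simp only: of_nat_le_iff)
    then have \<rho>1: "\<rho> m \<le> 1" using n by (simp add: \<rho>_def)
    have "real (2 ^ m * N m) \<le> n" unfolding N_def of_nat_le_iff by (rule times_div_less_eq_dividend)
    then have N: "N m \<le> 1 / \<rho> m" using n by (simp add: \<rho>_def field_simps)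
    have "(\<integral>U. a m U \<partial>M) = \<delta> m + (\<Sum>i\<in>I m. \<integral>U. w m i U \<partial>M) / \<delta> m ^ 5"
      unfolding a_def using intw prob_space by (simp add: Bochner_Integration.integral_sum integrable_divide Bochner_Integration.integrable_sum)
    also have "\<dots> \<le> \<delta> m + (card (I m) * (240 * \<rho> m ^ 3)) / \<delta> m ^ 5"
      using \<delta>0[of m] by (intro add_left_mono divide_right_mono sum_bounded_above Ew) auto
    also have "real (card (I m)) * (240 * \<rho> m ^ 3) \<le> 480 * \<rho> m"
    proof -
      have "real (card (I m)) = real (N m) * (real (N m) + 1)" by (simp add: I_def algebra_simps)
      also have "\<dots> \<le> (1 / \<rho> m) * (1 / \<rho> m + 1 / \<rho> m)"
        using N \<rho>0[of m] \<rho>1 by (intro mult_mono add_mono) (auto simp: divide_simps)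
      finally have "real (card (I m)) * (240 * \<rho> m ^ 3) \<le> ((1 / \<rho> m) * (1 / \<rho> m + 1 / \<rho> m)) * (240 * \<rho> m ^ 3)"
        using \<rho>0[of m] by (intro mult_right_mono) auto
      also have "\<dots> = 480 * \<rho> m" using \<rho>0[of m] by (simp add: field_simps power3_eq_cube)
      finally show ?thesis .
    qed
    then have "\<delta> m + (card (I m) * (240 * \<rho> m ^ 3)) / \<delta> m ^ 5 \<le> \<delta> m + (480 * \<rho> m) / \<delta> m ^ 5"
      using \<delta>0[of m] by (intro add_left_mono divide_right_mono) auto
    also have "\<dots> = \<delta> m + 480 * \<delta> m" using \<delta>0[of m] \<delta>6[of m, symmetric] by (simp add: power_numeral_reduce)
    finally show ?thesis by simp
  qed
  define r :: real where "r = 2 powr (1/6)"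
  have r1: "1 < r" unfolding r_def by simp
  have \<delta>r: "\<delta> m = (1 / n) powr (1/6) * r ^ m" for m
  proof -
    have "(2 ^ m :: real) powr (1/6) = r ^ m"
      by (simp add: r_def powr_realpow[symmetric] powr_powr mult.commute)
    moreover have "\<rho> m = (1 / n) * 2 ^ m" by (simp add: \<rho>_def)
    ultimately show ?thesis unfolding \<delta>_def by (simp only: powr_mult)
  qed
  have "(\<integral>U. 4 * (\<Sum>m\<le>m0. a m U) \<partial>M) = 4 * (\<Sum>m\<le>m0. \<integral>U. a m U \<partial>M)"
    by (simp add: Bochner_Integration.integral_sum inta)
  also have "\<dots> \<le> 4 * (\<Sum>m\<le>m0. 481 * \<delta> m)"
    by (intro mult_left_mono sum_mono Ea) auto
  also have "(\<Sum>m\<le>m0. 481 * \<delta> m) = 481 * ((1 / n) powr (1/6) * (\<Sum>m\<le>m0. r ^ m))"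
    by (simp add: \<delta>r sum_distrib_left)
  also have "(\<Sum>m\<le>m0. r ^ m) \<le> r / (r - 1) * r ^ m0"
    using r1 by (simp add: lessThan_Suc_atMost[symmetric] geometric_sum divide_simps del: sum.lessThan_Suc)
  then have "4 * (481 * ((1 / n) powr (1/6) * (\<Sum>m\<le>m0. r ^ m))) \<le> 4 * (481 * ((1 / n) powr (1/6) * (r / (r - 1) * r ^ m0)))"
    by (intro mult_left_mono) auto
  also have "\<dots> = chain_const * \<delta> m0"
    by (simp add: \<delta>r chain_const_def r_def)
  finally have "(\<integral>U. 4 * (\<Sum>m\<le>m0. a m U) \<partial>M) \<le> chain_const * (2 ^ m0 / n) powr (1/6)"
    by (simp add: \<delta>_def \<rho>_def)
  moreover have "integrable M (\<lambda>U. 4 * (\<Sum>m\<le>m0. a m U))"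
    by (auto intro!: integrable_mult_right Bochner_Integration.integrable_sum inta)
  ultimately show ?thesis using det by blast
qed

end

section \<open>Convergence in finite dimensions\<close>

text \<open>Trigonometric polynomials in the coordinates of \<open>I\<close>: products add
  frequencies, and expectations are determined by characteristic functions.\<close>

inductive trig :: "'i set \<Rightarrow> (('i \<Rightarrow> real) \<Rightarrow> complex) \<Rightarrow> bool" for I where
  trig_exp: "trig I (\<lambda>x. a * exp (\<i> * of_real (\<Sum>j\<in>I. c j * x j)))"
| trig_add: "trig I f \<Longrightarrow> trig I g \<Longrightarrow> trig I (\<lambda>x. f x + g x)"

lemma trig_const: "trig I (\<lambda>x. a)"
  using trig_exp[of I a "\<lambda>_. 0"] by simp

lemma trig_exp_mult:
  assumes "trig I f" shows "trig I (\<lambda>x. (a * exp (\<i> * of_real (\<Sum>j\<in>I. c j * x j))) * f x)"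
  using assms
proof induction
  case (trig_exp b d)
  have "(\<lambda>x. (a * exp (\<i> * of_real (\<Sum>j\<in>I. c j * x j))) * (b * exp (\<i> * of_real (\<Sum>j\<in>I. d j * x j)))) =
    (\<lambda>x. (a * b) * exp (\<i> * of_real (\<Sum>j\<in>I. (c j + d j) * x j)))"
    by (simp add: fun_eq_iff sum.distrib ring_distribs exp_add)
  then show ?case using trig.trig_exp[of I "a * b" "\<lambda>j. c j + d j"] by simp
next
  case (trig_add f g)
  then show ?case by (simp add: ring_distribs trig.trig_add)
qed

lemma trig_mult:
  assumes "trig I f" "trig I g" shows "trig I (\<lambda>x. f x * g x)"
  using assms by induction (auto simp: ring_distribs intro: trig_exp_mult trig_add simp del: of_real_sum of_real_mult)

lemma trig_sin:
  assumes "finite I" "i \<in> I" shows "trig I (\<lambda>x. of_real (sin (w * x i)))"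
proof -
  have s: "(\<Sum>j\<in>I. (if j = i then v else 0) * x j) = v * x i" for v :: real and x
    using assms by (simp add: if_distrib[where f = "\<lambda>t. t * _"] cong: if_cong)
  have "complex_of_real (sin y) = (1 / (2 * \<i>)) * exp (\<i> * of_real y) + (- 1 / (2 * \<i>)) * exp (\<i> * of_real (- y))" for y
    by (simp add: sin_of_real[symmetric] sin_exp_eq field_simps)
  then have "(\<lambda>x. complex_of_real (sin (w * x i))) =
    (\<lambda>x. (1 / (2 * \<i>)) * exp (\<i> * of_real (\<Sum>j\<in>I. (if j = i then w else 0) * x j))
       + (- 1 / (2 * \<i>)) * exp (\<i> * of_real (\<Sum>j\<in>I. (if j = i then - w else 0) * x j)))"
    unfolding s by (simp only: mult_minus_left)
  then show ?thesis
    using trig_add[OF trig_exp[of I "1 / (2 * \<i>)" "\<lambda>j. if j = i then w else 0"] trig_exp[of I "- 1 / (2 * \<i>)" "\<lambda>j. if j = i then - w else 0"]]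
    by simp
qed

lemma trig_integrable:
  assumes "prob_space N" "trig I f" "\<And>i. i \<in> I \<Longrightarrow> (\<lambda>u. V u i) \<in> borel_measurable N"
  shows "integrable N (\<lambda>u. f (V u))"
  using assms(2)
proof induction
  case (trig_exp a c)
  interpret prob_space N by fact
  have [measurable]: "(\<lambda>u. \<Sum>j\<in>I. c j * V u j) \<in> borel_measurable N"
    using assms(3) by (intro borel_measurable_sum borel_measurable_times) auto
  show ?case
  proof (rule integrable_const_bound[of _ "cmod a"])
    show "AE u in N. cmod (a * exp (\<i> * of_real (\<Sum>j\<in>I. c j * V u j))) \<le> cmod a"
      by (simp add: norm_mult del: of_real_sum of_real_mult)
  qed measurable
qed auto

lemma compact_box:
  "compact {z :: 'i \<Rightarrow> real. \<forall>i. z i \<in> (if i \<in> I then {-1..1} else {0})}"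
proof -
  have "compactin (product_topology (\<lambda>i. euclidean) UNIV) (PiE UNIV (\<lambda>i::'i. if i \<in> I then {-1..1} else {0::real}))"
    unfolding compactin_PiE by (auto simp: compactin_euclidean_iff)
  moreover have "PiE UNIV (\<lambda>i::'i. if i \<in> I then {-1..1} else {0::real}) = {z. \<forall>i. z i \<in> (if i \<in> I then {-1..1} else {0})}"
    by (simp add: PiE_UNIV_domain Pi_def)
  ultimately show ?thesis by (simp only: euclidean_product_topology compactin_euclidean_iff)
qed

text \<open>On \<open>[-R, R]\<close> the triangle wave \<open>arcsin (sin (\<pi> y / 2R))\<close> is linear, so a bounded continuous function
  can be replaced, off an event controlled by Chebyshev's inequality, by a continuous function of the sines,
  to which the Stone--Weierstrass theorem applies.\<close>

lemma trig_approx: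
  fixes h :: "('i::countable \<Rightarrow> real) \<Rightarrow> real"
  assumes I: "finite I" and h: "continuous_on UNIV h" and B: "\<And>x. \<bar>h x\<bar> \<le> B"
    and dep: "\<And>x y. (\<And>i. i \<in> I \<Longrightarrow> x i = y i) \<Longrightarrow> h x = h y" and R: "R > 0" and e: "e > 0"
  shows "\<exists>f. trig I f \<and> (\<forall>x. cmod (of_real (h x) - f x) \<le> e + 2 * B * (\<Sum>i\<in>I. (x i)\<^sup>2) / R\<^sup>2)"
proof -
  define w where "w = pi / (2 * R)"
  have w: "w > 0" using R by (simp add: w_def)
  \<comment> \<open>Coordinates outside \<open>I\<close> are frozen at 0, so the box is compact and
    the coordinates in \<open>I\<close> already separate its points.\<close>
  define S where "S = {z :: 'i \<Rightarrow> real. \<forall>i. z i \<in> (if i \<in> I then {-1..1} else {0})}"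
  define \<sigma> where "\<sigma> = (\<lambda>x i. if i \<in> I then sin (w * x i) else 0)"
  define H where "H = (\<lambda>z. h (\<lambda>i. arcsin (z i) / w))"
  define Q where "Q = (\<lambda>g. continuous_on S g \<and> (\<exists>f. trig I f \<and> (\<forall>x. complex_of_real (g (\<sigma> x)) = f x)))"
  have S: "z i \<in> {-1..1}" if "z \<in> S" for z i
    using that by (auto simp: S_def split: if_splits dest!: spec[of _ i])
  have \<sigma>S: "\<sigma> x \<in> S" for x by (auto simp: \<sigma>_def S_def)
  have coord: "continuous_on S (\<lambda>z. z i)" for i
    by (rule continuous_on_subset[OF continuous_on_product_coordinates]) simp
  have contH: "continuous_on S H"
    unfolding H_def
  proof (rule continuous_on_compose2[OF h])
    show "continuous_on S (\<lambda>z i. arcsin (z i) / w)"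
      using S w by (intro continuous_on_coordinatewise_then_product continuous_intros coord) auto
  qed auto
  have "\<exists>g. Q g \<and> (\<forall>x\<in>S. \<bar>H x - g x\<bar> < e)"
  proof (rule Stone_Weierstrass_HOL)
    show "compact S" unfolding S_def by (rule compact_box)
    show "Q (\<lambda>x. c)" for c using trig_const[of I "of_real c"] by (auto simp: Q_def)
    show "continuous_on S f" if "Q f" for f using that by (simp add: Q_def)
    show "Q (\<lambda>x. f x + g x)" if "Q f \<and> Q g" for f g
    proof -
      obtain f' g' where fg: "trig I f'" "trig I g'" "\<And>x. complex_of_real (f (\<sigma> x)) = f' x" "\<And>x. complex_of_real (g (\<sigma> x)) = g' x"
        using \<open>Q f \<and> Q g\<close> by (auto simp: Q_def)
      have "continuous_on S (\<lambda>x. f x + g x)" using \<open>Q f \<and> Q g\<close> by (auto simp: Q_def intro: continuous_on_add)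
      then show ?thesis using fg trig_add[OF fg(1,2)] by (auto simp: Q_def)
    qed
    show "Q (\<lambda>x. f x * g x)" if "Q f \<and> Q g" for f g
    proof -
      obtain f' g' where fg: "trig I f'" "trig I g'" "\<And>x. complex_of_real (f (\<sigma> x)) = f' x" "\<And>x. complex_of_real (g (\<sigma> x)) = g' x"
        using \<open>Q f \<and> Q g\<close> by (auto simp: Q_def)
      have "continuous_on S (\<lambda>x. f x * g x)" using \<open>Q f \<and> Q g\<close> by (auto simp: Q_def intro: continuous_on_mult)
      then show ?thesis using fg trig_mult[OF fg(1,2)] by (auto simp: Q_def)
    qed
    show "\<exists>f. Q f \<and> f x \<noteq> f y" if xy: "x \<in> S \<and> y \<in> S \<and> x \<noteq> y" for x y
    proof -
      obtain i where i: "x i \<noteq> y i" using xy by (auto simp: fun_eq_iff)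
      have "i \<in> I"
      proof (rule ccontr)
        assume "i \<notin> I"
        then have "x i = 0" "y i = 0" using xy by (auto simp: S_def dest!: spec[of _ i])
        then show False using i by simp
      qed
      then have "Q (\<lambda>z. z i)" using trig_sin[OF I] coord by (auto simp: Q_def \<sigma>_def)
      then show ?thesis using i by blast
    qed
  qed (use contH e in auto)
  then obtain g f where g: "\<And>x. x \<in> S \<Longrightarrow> \<bar>H x - g x\<bar> < e" and f: "trig I f" "\<And>x. complex_of_real (g (\<sigma> x)) = f x"
    by (auto simp: Q_def)
  have "cmod (of_real (h x) - f x) \<le> e + 2 * B * (\<Sum>i\<in>I. (x i)\<^sup>2) / R\<^sup>2" for x
  proof -
    have B0: "0 \<le> B" using B[of x] by linarith
    have hH: "\<bar>h x - H (\<sigma> x)\<bar> \<le> 2 * B * (\<Sum>i\<in>I. (x i)\<^sup>2) / R\<^sup>2"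
    proof (cases "\<forall>i\<in>I. \<bar>x i\<bar> \<le> R")
      case True
      have "h x = H (\<sigma> x)"
        unfolding H_def
      proof (rule dep)
        fix i assume i: "i \<in> I"
        have "\<bar>w * x i\<bar> = w * \<bar>x i\<bar>" using w by (simp add: abs_mult)
        also have "\<dots> \<le> w * R" using True i w by (intro mult_left_mono) auto
        also have "\<dots> = pi / 2" using R by (simp add: w_def)
        finally have "arcsin (sin (w * x i)) = w * x i" by (intro arcsin_sin) auto
        then show "x i = arcsin (\<sigma> x i) / w" using i w by (simp add: \<sigma>_def)
      qed
      then show ?thesis using B0 by (simp add: sum_nonneg)
    next
      case False
      then obtain i where i: "i \<in> I" "\<bar>x i\<bar> > R" by auto
      then have "R\<^sup>2 \<le> \<bar>x i\<bar>\<^sup>2" using R by (intro power_mono) auto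
      also have "\<dots> \<le> (\<Sum>i\<in>I. (x i)\<^sup>2)" using i I member_le_sum[of i I "\<lambda>i. (x i)\<^sup>2"] by simp
      finally have "1 \<le> (\<Sum>i\<in>I. (x i)\<^sup>2) / R\<^sup>2" using R by simp
      then have "2 * B * 1 \<le> 2 * B * ((\<Sum>i\<in>I. (x i)\<^sup>2) / R\<^sup>2)" using B0 by (intro mult_left_mono) auto
      moreover have "\<bar>h x - H (\<sigma> x)\<bar> \<le> 2 * B" using B[of x] B[of "\<lambda>i. arcsin (\<sigma> x i) / w"] by (simp add: H_def)
      ultimately show ?thesis by simp
    qed
    have "cmod (of_real (h x) - f x) = \<bar>h x - g (\<sigma> x)\<bar>"
      unfolding f(2)[symmetric] of_real_diff[symmetric] norm_of_real ..
    also have "\<dots> \<le> \<bar>h x - H (\<sigma> x)\<bar> + \<bar>H (\<sigma> x) - g (\<sigma> x)\<bar>" by simp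
    finally show ?thesis using hH g[OF \<sigma>S, of x] by simp
  qed
  then show ?thesis using f(1) by blast
qed

text \<open>Uniform second moments play the role of tightness: replacing \<open>h\<close> by a
  trigonometric polynomial costs little in mean, uniformly in \<open>n\<close>, and for the
  polynomial the convergence is linear in \<open>char\<close>.\<close>

lemma cramer_wold:
  fixes h :: "('i::countable \<Rightarrow> real) \<Rightarrow> real"
  assumes M: "\<And>n. prob_space (M n)" and P: "prob_space P" and I: "finite I"
    and V: "\<And>n i. (\<lambda>u. V n u i) \<in> borel_measurable (M n)"
    and Y: "\<And>i. (\<lambda>u. Y u i) \<in> borel_measurable P"
    and char: "\<And>c. (\<lambda>n. \<integral>u. exp (\<i> * of_real (\<Sum>j\<in>I. c j * V n u j)) \<partial>M n) \<longlonglongrightarrow>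
       (\<integral>u. exp (\<i> * of_real (\<Sum>j\<in>I. c j * Y u j)) \<partial>P)"
    and V2: "\<And>n i. i \<in> I \<Longrightarrow> integrable (M n) (\<lambda>u. (V n u i)\<^sup>2) \<and> (\<integral>u. (V n u i)\<^sup>2 \<partial>M n) \<le> C"
    and Y2: "\<And>i. i \<in> I \<Longrightarrow> integrable P (\<lambda>u. (Y u i)\<^sup>2) \<and> (\<integral>u. (Y u i)\<^sup>2 \<partial>P) \<le> C"
    and h: "continuous_on UNIV h" and B: "\<And>x. \<bar>h x\<bar> \<le> B"
    and dep: "\<And>x y. (\<And>i. i \<in> I \<Longrightarrow> x i = y i) \<Longrightarrow> h x = h y"
  shows "(\<lambda>n. \<integral>u. h (V n u) \<partial>M n) \<longlonglongrightarrow> (\<integral>u. h (Y u) \<partial>P)"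
proof (rule LIMSEQ_I)
  have B0: "0 \<le> B" using B[of undefined] by linarith
  have near: "cmod (of_real (\<integral>u. h (X u) \<partial>N) - (\<integral>u. f (X u) \<partial>N)) \<le> e + 2 * B * (card I * C) / R\<^sup>2"
    if N: "prob_space N" and X: "\<And>i. (\<lambda>u. X u i) \<in> borel_measurable N"
      and X2: "\<And>i. i \<in> I \<Longrightarrow> integrable N (\<lambda>u. (X u i)\<^sup>2) \<and> (\<integral>u. (X u i)\<^sup>2 \<partial>N) \<le> C"
      and f: "trig I f" "\<And>x. cmod (of_real (h x) - f x) \<le> e + 2 * B * (\<Sum>i\<in>I. (x i)\<^sup>2) / R\<^sup>2"
    for N :: "'x measure" and X :: "'x \<Rightarrow> 'i \<Rightarrow> real" and f e R
  proof -
    interpret prob_space N by fact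
    have mX: "X \<in> borel_measurable N" by (rule measurable_coordinatewise_then_product) (rule X)
    have mh: "(\<lambda>u. h (X u)) \<in> borel_measurable N"
      using measurable_compose[OF mX borel_measurable_continuous_onI[OF h]] .
    have i1: "integrable N (\<lambda>u. h (X u))"
      by (rule integrable_const_bound[of _ B]) (use B mh in auto)
    have i2: "integrable N (\<lambda>u. f (X u))" by (rule trig_integrable[OF N f(1) X])
    have i3: "integrable N (\<lambda>u. \<Sum>i\<in>I. (X u i)\<^sup>2)" using X2 by (intro Bochner_Integration.integrable_sum) auto
    have "of_real (\<integral>u. h (X u) \<partial>N) - (\<integral>u. f (X u) \<partial>N) = (\<integral>u. of_real (h (X u)) - f (X u) \<partial>N)"
      using i1 i2 by simp
    also have "cmod \<dots> \<le> (\<integral>u. cmod (of_real (h (X u)) - f (X u)) \<partial>N)" by (rule integral_norm_bound)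
    also have "\<dots> \<le> (\<integral>u. e + 2 * B * (\<Sum>i\<in>I. (X u i)\<^sup>2) / R\<^sup>2 \<partial>N)"
      using i1 i2 i3 by (intro integral_mono f(2)) auto
    also have "\<dots> = e + 2 * B * (\<integral>u. (\<Sum>i\<in>I. (X u i)\<^sup>2) \<partial>N) / R\<^sup>2" using i3 prob_space by simp
    also have "(\<integral>u. (\<Sum>i\<in>I. (X u i)\<^sup>2) \<partial>N) = (\<Sum>i\<in>I. \<integral>u. (X u i)\<^sup>2 \<partial>N)"
      using X2 by (intro Bochner_Integration.integral_sum) auto
    also have "e + 2 * B * (\<Sum>i\<in>I. \<integral>u. (X u i)\<^sup>2 \<partial>N) / R\<^sup>2 \<le> e + 2 * B * (card I * C) / R\<^sup>2"
      using X2 B0 by (intro add_left_mono divide_right_mono mult_left_mono sum_bounded_above) auto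
    finally show ?thesis .
  qed
  fix r :: real assume r: "r > 0"
  define D where "D = 2 * B * (card I * C)"
  \<comment> \<open>Large enough to push the Chebyshev term below \<open>r / 10\<close>; the summand
    1 keeps \<open>R\<close> positive.\<close>
  define R where "R = sqrt (10 * \<bar>D\<bar> / r + 1)"
  have R: "R > 0" "R\<^sup>2 = 10 * \<bar>D\<bar> / r + 1" using r by (auto simp: R_def add_nonneg_pos)
  have "(r / 10) * R\<^sup>2 = \<bar>D\<bar> + r / 10" using r unfolding R by (simp add: field_simps)
  then have "D \<le> (r / 10) * R\<^sup>2" using r by linarith
  then have DR: "2 * B * (card I * C) / R\<^sup>2 \<le> r / 10" using R(1) by (simp add: D_def pos_divide_le_eq)
  from trig_approx[OF I h B dep R(1), of "r / 10"] r obtain f where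
    f: "trig I f" "\<And>x. cmod (of_real (h x) - f x) \<le> r / 10 + 2 * B * (\<Sum>i\<in>I. (x i)\<^sup>2) / R\<^sup>2" by auto
  have lim: "(\<lambda>n. \<integral>u. f (V n u) \<partial>M n) \<longlonglongrightarrow> (\<integral>u. f (Y u) \<partial>P)"
    using f(1)
  proof induction
    case (trig_exp a c)
    then show ?case using tendsto_mult_left[OF char[of c], of a] by simp
  next
    case (trig_add f g)
    then show ?case
      using trig_integrable[OF M trig_add.hyps(1) V] trig_integrable[OF M trig_add.hyps(2) V]
        trig_integrable[OF P trig_add.hyps(1) Y] trig_integrable[OF P trig_add.hyps(2) Y]
      by (simp add: tendsto_add)
  qed
  then obtain n0 where n0: "\<And>n. n \<ge> n0 \<Longrightarrow> cmod ((\<integral>u. f (V n u) \<partial>M n) - (\<integral>u. f (Y u) \<partial>P)) < r / 10"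
    using LIMSEQ_D[OF lim, of "r / 10"] r by auto
  show "\<exists>n0. \<forall>n\<ge>n0. norm ((\<integral>u. h (V n u) \<partial>M n) - (\<integral>u. h (Y u) \<partial>P)) < r"
  proof (intro exI allI impI)
    fix n assume n: "n \<ge> n0"
    let ?a = "\<integral>u. h (V n u) \<partial>M n" and ?b = "\<integral>u. h (Y u) \<partial>P" and ?a' = "\<integral>u. f (V n u) \<partial>M n" and ?b' = "\<integral>u. f (Y u) \<partial>P"
    have a: "cmod (of_real ?a - ?a') \<le> r / 10 + r / 10" by (rule order_trans[OF near[OF M V V2 f] add_left_mono[OF DR]])
    have b: "cmod (of_real ?b - ?b') \<le> r / 10 + r / 10" by (rule order_trans[OF near[OF P Y Y2 f] add_left_mono[OF DR]])
    have "norm (?a - ?b) = cmod (of_real ?a - of_real ?b)" by (simp only: of_real_diff[symmetric] norm_of_real real_norm_def)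
    also have "\<dots> = cmod ((of_real ?a - ?a') + (?a' - ?b') - (of_real ?b - ?b'))" by simp
    also have "\<dots> \<le> cmod (of_real ?a - ?a') + cmod (?a' - ?b') + cmod (of_real ?b - ?b')"
      by (intro order_trans[OF norm_triangle_ineq4] add_right_mono norm_triangle_ineq)
    finally show "norm (?a - ?b) < r" using a b n0[OF n] r unfolding real_norm_def by linarith
  qed
qed

section \<open>Functionals on the Skorokhod space\<close>

abbreviation nfloor :: "nat \<Rightarrow> real \<Rightarrow> nat" where "nfloor k s \<equiv> nat \<lfloor>real k * s\<rfloor>"

definition step :: "nat \<Rightarrow> (nat \<times> nat \<Rightarrow> real) \<Rightarrow> real \<times> real \<Rightarrow> real" where
  "step k v = (\<lambda>(s, t). v (nfloor k s, nfloor k t))"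

definition grid :: "nat \<Rightarrow> (real \<times> real \<Rightarrow> real) \<Rightarrow> real \<times> real \<Rightarrow> real" where
  "grid k x = step k (\<lambda>(i, j). x (real i / real k, real j / real k))"

text \<open>From the right the floor keeps its value; strictly from the left it equals
  \<open>\<lceil>real k * s\<rceil> - 1\<close>, which is a different integer exactly at grid
  points. In two coordinates this gives right continuity and limits in all four quadrants.\<close>

lemma floor_locally_constant:
  fixes s :: real
  assumes "s \<ge> 0"
  shows "\<exists>d>0. \<exists>p. (a \<longrightarrow> p = nfloor k s) \<and>
    (\<forall>s'. \<bar>s' - s\<bar> < d \<longrightarrow> (if a then s' \<ge> s else s' < s) \<longrightarrow> nfloor k s' = p)"
proof (cases "k = 0")
  case True
  then show ?thesis by (intro exI[of _ 1]) auto
next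
  case False
  then have k: "real k > 0" by simp
  show ?thesis
  proof (cases a)
    case True
    define d where "d = (of_int \<lfloor>real k * s\<rfloor> + 1 - real k * s) / k"
    have "d > 0" using k by (auto simp: d_def)
    moreover have "\<lfloor>real k * s'\<rfloor> = \<lfloor>real k * s\<rfloor>" if "\<bar>s' - s\<bar> < d" "s' \<ge> s" for s'
    proof -
      have "s' < s + d" using that by linarith
      then have "real k * s' < real k * (s + d)" using k by simp
      also have "\<dots> = of_int \<lfloor>real k * s\<rfloor> + 1" using k by (simp add: d_def field_simps)
      finally have "real k * s' < of_int \<lfloor>real k * s\<rfloor> + 1" .
      moreover have "real k * s \<le> real k * s'" using that k by simp
      ultimately show ?thesis by linarith
    qed
    ultimately have "\<exists>d>0. \<exists>p. p = nfloor k s \<and> (\<forall>s'. \<bar>s' - s\<bar> < d \<longrightarrow> s' \<ge> s \<longrightarrow> nfloor k s' = p)"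
      by metis
    then show ?thesis using True by simp
  next
    case False
    define d where "d = (real k * s - (of_int \<lceil>real k * s\<rceil> - 1)) / k"
    have "of_int \<lceil>real k * s\<rceil> - 1 < real k * s" by linarith
    then have "d > 0" using k by (simp add: d_def)
    moreover have "\<lfloor>real k * s'\<rfloor> = \<lceil>real k * s\<rceil> - 1" if "\<bar>s' - s\<bar> < d" "s' < s" for s'
    proof -
      have "s - d < s'" using that by linarith
      then have "real k * (s - d) < real k * s'" using k by simp
      moreover have "real k * (s - d) = of_int \<lceil>real k * s\<rceil> - 1" using k by (simp add: d_def field_simps)
      moreover have "real k * s' < real k * s" using that k by simp
      ultimately show ?thesis by linarith
    qed
    ultimately have "\<exists>d>0. \<exists>p. \<forall>s'. \<bar>s' - s\<bar> < d \<longrightarrow> s' < s \<longrightarrow> nfloor k s' = p"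
      by metis
    then show ?thesis using False by simp
  qed
qed

lemma step_in_D2: "step k v \<in> D2"
proof -
  have "\<exists>l. (a \<and> b \<longrightarrow> l = step k v (s, t)) \<and> (step k v \<longlongrightarrow> l) (at (s, t) within quadrant a b (s, t))"
    if st: "(s, t) \<in> unit_sq" for s t a b
  proof -
    have "s \<ge> 0" "t \<ge> 0" using st by (auto simp: unit_sq_def)
    obtain d p where d: "d > 0" "a \<Longrightarrow> p = nfloor k s"
      "\<And>s'. \<bar>s' - s\<bar> < d \<Longrightarrow> (if a then s' \<ge> s else s' < s) \<Longrightarrow> nfloor k s' = p"
      using floor_locally_constant[OF \<open>s \<ge> 0\<close>, of a k] by blast
    obtain d' q where d': "d' > 0" "b \<Longrightarrow> q = nfloor k t"
      "\<And>t'. \<bar>t' - t\<bar> < d' \<Longrightarrow> (if b then t' \<ge> t else t' < t) \<Longrightarrow> nfloor k t' = q"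
      using floor_locally_constant[OF \<open>t \<ge> 0\<close>, of b k] by blast
    have "eventually (\<lambda>z. step k v z = v (p, q)) (at (s, t) within quadrant a b (s, t))"
      unfolding eventually_at
    proof (intro exI[of _ "min d d'"] conjI ballI impI)
      fix z assume z: "z \<in> quadrant a b (s, t)" "z \<noteq> (s, t) \<and> dist z (s, t) < min d d'"
      obtain s' t' where [simp]: "z = (s', t')" by (cases z)
      have "dist s' s < d" "dist t' t < d'"
        using z(2) dist_fst_le[of z "(s, t)"] dist_snd_le[of z "(s, t)"] by auto
      moreover have "if a then s' \<ge> s else s' < s" "if b then t' \<ge> t else t' < t"
        using z(1) by (auto simp: quadrant_def)
      ultimately show "step k v z = v (p, q)"
        using d(3)[of s'] d'(3)[of t'] by (simp add: step_def dist_real_def)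
    qed (use d d' in auto)
    then have "(step k v \<longlongrightarrow> v (p, q)) (at (s, t) within quadrant a b (s, t))"
      by (rule tendsto_eventually)
    then show ?thesis using d(2) d'(2) by (intro exI[of _ "v (p, q)"]) (auto simp: step_def)
  qed
  note * = this
  show ?thesis
    unfolding D2_def using *[of _ _ True True] * by auto blast
qed

lemma continuous_in_D2:
  assumes "continuous_on unit_sq x" shows "x \<in> D2"
proof -
  have "(x \<longlongrightarrow> x st) (at st within quadrant a b st)" if "st \<in> unit_sq" for a b st
    using assms that unfolding continuous_on_def
    by (rule_tac tendsto_within_subset[of _ _ _ unit_sq]) (auto simp: quadrant_def)
  then show ?thesis unfolding D2_def by blast
qed

text \<open>Continuity for the supremum distance follows from Skorokhod continuity because the
  identity is an admissible time change. From here on time changes play no part.\<close>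

definition sup_cont :: "((real \<times> real \<Rightarrow> real) \<Rightarrow> real) \<Rightarrow> real \<Rightarrow> bool" where
  "sup_cont f B \<longleftrightarrow> (\<forall>x\<in>D2. \<bar>f x\<bar> \<le> B) \<and>
     (\<forall>x\<in>D2. \<forall>e>0. \<exists>d>0. \<forall>y\<in>D2. (\<forall>z\<in>unit_sq. \<bar>x z - y z\<bar> \<le> d) \<longrightarrow> \<bar>f x - f y\<bar> < e)"

lemma sup_contD: "sup_cont f B \<Longrightarrow> x \<in> D2 \<Longrightarrow> \<bar>f x\<bar> \<le> B"
  and sup_cont_cont: "sup_cont f B \<Longrightarrow> x \<in> D2 \<Longrightarrow> e > 0 \<Longrightarrow> \<exists>d>0. \<forall>y\<in>D2. (\<forall>z\<in>unit_sq. \<bar>x z - y z\<bar> \<le> d) \<longrightarrow> \<bar>f x - f y\<bar> < e"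
  unfolding sup_cont_def by blast+

text \<open>Elements of \<open>D2\<close> are functions on the whole plane; the functional
  nevertheless sees only the unit square.\<close>

lemma sup_cont_cong:
  assumes "sup_cont f B" "x \<in> D2" "y \<in> D2" "\<And>z. z \<in> unit_sq \<Longrightarrow> x z = y z" shows "f x = f y"
proof (rule ccontr)
  assume "f x \<noteq> f y"
  then have "0 < \<bar>f x - f y\<bar>" by simp
  from sup_cont_cont[OF assms(1,2) this] obtain d where
    "d > 0" "\<forall>y'\<in>D2. (\<forall>z\<in>unit_sq. \<bar>x z - y' z\<bar> \<le> d) \<longrightarrow> \<bar>f x - f y'\<bar> < \<bar>f x - f y\<bar>" by blast
  then show False using assms by force
qed

lemma skorokhod_dist_le_sup:
  assumes "0 \<le> d" "\<And>z. z \<in> unit_sq \<Longrightarrow> \<bar>x z - y z\<bar> \<le> d"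
  shows "skorokhod_dist x y \<le> d"
  unfolding skorokhod_dist_def
proof (rule cInf_lower)
  have "id \<in> time_changes" by (auto simp: time_changes_def strict_mono_on_def)
  then show "d \<in> {e. \<exists>l1\<in>time_changes. \<exists>l2\<in>time_changes. e \<ge> 0 \<and>
      (\<forall>s\<in>{0..1}. \<bar>l1 s - s\<bar> \<le> e) \<and> (\<forall>t\<in>{0..1}. \<bar>l2 t - t\<bar> \<le> e) \<and>
      (\<forall>(s, t)\<in>unit_sq. \<bar>x (s, t) - y (l1 s, l2 t)\<bar> \<le> e)}"
    using assms by (auto intro!: bexI[of _ id])
qed (auto intro: bdd_belowI[of _ 0])

lemma bounded_skorokhod_continuous_sup_cont:
  assumes "bounded_skorokhod_continuous f" shows "\<exists>B. sup_cont f B"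
proof -
  obtain B where B: "\<forall>x\<in>D2. \<bar>f x\<bar> \<le> B" using assms by (auto simp: bounded_skorokhod_continuous_def)
  have "\<exists>d>0. \<forall>y\<in>D2. (\<forall>z\<in>unit_sq. \<bar>x z - y z\<bar> \<le> d) \<longrightarrow> \<bar>f x - f y\<bar> < e" if xe: "x \<in> D2" "e > 0" for x e
  proof -
    obtain d where d: "d > 0" "\<forall>y\<in>D2. skorokhod_dist x y < d \<longrightarrow> \<bar>f x - f y\<bar> < e"
      using assms xe unfolding bounded_skorokhod_continuous_def by blast
    have "\<bar>f x - f y\<bar> < e" if "y \<in> D2" "\<forall>z\<in>unit_sq. \<bar>x z - y z\<bar> \<le> d / 2" for y
      using skorokhod_dist_le_sup[of "d / 2" x y] that d by auto
    then show ?thesis using d(1) by (intro exI[of _ "d / 2"]) auto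
  qed
  then show ?thesis using B by (auto simp: sup_cont_def)
qed

lemma sup_cont_minus: "sup_cont f B \<Longrightarrow> sup_cont (\<lambda>x. - f x) B"
  by (simp add: sup_cont_def abs_minus_commute)

text \<open>The Pasch--Hausdorff envelope: the largest \<open>k\<close>-Lipschitz minorant for the supremum distance.\<close>

definition candidates :: "((real \<times> real \<Rightarrow> real) \<Rightarrow> real) \<Rightarrow> nat \<Rightarrow> (real \<times> real \<Rightarrow> real) \<Rightarrow> real set" where
  "candidates f k x = {f y + real k * r | y r. y \<in> D2 \<and> r \<ge> 0 \<and> (\<forall>z\<in>unit_sq. \<bar>x z - y z\<bar> \<le> r)}"

definition envelope :: "((real \<times> real \<Rightarrow> real) \<Rightarrow> real) \<Rightarrow> nat \<Rightarrow> (real \<times> real \<Rightarrow> real) \<Rightarrow> real" where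
  "envelope f k x = Inf (candidates f k x)"

context
  fixes f B assumes f: "sup_cont f B"
begin

lemma envelope_bdd: "bdd_below (candidates f k x)"
proof (rule bdd_belowI[of _ "- B"])
  fix v assume "v \<in> candidates f k x"
  then obtain y r where "v = f y + real k * r" "y \<in> D2" "r \<ge> 0" unfolding candidates_def by blast
  moreover have "real k * r \<ge> 0" using \<open>r \<ge> 0\<close> by simp
  ultimately show "- B \<le> v" using sup_contD[OF f, of y] by linarith
qed

lemma envelope_lower: "y \<in> D2 \<Longrightarrow> r \<ge> 0 \<Longrightarrow> (\<And>z. z \<in> unit_sq \<Longrightarrow> \<bar>x z - y z\<bar> \<le> r) \<Longrightarrow> envelope f k x \<le> f y + real k * r"
  unfolding envelope_def by (rule cInf_lower[OF _ envelope_bdd]) (unfold candidates_def, blast)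

lemma envelope_le: "x \<in> D2 \<Longrightarrow> envelope f k x \<le> f x"
  using envelope_lower[of x 0 x k] by simp

lemma envelope_greatest:
  assumes "x \<in> D2" "\<And>y r. y \<in> D2 \<Longrightarrow> r \<ge> 0 \<Longrightarrow> (\<And>z. z \<in> unit_sq \<Longrightarrow> \<bar>x z - y z\<bar> \<le> r) \<Longrightarrow> c \<le> f y + real k * r"
  shows "c \<le> envelope f k x"
  unfolding envelope_def
proof (rule cInf_greatest)
  show "(candidates f k x) \<noteq> {}"
    using assms(1) by (auto simp: candidates_def intro!: exI[of _ x] exI[of _ 0])
qed (use assms(2) in \<open>unfold candidates_def, blast\<close>)

lemma envelope_abs: assumes "x \<in> D2" shows "\<bar>envelope f k x\<bar> \<le> B"
proof -
  have "- B \<le> envelope f k x"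
  proof (rule envelope_greatest[OF assms])
    fix y r assume "y \<in> D2" "0 \<le> (r::real)"
    moreover have "real k * r \<ge> 0" using \<open>r \<ge> 0\<close> by simp
    ultimately show "- B \<le> f y + real k * r" using sup_contD[OF f, of y] by linarith
  qed
  then show ?thesis using envelope_le[OF assms, of k] sup_contD[OF f assms] by linarith
qed

text \<open>A competitor for \<open>x'\<close> at radius \<open>r'\<close> is a competitor for
  \<open>x\<close> at radius \<open>r + r'\<close>.\<close>

lemma envelope_lipschitz:
  assumes "x \<in> D2" "x' \<in> D2" "0 \<le> r" "\<And>z. z \<in> unit_sq \<Longrightarrow> \<bar>x z - x' z\<bar> \<le> r"
  shows "\<bar>envelope f k x - envelope f k x'\<bar> \<le> real k * r"
proof -
  have "envelope f k x - real k * r \<le> envelope f k x'" if "x \<in> D2" "x' \<in> D2" "\<And>z. z \<in> unit_sq \<Longrightarrow> \<bar>x z - x' z\<bar> \<le> r" for x x'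
  proof (rule envelope_greatest[OF that(2)])
    fix y r' assume y: "y \<in> D2" "0 \<le> r'" "\<And>z. z \<in> unit_sq \<Longrightarrow> \<bar>x' z - y z\<bar> \<le> r'"
    have "envelope f k x \<le> f y + real k * (r + r')"
    proof (rule envelope_lower)
      show "\<bar>x z - y z\<bar> \<le> r + r'" if "z \<in> unit_sq" for z
        using that(1) y(3)[OF that] \<open>\<And>z. z \<in> unit_sq \<Longrightarrow> \<bar>x z - x' z\<bar> \<le> r\<close>[OF that] by linarith
    qed (use y assms in auto)
    then show "envelope f k x - real k * r \<le> f y + real k * r'" by (simp add: algebra_simps)
  qed
  from this[of x x'] this[of x' x] show ?thesis using assms by (simp add: abs_le_iff abs_minus_commute)
qed

lemma envelope_sup_cont: "sup_cont (envelope f k) B"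
  unfolding sup_cont_def
proof (intro conjI ballI allI impI)
  fix x e assume x: "x \<in> D2" and e: "(e::real) > 0"
  have "\<bar>envelope f k x - envelope f k y\<bar> < e" if "y \<in> D2" "\<forall>z\<in>unit_sq. \<bar>x z - y z\<bar> \<le> e / (real k + 1)" for y
  proof -
    have "\<bar>envelope f k x - envelope f k y\<bar> \<le> real k * (e / (real k + 1))"
      using that e by (intro envelope_lipschitz x) auto
    also have "\<dots> < e" using e by (simp add: field_simps)
    finally show ?thesis .
  qed
  then show "\<exists>d>0. \<forall>y\<in>D2. (\<forall>z\<in>unit_sq. \<bar>x z - y z\<bar> \<le> d) \<longrightarrow> \<bar>envelope f k x - envelope f k y\<bar> < e"
    using e by (intro exI[of _ "e / (real k + 1)"]) auto
qed (rule envelope_abs)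

text \<open>Competitors within \<open>d\<close> of \<open>x\<close> are handled by continuity at
  \<open>x\<close>. Those farther away pay a penalty of at least \<open>k * d\<close>, which for
  large \<open>k\<close> outweighs the total oscillation \<open>2 * B\<close>.\<close>

lemma envelope_tendsto:
  assumes x: "x \<in> D2" shows "(\<lambda>k. envelope f k x) \<longlonglongrightarrow> f x"
proof (rule LIMSEQ_I)
  fix e :: real assume e: "e > 0"
  obtain d where d: "d > 0" "\<forall>y\<in>D2. (\<forall>z\<in>unit_sq. \<bar>x z - y z\<bar> \<le> d) \<longrightarrow> \<bar>f x - f y\<bar> < e / 2"
    using sup_cont_cont[OF f x, of "e / 2"] e by auto
  show "\<exists>K. \<forall>k\<ge>K. norm (envelope f k x - f x) < e"
  proof (intro exI allI impI)
    fix k assume "k \<ge> nat \<lceil>2 * B / d\<rceil>"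
    then have "2 * B / d \<le> real k" by linarith
    then have k: "2 * B \<le> real k * d" using d by (simp add: field_simps)
    have "f x - e / 2 \<le> envelope f k x"
    proof (rule envelope_greatest[OF x])
      fix y r assume y: "y \<in> D2" "0 \<le> (r::real)" "\<And>z. z \<in> unit_sq \<Longrightarrow> \<bar>x z - y z\<bar> \<le> r"
      show "f x - e / 2 \<le> f y + real k * r"
      proof (cases "r \<le> d")
        case True
        then have "\<bar>f x - f y\<bar> < e / 2" using d y by force
        moreover have "real k * r \<ge> 0" using y by simp
        ultimately show ?thesis by linarith
      next
        case False
        then have "real k * d \<le> real k * r" by (intro mult_left_mono) auto
        then show ?thesis using k sup_contD[OF f x] sup_contD[OF f y(1)] e by linarith
      qed
    qed
    then show "norm (envelope f k x - f x) < e" using envelope_le[OF x, of k] e by (simp add: abs_less_iff)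
  qed
qed

end

section \<open>Grid approximation and measurability of functionals\<close>

lemma nat_floor_le:
  assumes "0 \<le> s" "s \<le> 1" shows "nfloor k s \<le> k" "0 \<le> real (nfloor k s) / real k" "real (nfloor k s) / real k \<le> 1"
proof -
  have "real k * s \<le> real k * 1" using assms by (intro mult_left_mono) auto
  then have "\<lfloor>real k * s\<rfloor> \<le> int k" by (simp add: floor_le_iff)
  then show "nfloor k s \<le> k" by simp
  then show "real (nfloor k s) / real k \<le> 1" by (cases "k = 0") auto
qed auto

lemma grid_unif:
  assumes "continuous_on unit_sq x" "e > 0"
  shows "\<exists>K. \<forall>k\<ge>K. \<forall>z\<in>unit_sq. \<bar>x z - grid k x z\<bar> \<le> e"
proof -
  have "compact unit_sq" unfolding unit_sq_def by (intro compact_Times compact_Icc)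
  then have "uniformly_continuous_on unit_sq x" using assms compact_uniformly_continuous by blast
  then obtain d where d: "d > 0" "\<And>z z'. z \<in> unit_sq \<Longrightarrow> z' \<in> unit_sq \<Longrightarrow> dist z' z < d \<Longrightarrow> dist (x z') (x z) < e"
    using assms(2) unfolding uniformly_continuous_on_def by metis
  have "\<bar>x z - grid k x z\<bar> \<le> e" if k: "k \<ge> nat \<lceil>2 / d\<rceil> + 1" and z: "z \<in> unit_sq" for k z
  proof -
    obtain s t where [simp]: "z = (s, t)" by (cases z)
    have st: "0 \<le> s" "s \<le> 1" "0 \<le> t" "t \<le> 1" using z by (auto simp: unit_sq_def)
    have k0: "real k > 0" using k by simp
    have "2 / d < real k" using k by linarith
    then have kd: "1 / real k < d / 2" using d(1) k0 by (simp add: field_simps)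
    have near: "\<bar>real (nfloor k s) / real k - s\<bar> \<le> 1 / real k" if "0 \<le> s" for s
    proof -
      have "0 \<le> real k * s" using that by simp
      then have "\<bar>real (nfloor k s) - real k * s\<bar> \<le> 1" by linarith
      then have "\<bar>real (nfloor k s) - real k * s\<bar> / real k \<le> 1 / real k" using k0 by (intro divide_right_mono) auto
      moreover have "\<bar>real (nfloor k s) - real k * s\<bar> / real k = \<bar>real (nfloor k s) / real k - s\<bar>"
      proof -
        have "\<bar>real (nfloor k s) - real k * s\<bar> / real k = \<bar>(real (nfloor k s) - real k * s) / real k\<bar>"
          by simp
        then show ?thesis using k0 by (simp add: diff_divide_distrib)
      qed
      ultimately show ?thesis by simp
    qed
    let ?z = "(real (nfloor k s) / real k, real (nfloor k t) / real k)"
    have "?z \<in> unit_sq" using nat_floor_le st by (auto simp: unit_sq_def)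
    moreover have "dist ?z z < d"
    proof -
      have "dist ?z z \<le> \<bar>real (nfloor k s) / real k - s\<bar> + \<bar>real (nfloor k t) / real k - t\<bar>"
        unfolding dist_prod_def by (simp add: dist_real_def sqrt_sum_squares_le_sum_abs)
      also have "\<dots> \<le> 1 / real k + 1 / real k" using near st by (intro add_mono) auto
      also have "\<dots> < d" using kd by simp
      finally show ?thesis .
    qed
    ultimately have "dist (x ?z) (x z) < e" using d(2) z by blast
    then show ?thesis by (simp add: grid_def step_def dist_real_def abs_minus_commute)
  qed
  then show ?thesis by blast
qed

text \<open>On the square, \<open>step k v\<close> reads only the coordinates of \<open>v\<close> up
  to \<open>k\<close>. These are finitely many, so closeness in the product topology becomes uniform
  closeness. This is the source of all measurability of functionals below.\<close>

lemma continuous_on_step: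
  assumes f: "sup_cont f B" shows "continuous_on UNIV (\<lambda>v. f (step k v))"
  unfolding continuous_on_def
proof (intro ballI tendstoI)
  fix v :: "nat \<times> nat \<Rightarrow> real" and e :: real assume e: "e > 0"
  obtain d where d: "d > 0" "\<forall>y\<in>D2. (\<forall>z\<in>unit_sq. \<bar>step k v z - y z\<bar> \<le> d) \<longrightarrow> \<bar>f (step k v) - f y\<bar> < e"
    using sup_cont_cont[OF f step_in_D2 e] by blast
  have "eventually (\<lambda>v'. \<forall>i\<in>{..k} \<times> {..k}. dist (v' i) (v i) < d) (at v)"
  proof (rule eventually_ball_finite)
    show "\<forall>i\<in>{..k} \<times> {..k}. eventually (\<lambda>v'. dist (v' i) (v i) < d) (at v)"
    proof
      fix i :: "nat \<times> nat"
      have "continuous_on UNIV (\<lambda>v' :: nat \<times> nat \<Rightarrow> real. v' i)" by (rule continuous_on_product_coordinates)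
      then have "((\<lambda>v'. v' i) \<longlongrightarrow> v i) (at v)" by (simp add: continuous_on_def)
      then show "eventually (\<lambda>v'. dist (v' i) (v i) < d) (at v)" using d(1) by (rule tendstoD)
    qed
  qed auto
  then show "eventually (\<lambda>v'. dist (f (step k v')) (f (step k v)) < e) (at v)"
  proof eventually_elim
    case (elim v')
    have "\<bar>step k v z - step k v' z\<bar> \<le> d" if "z \<in> unit_sq" for z
    proof -
      obtain s t where [simp]: "z = (s, t)" by (cases z)
      have "(nfloor k s, nfloor k t) \<in> {..k} \<times> {..k}"
        using that nat_floor_le(1) by (auto simp: unit_sq_def)
      then show ?thesis using elim by (force simp: step_def dist_real_def abs_minus_commute)
    qed
    then show ?case using d(2) step_in_D2[of k v'] by (simp add: dist_real_def abs_minus_commute)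
  qed
qed

lemma measurable_step:
  assumes f: "sup_cont f B" and V: "\<And>i. (\<lambda>u. V u i) \<in> borel_measurable N"
  shows "(\<lambda>u. f (step k (V u))) \<in> borel_measurable N"
  using measurable_compose[OF measurable_coordinatewise_then_product[OF V] borel_measurable_continuous_onI[OF continuous_on_step[OF f]]] .

lemma sup_cont_grid_tendsto:
  assumes f: "sup_cont f B" and x: "continuous_on unit_sq x"
  shows "(\<lambda>k. f (grid k x)) \<longlonglongrightarrow> f x"
proof (rule LIMSEQ_I)
  fix e :: real assume e: "e > 0"
  obtain d where d: "d > 0" "\<forall>y\<in>D2. (\<forall>z\<in>unit_sq. \<bar>x z - y z\<bar> \<le> d) \<longrightarrow> \<bar>f x - f y\<bar> < e"
    using sup_cont_cont[OF f continuous_in_D2[OF x] e] by blast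
  then show "\<exists>K. \<forall>k\<ge>K. norm (f (grid k x) - f x) < e"
    using grid_unif[OF x d(1)] step_in_D2 unfolding grid_def real_norm_def abs_minus_commute[of _ "f x"] by blast
qed

text \<open>Outside the unit square the process is unconstrained, so measurability is only available for the
  grid points \<open>i, j \<le> k\<close>; the others are redirected to the origin.\<close>

lemma grid_eq_step_cut:
  assumes "z \<in> unit_sq"
  shows "grid k x z = step k (\<lambda>(i, j). if i \<le> k \<and> j \<le> k then x (real i / real k, real j / real k) else x (0, 0)) z"
  using assms nat_floor_le(1) by (auto simp: grid_def step_def unit_sq_def)

lemma grid_point_in_unit_sq: "i \<le> k \<Longrightarrow> j \<le> k \<Longrightarrow> (real i / real k, real j / real k) \<in> unit_sq"
  by (auto simp: unit_sq_def divide_simps)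

lemma measurable_grid:
  assumes f: "sup_cont f B" and Y: "\<And>z. z \<in> unit_sq \<Longrightarrow> (\<lambda>w. Y w z) \<in> borel_measurable P"
  shows "(\<lambda>w. f (grid k (Y w))) \<in> borel_measurable P"
proof -
  let ?V = "\<lambda>w (i, j). if i \<le> k \<and> j \<le> k then Y w (real i / real k, real j / real k) else Y w (0, 0)"
  have "f (grid k (Y w)) = f (step k (?V w))" for w
    using grid_eq_step_cut by (intro sup_cont_cong[OF f]) (auto simp: grid_def step_in_D2)
  moreover have "(\<lambda>w. f (step k (?V w))) \<in> borel_measurable P"
  proof (rule measurable_step[OF f])
    fix i :: "nat \<times> nat"
    have "(0, 0) \<in> unit_sq" by (simp add: unit_sq_def)
    then show "(\<lambda>w. ?V w i) \<in> borel_measurable P"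
      using Y grid_point_in_unit_sq[of "fst i" k "snd i"]
      by (cases i; cases "fst i \<le> k \<and> snd i \<le> k") auto
  qed
  ultimately show ?thesis by simp
qed

text \<open>Continuity for the supremum distance alone does not give measurability. For continuous
  paths the functional is the pointwise limit of its values on grid versions, which are
  measurable.\<close>

lemma measurable_sup_cont:
  assumes f: "sup_cont f B" and Y: "\<And>z. z \<in> unit_sq \<Longrightarrow> (\<lambda>w. Y w z) \<in> borel_measurable P"
    and c: "\<And>w. w \<in> space P \<Longrightarrow> continuous_on unit_sq (Y w)"
  shows "(\<lambda>w. f (Y w)) \<in> borel_measurable P"
  by (rule borel_measurable_LIMSEQ_real[OF sup_cont_grid_tendsto[OF f c] measurable_grid[OF f Y]])

section \<open>From finite grids to convergence in distribution\<close>

definition cut :: "nat \<Rightarrow> (real \<times> real \<Rightarrow> real) \<Rightarrow> nat \<times> nat \<Rightarrow> real" where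
  "cut k x = (\<lambda>(i, j). if i \<le> k \<and> j \<le> k then x (real i / real k, real j / real k) else x (0, 0))"

lemma sup_cont_grid_cut:
  assumes "sup_cont f B" shows "f (grid k x) = f (step k (cut k x))"
  using grid_eq_step_cut unfolding cut_def by (intro sup_cont_cong[OF assms]) (auto simp: grid_def step_in_D2)

lemma cut_in:
  "\<exists>z\<in>unit_sq. \<forall>x. cut k x i = x z"
proof (cases "fst i \<le> k \<and> snd i \<le> k")
  case True
  then show ?thesis using grid_point_in_unit_sq[of "fst i" k "snd i"] by (cases i) (auto simp: cut_def)
next
  case False
  then show ?thesis by (intro bexI[of _ "(0, 0)"]) (cases i; auto simp: cut_def unit_sq_def)+
qed

text \<open>The integrable majorant \<open>S\<close> stands in for the supremum over the square, so
  that no measurability of a supremum has to be established.\<close>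

definition grid_close :: "'a measure \<Rightarrow> ('a \<Rightarrow> real \<times> real \<Rightarrow> real) \<Rightarrow> nat \<Rightarrow> real \<Rightarrow> bool" where
  "grid_close N X k \<epsilon> \<longleftrightarrow> (\<exists>S. integrable N S \<and> (\<integral>u. S u \<partial>N) \<le> \<epsilon> \<and>
     (\<forall>u. \<forall>z\<in>unit_sq. \<bar>X u z - grid k (X u) z\<bar> \<le> S u))"

lemma grid_close_mono: "grid_close N X k \<epsilon> \<Longrightarrow> \<epsilon> \<le> \<epsilon>' \<Longrightarrow> grid_close N X k \<epsilon>'"
  unfolding grid_close_def using order_trans by blast

text \<open>The probabilistic criterion, free of matrices: convergence of joint characteristic
  functions, uniform second moments, and approximation by grid versions in mean, uniformly for large
  \<open>n\<close>. The family \<open>V\<close> records that the processes are step functions of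
  measurable coordinates.\<close>

locale D2_convergence =
  fixes M :: "nat \<Rightarrow> 'a measure" and P :: "'b measure"
    and V :: "nat \<Rightarrow> 'a \<Rightarrow> nat \<times> nat \<Rightarrow> real" and X :: "nat \<Rightarrow> 'a \<Rightarrow> real \<times> real \<Rightarrow> real"
    and Y :: "'b \<Rightarrow> real \<times> real \<Rightarrow> real" and C :: real
  assumes M: "\<And>n. prob_space (M n)" and P: "prob_space P"
    and X: "\<And>n u. X n u = step n (V n u)"
    and V: "\<And>n i. (\<lambda>u. V n u i) \<in> borel_measurable (M n)"
    and Y: "\<And>z. z \<in> unit_sq \<Longrightarrow> (\<lambda>w. Y w z) \<in> borel_measurable P"
    and cont: "\<And>w. w \<in> space P \<Longrightarrow> continuous_on unit_sq (Y w)"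
    and char: "\<And>(K :: (nat \<times> nat) set) z c. finite K \<Longrightarrow> (\<And>i. z i \<in> unit_sq) \<Longrightarrow>
       (\<lambda>n. \<integral>u. exp (\<i> * of_real (\<Sum>j\<in>K. c j * X n u (z j))) \<partial>M n) \<longlonglongrightarrow>
       (\<integral>w. exp (\<i> * of_real (\<Sum>j\<in>K. c j * Y w (z j))) \<partial>P)"
    and X2: "\<And>n z. z \<in> unit_sq \<Longrightarrow> integrable (M n) (\<lambda>u. (X n u z)\<^sup>2) \<and> (\<integral>u. (X n u z)\<^sup>2 \<partial>M n) \<le> C"
    and Y2: "\<And>z. z \<in> unit_sq \<Longrightarrow> integrable P (\<lambda>w. (Y w z)\<^sup>2) \<and> (\<integral>w. (Y w z)\<^sup>2 \<partial>P) \<le> C"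
    and tight: "\<And>\<epsilon>. \<epsilon> > 0 \<Longrightarrow> \<exists>K. \<forall>k\<ge>K. eventually (\<lambda>n. grid_close (M n) (X n) k \<epsilon>) sequentially"
begin

lemma X_in_D2: "X n u \<in> D2" by (simp add: X step_in_D2)

lemma integrable_X: "sup_cont f B \<Longrightarrow> integrable (M n) (\<lambda>u. f (X n u))"
proof -
  assume f: "sup_cont f B"
  interpret prob_space "M n" by (rule M)
  have "(\<lambda>u. f (X n u)) \<in> borel_measurable (M n)"
    unfolding X by (rule measurable_step[OF f V])
  then show ?thesis
    by (intro integrable_const_bound[of _ B]) (use sup_contD[OF f X_in_D2] in auto)
qed

lemma measurable_X: "(\<lambda>u. X n u z) \<in> borel_measurable (M n)"
  unfolding X step_def by (cases z) (simp add: V)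

lemma integrable_X_grid: "sup_cont f B \<Longrightarrow> integrable (M n) (\<lambda>u. f (grid k (X n u)))"
proof -
  assume f: "sup_cont f B"
  interpret prob_space "M n" by (rule M)
  have "(\<lambda>u. f (grid k (X n u))) \<in> borel_measurable (M n)"
    by (rule measurable_grid[OF f measurable_X])
  then show ?thesis
    by (intro integrable_const_bound[of _ B]) (use sup_contD[OF f step_in_D2] in \<open>auto simp: grid_def\<close>)
qed

lemma grid_convergence:
  assumes f: "sup_cont f B"
  shows "(\<lambda>n. \<integral>u. f (grid k (X n u)) \<partial>M n) \<longlonglongrightarrow> (\<integral>w. f (grid k (Y w)) \<partial>P)"
  unfolding sup_cont_grid_cut[OF f]
proof (rule cramer_wold[where I = "{..k} \<times> {..k}" and h = "\<lambda>v. f (step k v)" and C = C and B = B])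
  obtain z where z: "\<And>i. z i \<in> unit_sq" "\<And>i x. cut k x i = x (z i)" using cut_in[of k] by metis
  show "(\<lambda>u. cut k (X n u) i) \<in> borel_measurable (M n)" for n i
    unfolding z(2) by (rule measurable_X)
  show "(\<lambda>u. cut k (Y u) i) \<in> borel_measurable P" for i
    unfolding z(2) by (rule Y[OF z(1)])
  show "(\<lambda>n. \<integral>u. exp (\<i> * of_real (\<Sum>j\<in>{..k} \<times> {..k}. c j * cut k (X n u) j)) \<partial>M n) \<longlonglongrightarrow>
       (\<integral>u. exp (\<i> * of_real (\<Sum>j\<in>{..k} \<times> {..k}. c j * cut k (Y u) j)) \<partial>P)" for c
    unfolding z(2) by (rule char) (use z in auto)
  show "integrable (M n) (\<lambda>u. (cut k (X n u) i)\<^sup>2) \<and> (\<integral>u. (cut k (X n u) i)\<^sup>2 \<partial>M n) \<le> C" for n i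
    unfolding z(2) by (rule X2[OF z(1)])
  show "integrable P (\<lambda>u. (cut k (Y u) i)\<^sup>2) \<and> (\<integral>u. (cut k (Y u) i)\<^sup>2 \<partial>P) \<le> C" for i
    unfolding z(2) by (rule Y2[OF z(1)])
  show "continuous_on UNIV (\<lambda>v. f (step k v))" by (rule continuous_on_step[OF f])
  show "\<bar>f (step k v)\<bar> \<le> B" for v by (rule sup_contD[OF f step_in_D2])
  show "f (step k x) = f (step k y)" if xy: "\<And>i. i \<in> {..k} \<times> {..k} \<Longrightarrow> x i = y i" for x y
    using xy nat_floor_le(1) by (intro sup_cont_cong[OF f step_in_D2 step_in_D2]) (auto simp: step_def unit_sq_def)
qed (use M P in auto)

text \<open>The process is compared with its grid version at a cost of \<open>L\<close> times the
  mean of the majorant, the grid versions converge in finite dimensions, and the limit is close to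
  its grid version by continuity of paths. The Lipschitz property is what lets a bound in mean
  suffice, without restriction to compact sets.\<close>

lemma lipschitz_convergence:
  assumes f: "sup_cont f B" and L: "L \<ge> 0"
    and lip: "\<And>x y r. x \<in> D2 \<Longrightarrow> y \<in> D2 \<Longrightarrow> 0 \<le> r \<Longrightarrow> (\<And>z. z \<in> unit_sq \<Longrightarrow> \<bar>x z - y z\<bar> \<le> r) \<Longrightarrow> \<bar>f x - f y\<bar> \<le> L * r"
  shows "(\<lambda>n. \<integral>u. f (X n u) \<partial>M n) \<longlonglongrightarrow> (\<integral>w. f (Y w) \<partial>P)"
proof (rule LIMSEQ_I)
  fix e :: real assume e: "e > 0"
  have "(\<lambda>k. \<integral>w. f (grid k (Y w)) \<partial>P) \<longlonglongrightarrow> (\<integral>w. f (Y w) \<partial>P)"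
  proof (rule integral_dominated_convergence[where w = "\<lambda>_. B"])
    interpret prob_space P by (rule P)
    show "integrable P (\<lambda>_. B)" by simp
    show "(\<lambda>w. f (Y w)) \<in> borel_measurable P" by (rule measurable_sup_cont[OF f Y cont])
    show "(\<lambda>w. f (grid k (Y w))) \<in> borel_measurable P" for k by (rule measurable_grid[OF f Y])
    show "AE w in P. (\<lambda>k. f (grid k (Y w))) \<longlonglongrightarrow> f (Y w)"
      using sup_cont_grid_tendsto[OF f cont] by auto
    show "AE w in P. norm (f (grid k (Y w))) \<le> B" for k
      using sup_contD[OF f step_in_D2] by (simp add: grid_def)
  qed
  from LIMSEQ_D[OF this, of "e / 4"] e obtain K1 where
    K1: "\<And>k. k \<ge> K1 \<Longrightarrow> \<bar>(\<integral>w. f (grid k (Y w)) \<partial>P) - (\<integral>w. f (Y w) \<partial>P)\<bar> < e / 4" by auto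
  \<comment> \<open>Using \<open>L + 1\<close> instead of \<open>L\<close> keeps the quotient
    meaningful when \<open>L = 0\<close>.\<close>
  define \<epsilon> where "\<epsilon> = e / (4 * (L + 1))"
  have \<epsilon>: "\<epsilon> > 0" "L * \<epsilon> \<le> e / 4"
    using e L by (auto simp: \<epsilon>_def field_simps)
  obtain K2 where K2: "\<And>k. k \<ge> K2 \<Longrightarrow> eventually (\<lambda>n. grid_close (M n) (X n) k \<epsilon>) sequentially"
    using tight[OF \<epsilon>(1)] by blast
  define k where "k = max K1 K2"
  from grid_convergence[OF f, of k] have "eventually (\<lambda>n. \<bar>(\<integral>u. f (grid k (X n u)) \<partial>M n) - (\<integral>w. f (grid k (Y w)) \<partial>P)\<bar> < e / 4) sequentially"
    using e by (auto dest!: tendstoD[of _ _ _ "e / 4"] simp: dist_real_def)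
  moreover have "eventually (\<lambda>n. grid_close (M n) (X n) k \<epsilon>) sequentially" by (rule K2) (simp add: k_def)
  ultimately have "eventually (\<lambda>n. norm ((\<integral>u. f (X n u) \<partial>M n) - (\<integral>w. f (Y w) \<partial>P)) < e) sequentially"
  proof eventually_elim
    case (elim n)
    then obtain S where S: "integrable (M n) S" "(\<integral>u. S u \<partial>M n) \<le> \<epsilon>" "\<And>u z. z \<in> unit_sq \<Longrightarrow> \<bar>X n u z - grid k (X n u) z\<bar> \<le> S u"
      unfolding grid_close_def by blast
    have "\<bar>f (X n u) - f (grid k (X n u))\<bar> \<le> L * S u" for u
    proof (rule lip)
      have "(0, 0) \<in> unit_sq" by (simp add: unit_sq_def)
      then show "0 \<le> S u" using S(3)[of "(0, 0)" u] by linarith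
    qed (use S X_in_D2 step_in_D2 in \<open>auto simp: grid_def\<close>)
    then have "\<bar>\<integral>u. f (X n u) - f (grid k (X n u)) \<partial>M n\<bar> \<le> (\<integral>u. L * S u \<partial>M n)"
      using integrable_X[OF f] integrable_X_grid[OF f] S(1)
      by (intro order_trans[OF integral_abs_bound] integral_mono) auto
    also have "\<dots> \<le> L * \<epsilon>" using S(1,2) L by (simp add: mult_left_mono)
    finally have "\<bar>(\<integral>u. f (X n u) \<partial>M n) - (\<integral>u. f (grid k (X n u)) \<partial>M n)\<bar> \<le> e / 4"
      using integrable_X[OF f] integrable_X_grid[OF f] \<epsilon>(2) by simp
    moreover have "\<bar>(\<integral>w. f (grid k (Y w)) \<partial>P) - (\<integral>w. f (Y w) \<partial>P)\<bar> < e / 4" by (rule K1) (simp add: k_def)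
    ultimately show ?case using elim(1) e unfolding real_norm_def by linarith
  qed
  then show "\<exists>n0. \<forall>n\<ge>n0. norm ((\<integral>u. f (X n u) \<partial>M n) - (\<integral>w. f (Y w) \<partial>P)) < e"
    by (simp add: eventually_sequentially)
qed

lemma envelope_convergence:
  assumes f: "sup_cont f B" shows "(\<lambda>k. \<integral>w. envelope f k (Y w) \<partial>P) \<longlonglongrightarrow> (\<integral>w. f (Y w) \<partial>P)"
proof (rule integral_dominated_convergence[where w = "\<lambda>_. B"])
  interpret prob_space P by (rule P)
  show "integrable P (\<lambda>_. B)" by simp
  show "(\<lambda>w. f (Y w)) \<in> borel_measurable P" by (rule measurable_sup_cont[OF f Y cont])
  show "(\<lambda>w. envelope f k (Y w)) \<in> borel_measurable P" for k
    by (rule measurable_sup_cont[OF envelope_sup_cont[OF f] Y cont])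
  show "AE w in P. (\<lambda>k. envelope f k (Y w)) \<longlonglongrightarrow> f (Y w)"
    using envelope_tendsto[OF f continuous_in_D2[OF cont]] by auto
  show "AE w in P. norm (envelope f k (Y w)) \<le> B" for k
    using envelope_abs[OF f continuous_in_D2[OF cont]] by auto
qed

text \<open>The envelope lies below \<open>f\<close>, so convergence for a close enough envelope
  bounds the means of \<open>f\<close> from below. The upper bound is the same statement for
  \<open>- f\<close>.\<close>

lemma liminf_bound:
  assumes f: "sup_cont f B" and e: "e > 0"
  shows "eventually (\<lambda>n. (\<integral>u. f (X n u) \<partial>M n) > (\<integral>w. f (Y w) \<partial>P) - e) sequentially"
proof -
  from LIMSEQ_D[OF envelope_convergence[OF f], of "e / 2"] e obtain k where
    k: "\<bar>(\<integral>w. envelope f k (Y w) \<partial>P) - (\<integral>w. f (Y w) \<partial>P)\<bar> < e / 2" by auto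
  have "(\<lambda>n. \<integral>u. envelope f k (X n u) \<partial>M n) \<longlonglongrightarrow> (\<integral>w. envelope f k (Y w) \<partial>P)"
    by (rule lipschitz_convergence[OF envelope_sup_cont[OF f], of "real k"]) (use envelope_lipschitz[OF f] in auto)
  then have "eventually (\<lambda>n. \<bar>(\<integral>u. envelope f k (X n u) \<partial>M n) - (\<integral>w. envelope f k (Y w) \<partial>P)\<bar> < e / 2) sequentially"
    using e by (auto dest!: tendstoD[of _ _ _ "e / 2"] simp: dist_real_def)
  then show ?thesis
  proof eventually_elim
    case (elim n)
    have "(\<integral>u. envelope f k (X n u) \<partial>M n) \<le> (\<integral>u. f (X n u) \<partial>M n)"
      by (intro integral_mono integrable_X[OF f] integrable_X[OF envelope_sup_cont[OF f]] envelope_le[OF f] X_in_D2)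
    then show ?case using elim k by linarith
  qed
qed

theorem conv_distr: "conv_distr_D2 M X P Y"
  unfolding conv_distr_D2_def
proof (intro allI impI)
  fix f assume "bounded_skorokhod_continuous f"
  then obtain B where f: "sup_cont f B" using bounded_skorokhod_continuous_sup_cont by blast
  show "(\<lambda>n. \<integral>u. f (X n u) \<partial>M n) \<longlonglongrightarrow> (\<integral>w. f (Y w) \<partial>P)"
  proof (rule tendstoI)
    fix e :: real assume e: "e > 0"
    show "eventually (\<lambda>n. dist (\<integral>u. f (X n u) \<partial>M n) (\<integral>w. f (Y w) \<partial>P) < e) sequentially"
      using liminf_bound[OF f e] liminf_bound[OF sup_cont_minus[OF f] e]
      by eventually_elim (auto simp: dist_real_def)
  qed
qed

end

section \<open>The limit theorem\<close>

lemma (in prob_space) gaussian_square_integrable: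
  assumes X: "gaussian_rv M X" shows "integrable M (\<lambda>w. (X w)\<^sup>2)"
proof -
  have mX [measurable]: "X \<in> borel_measurable M" using X by (simp add: gaussian_rv_def)
  from X consider \<mu> where "AE w in M. X w = \<mu>" | \<mu> \<sigma> where "\<sigma> > 0" "distributed M lborel X (normal_density \<mu> \<sigma>)"
    by (auto simp: gaussian_rv_def)
  then show ?thesis
  proof cases
    case 1
    then show ?thesis by (intro integrable_const_bound[of _ "\<mu>\<^sup>2"]) (auto elim: eventually_mono)
  next
    case 2
    have [simp]: "integrable lborel (\<lambda>x. normal_density \<mu> \<sigma> x * (x - \<mu>))"
      using integrable_normal_moment[OF 2(1), of \<mu> 1] by simp
    have [simp]: "integrable lborel (\<lambda>x. normal_density \<mu> \<sigma> x * (x - \<mu>)\<^sup>2)"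
      using integrable_normal_moment[OF 2(1), of \<mu> 2] by simp
    have "normal_density \<mu> \<sigma> x * x\<^sup>2 = normal_density \<mu> \<sigma> x * (x - \<mu>)\<^sup>2 + 2 * \<mu> * (normal_density \<mu> \<sigma> x * (x - \<mu>)) + \<mu>\<^sup>2 * normal_density \<mu> \<sigma> x" for x
      by (simp add: power2_eq_square algebra_simps)
    then have "integrable lborel (\<lambda>x. normal_density \<mu> \<sigma> x * x\<^sup>2)"
      using 2(1) by simp
    then show ?thesis
      using distributed_integrable[OF 2(2), of "\<lambda>x. x\<^sup>2"] by simp
  qed
qed

text \<open>In the degenerate case the vanishing mean forces the constant to be 0. Otherwise the
  variable is rescaled and the standard normal characteristic function is read off at
  \<sigma>.\<close>

lemma (in prob_space) gaussian_char:
  assumes X: "gaussian_rv M X" and EX: "(\<integral>w. X w \<partial>M) = 0"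
  shows "(\<integral>w. exp (\<i> * of_real (X w)) \<partial>M) = exp (- of_real ((\<integral>w. (X w)\<^sup>2 \<partial>M) / 2))"
proof -
  have mX [measurable]: "X \<in> borel_measurable M" using X by (simp add: gaussian_rv_def)
  from X consider \<mu> where "AE w in M. X w = \<mu>" | \<mu> \<sigma> where "\<sigma> > 0" "distributed M lborel X (normal_density \<mu> \<sigma>)"
    by (auto simp: gaussian_rv_def)
  then show ?thesis
  proof cases
    case 1
    then have "(\<integral>w. X w \<partial>M) = (\<integral>w. \<mu> \<partial>M)" by (intro integral_cong_AE) auto
    then have "\<mu> = 0" using EX prob_space by simp
    then have "(\<integral>w. (X w)\<^sup>2 \<partial>M) = (\<integral>w. 0 \<partial>M)" "(\<integral>w. exp (\<i> * of_real (X w)) \<partial>M) = (\<integral>w. 1 \<partial>M)"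
      using 1 by (intro integral_cong_AE; auto elim!: eventually_mono)+
    then show ?thesis using prob_space by simp
  next
    case 2
    have \<mu>: "\<mu> = 0" using normal_distributed_expectation[OF 2] EX by simp
    then have var: "(\<integral>w. (X w)\<^sup>2 \<partial>M) = \<sigma>\<^sup>2" using normal_distributed_variance[OF 2] EX by simp
    have "distributed M lborel (\<lambda>w. X w / \<sigma>) std_normal_density"
      using 2(2) \<mu> unfolding normal_standard_normal_convert[OF 2(1)] by simp
    then have d: "distr M lborel (\<lambda>w. X w / \<sigma>) = std_normal_distribution"
      by (simp add: distributed_def)
    have "char std_normal_distribution \<sigma> = (\<integral>x. exp (\<i> * of_real (\<sigma> * x)) \<partial>distr M lborel (\<lambda>w. X w / \<sigma>))"
      by (simp add: char_def d)
    also have "\<dots> = (\<integral>w. exp (\<i> * of_real (\<sigma> * (X w / \<sigma>))) \<partial>M)"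
      by (rule integral_distr) measurable
    also have "\<dots> = (\<integral>w. exp (\<i> * of_real (X w)) \<partial>M)" using 2(1) by simp
    finally show ?thesis by (simp add: char_std_normal_distribution var exp_of_real[symmetric] exp_minus)
  qed
qed

section \<open>The limiting Gaussian process\<close>

locale bridge =
  fixes P :: "'a measure" and W :: "real \<times> real \<Rightarrow> 'a \<Rightarrow> real"
  assumes bridge: "tied_down_bridge P W"
begin

lemma prob_space_P: "prob_space P" using bridge by (simp add: tied_down_bridge_def)

definition cov :: "real \<times> real \<Rightarrow> real \<times> real \<Rightarrow> real" where
  "cov z z' = (min (fst z) (fst z') - fst z * fst z') * (min (snd z) (snd z') - snd z * snd z')"

lemma gaussian_sum:
  assumes "finite K" "\<And>i. i \<in> K \<Longrightarrow> z i \<in> unit_sq"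
  shows "gaussian_rv P (\<lambda>w. \<Sum>i\<in>K. c i * W (z i) w)"
proof -
  obtain xs where xs: "set xs = K" "distinct xs" using finite_distinct_list[OF assms(1)] by blast
  have "\<forall>ps cs. set ps \<subseteq> unit_sq \<longrightarrow> length cs = length ps \<longrightarrow> gaussian_rv P (\<lambda>w. \<Sum>i<length ps. cs ! i * W (ps ! i) w)"
    using bridge unfolding tied_down_bridge_def by blast
  then have "gaussian_rv P (\<lambda>w. \<Sum>i<length (map z xs). map c xs ! i * W (map z xs ! i) w)"
    by (elim allE[of _ "map z xs"] allE[of _ "map c xs"] impE) (use assms(2) xs(1) in auto)
  also have "(\<lambda>w. \<Sum>i<length (map z xs). map c xs ! i * W (map z xs ! i) w) = (\<lambda>w. \<Sum>i\<in>K. c i * W (z i) w)"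
  proof
    fix w
    have "(\<Sum>i<length xs. c (xs ! i) * W (z (xs ! i)) w) = (\<Sum>i\<in>K. c i * W (z i) w)"
      using sum.reindex_bij_betw[OF bij_betw_nth[OF xs(2) refl xs(1)[symmetric]], of "\<lambda>i. c i * W (z i) w"] by simp
    then show "(\<Sum>i<length (map z xs). map c xs ! i * W (map z xs ! i) w) = (\<Sum>i\<in>K. c i * W (z i) w)" by simp
  qed
  finally show ?thesis .
qed

lemma gaussian_W: "z \<in> unit_sq \<Longrightarrow> gaussian_rv P (W z)"
  using gaussian_sum[of "{()}" "\<lambda>_. z" "\<lambda>_. 1"] by simp

lemma measurable_W: "z \<in> unit_sq \<Longrightarrow> W z \<in> borel_measurable P"
  using gaussian_W by (simp add: gaussian_rv_def)

lemma integrable_W: "z \<in> unit_sq \<Longrightarrow> integrable P (W z)" and integral_W: "z \<in> unit_sq \<Longrightarrow> (\<integral>w. W z w \<partial>P) = 0"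
  using bridge unfolding tied_down_bridge_def by blast+

lemma cov_W:
  assumes "z \<in> unit_sq" "z' \<in> unit_sq" shows "(\<integral>w. W z w * W z' w \<partial>P) = cov z z'"
proof -
  have "\<forall>(s, t)\<in>unit_sq. \<forall>(s', t')\<in>unit_sq.
        (\<integral>\<omega>. W (s, t) \<omega> * W (s', t') \<omega> \<partial>P) = (min s s' - s * s') * (min t t' - t * t')"
    using bridge unfolding tied_down_bridge_def by blast
  then show ?thesis using assms by (cases z; cases z') (fastforce simp: cov_def)
qed

lemma integrable_W_sq: "z \<in> unit_sq \<Longrightarrow> integrable P (\<lambda>w. (W z w)\<^sup>2)"
  by (rule prob_space.gaussian_square_integrable[OF prob_space_P gaussian_W])

lemma integrable_W_W:
  assumes "z \<in> unit_sq" "z' \<in> unit_sq" shows "integrable P (\<lambda>w. W z w * W z' w)"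
proof (rule Bochner_Integration.integrable_bound[of _ "\<lambda>w. (W z w)\<^sup>2 + (W z' w)\<^sup>2"])
  have "\<bar>a * b\<bar> \<le> a\<^sup>2 + b\<^sup>2" for a b :: real
    using sum_squares_bound[of "\<bar>a\<bar>" "\<bar>b\<bar>"] abs_ge_zero[of "a * b"] unfolding abs_mult mult.assoc power2_abs by linarith
  then show "AE w in P. norm (W z w * W z' w) \<le> norm ((W z w)\<^sup>2 + (W z' w)\<^sup>2)" by simp
qed (use assms measurable_W integrable_W_sq in auto)

lemma W_sq_le: "z \<in> unit_sq \<Longrightarrow> (\<integral>w. (W z w)\<^sup>2 \<partial>P) \<le> 1"
proof -
  assume z: "z \<in> unit_sq"
  have *: "0 \<le> x - x * x \<and> x - x * x \<le> 1" if "0 \<le> x" "x \<le> 1" for x :: real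
    using that mult_left_le[of x x] mult_nonneg_nonneg[of x x] by linarith
  have "(\<integral>w. (W z w)\<^sup>2 \<partial>P) = cov z z" using cov_W[OF z z] by (simp add: power2_eq_square)
  also have "\<dots> \<le> 1 * 1" unfolding cov_def using z * by (intro mult_mono) (auto simp: unit_sq_def)
  finally show ?thesis by simp
qed

lemma char_W:
  assumes "finite K" "\<And>i. i \<in> K \<Longrightarrow> z i \<in> unit_sq"
  shows "(\<integral>w. exp (\<i> * of_real (\<Sum>j\<in>K. c j * W (z j) w)) \<partial>P) = exp (- of_real ((\<Sum>l\<in>K. \<Sum>k\<in>K. c l * c k * cov (z l) (z k)) / 2))"
proof -
  have "(\<integral>w. (\<Sum>j\<in>K. c j * W (z j) w) \<partial>P) = (\<Sum>j\<in>K. \<integral>w. c j * W (z j) w \<partial>P)"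
    using assms integrable_W by (intro Bochner_Integration.integral_sum) auto
  also have "\<dots> = 0" using assms integral_W by simp
  finally have 0: "(\<integral>w. (\<Sum>j\<in>K. c j * W (z j) w) \<partial>P) = 0" .
  have "(\<Sum>j\<in>K. c j * W (z j) w)\<^sup>2 = (\<Sum>l\<in>K. \<Sum>k\<in>K. c l * c k * (W (z l) w * W (z k) w))" for w
    by (simp add: power2_eq_square sum_product mult_ac)
  then have "(\<integral>w. (\<Sum>j\<in>K. c j * W (z j) w)\<^sup>2 \<partial>P) = (\<integral>w. (\<Sum>l\<in>K. \<Sum>k\<in>K. c l * c k * (W (z l) w * W (z k) w)) \<partial>P)" by simp
  also have "\<dots> = (\<Sum>l\<in>K. \<integral>w. (\<Sum>k\<in>K. c l * c k * (W (z l) w * W (z k) w)) \<partial>P)"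
    using assms integrable_W_W by (intro Bochner_Integration.integral_sum Bochner_Integration.integrable_sum integrable_mult_right) auto
  also have "\<dots> = (\<Sum>l\<in>K. \<Sum>k\<in>K. \<integral>w. c l * c k * (W (z l) w * W (z k) w) \<partial>P)"
    using assms integrable_W_W by (intro sum.cong refl Bochner_Integration.integral_sum integrable_mult_right) auto
  also have "\<dots> = (\<Sum>l\<in>K. \<Sum>k\<in>K. c l * c k * cov (z l) (z k))"
    using assms cov_W by (intro sum.cong refl) simp
  finally have 2: "(\<integral>w. (\<Sum>j\<in>K. c j * W (z j) w)\<^sup>2 \<partial>P) = (\<Sum>l\<in>K. \<Sum>k\<in>K. c l * c k * cov (z l) (z k))" .
  show ?thesis using prob_space.gaussian_char[OF prob_space_P gaussian_sum[OF assms, where c = c] 0] unfolding 2 .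
qed

end

lemma floor_div_tendsto: "0 \<le> s \<Longrightarrow> (\<lambda>n. real (nfloor n s) / real n) \<longlonglongrightarrow> s"
proof (rule tendsto_sandwich)
  assume s: "0 \<le> s"
  show "(\<lambda>n. s - 1 / real n) \<longlonglongrightarrow> s" using tendsto_diff[OF tendsto_const lim_1_over_n, of s] by simp
  have *: "real n * s - 1 \<le> real (nfloor n s)" "real (nfloor n s) \<le> real n * s" for n
  proof -
    have "0 \<le> real n * s" using s by simp
    then show "real n * s - 1 \<le> real (nfloor n s)" "real (nfloor n s) \<le> real n * s" by linarith+
  qed
  show "eventually (\<lambda>n. s - 1 / real n \<le> real (nfloor n s) / real n) sequentially"
    using eventually_gt_at_top[of 0]
  proof eventually_elim
    case (elim n)
    then have "s - 1 / real n = (real n * s - 1) / real n" by (simp add: field_simps)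
    also have "\<dots> \<le> real (nfloor n s) / real n" by (intro divide_right_mono *(1)) simp
    finally show ?case .
  qed
  show "eventually (\<lambda>n. real (nfloor n s) / real n \<le> s) sequentially"
    using eventually_gt_at_top[of 0]
    by eventually_elim (use *(2) in \<open>simp add: pos_divide_le_eq mult.commute\<close>)
qed simp

lemma chain_const_pos: "chain_const > 0"
proof -
  have "1 < (2::real) powr (1/6)" by simp
  then show ?thesis unfolding chain_const_def by (intro mult_pos_pos divide_pos_pos) auto
qed

section \<open>The matrix process on the unit square\<close>

context haar12
begin

text \<open>The bound freed from the definitions of its locale: the error depends on the
  coefficients and on \<open>n\<close>, but not on the blocks, which vary with \<open>n\<close> in
  the application.\<close>

lemma char_approx:
  fixes K :: "'k set"
  assumes "finite K" "\<And>k. k \<in> K \<Longrightarrow> A k \<subseteq> {..<n}" "\<And>k. k \<in> K \<Longrightarrow> B k \<subseteq> {..<n}"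
  shows "cmod ((\<integral>U. exp (\<i> * of_real (\<Sum>k\<in>K. c k * Tc (A k) (B k) U)) \<partial>M) -
      exp (- of_real (2 / \<beta> * (\<Sum>l\<in>K. \<Sum>k\<in>K. c l * c k * (covn (A l) (B l) (A k) (B k) / n\<^sup>2)) / 2)))
    \<le> exp ((\<Sum>k\<in>K. \<bar>c k\<bar>)\<^sup>2) * (exp ((\<Sum>k\<in>K. \<bar>c k\<bar>)\<^sup>2) *
        (2 * (\<Sum>k\<in>K. \<bar>c k\<bar>)\<^sup>2 * (7 + 2 * (\<Sum>k\<in>K. \<bar>c k\<bar>)) / sqrt n))"
proof -
  interpret char_haar n \<beta> M K c A B by unfold_locales (use assms in auto)
  show ?thesis using char_bound unfolding \<phi>_def E_L X_def s_def C_def mult_1_left .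
qed

lemma W_proc_eq:
  assumes "z \<in> unit_sq" shows "W_proc n M U z = Vp U (nfloor n (fst z)) (nfloor n (snd z))"
proof -
  have "nfloor n (fst z) \<le> n" "nfloor n (snd z) \<le> n"
    using assms nat_floor_le(1) by (auto simp: unit_sq_def)
  then have "{..<nfloor n (fst z)} \<subseteq> {..<n}" "{..<nfloor n (snd z)} \<subseteq> {..<n}" by auto
  from expectation_Tr[OF this] show ?thesis
    by (cases z) (simp add: W_proc_def Let_def T_pq_eq_Tr Vp_def Tc_def)
qed

lemma W_proc_moment2:
  assumes z: "z \<in> unit_sq"
  shows "integrable M (\<lambda>U. (W_proc n M U z)\<^sup>2) \<and> (\<integral>U. (W_proc n M U z)\<^sup>2 \<partial>M) \<le> 2"
proof -
  let ?p = "nfloor n (fst z)" and ?q = "nfloor n (snd z)"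
  have le: "?p \<le> n" "?q \<le> n" using z nat_floor_le(1) by (auto simp: unit_sq_def)
  then have sub: "{..<?p} \<subseteq> {..<n}" "{..<?q} \<subseteq> {..<n}" by auto
  have "(\<integral>U. (Tc {..<?p} {..<?q} U)\<^sup>2 \<partial>M) \<le> 2 * real ?p / real n"
    using Tr_le_rows[OF _ sub(2), of _ "{..<?p}"] by (intro moment2 sub) auto
  also have "\<dots> \<le> 2" using le n by (simp add: divide_simps)
  finally show ?thesis unfolding W_proc_eq[OF z] Vp_def using integrable_Tc_power by blast
qed

text \<open>A grid of mesh \<open>1 / k\<close> corresponds to about \<open>n / k\<close> matrix
  indices, so chaining starts at a dyadic scale comparable to \<open>n / k\<close> and the bound no
  longer depends on \<open>n\<close>.\<close>

lemma W_proc_tight: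
  assumes k: "4 \<le> k" "k \<le> n"
  shows "grid_close M (W_proc n M) k (chain_const * (4 / real k) powr (1/6))"
proof -
  have k0: "real k > 0" using k by simp
  \<comment> \<open>Within a grid cell the scaled coordinates differ by at most
    \<open>n / k\<close>; the extra 1 absorbs rounding down to integers. The least \<open>m\<close>
    with \<open>x \<le> 2 ^ m\<close> satisfies \<open>2 ^ m \<le> 2 * x\<close>, which is at most
    \<open>4 * n / k\<close> by \<open>k \<le> n\<close>, and this is at most \<open>n\<close> by
    \<open>4 \<le> k\<close>.\<close>
  define x where "x = real n / real k + 1"
  have "\<exists>m. x \<le> 2 ^ m" using real_arch_pow[of 2 x] by (auto intro: less_imp_le)
  define m where "m = (LEAST m. x \<le> 2 ^ m)"
  have m: "x \<le> 2 ^ m" unfolding m_def using \<open>\<exists>m. x \<le> 2 ^ m\<close> by (rule LeastI_ex)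
  have x1: "x > 1" using k0 n by (simp add: x_def)
  then obtain m' where m': "m = Suc m'" using m by (cases m) auto
  have "\<not> x \<le> 2 ^ m'" using not_less_Least[of m' "\<lambda>m. x \<le> 2 ^ m"] m' by (simp add: m_def)
  then have "2 ^ m \<le> 2 * x" by (simp add: m')
  also have "\<dots> \<le> 4 * (real n / real k)" using k k0 by (simp add: x_def field_simps)
  finally have m2: "2 ^ m \<le> 4 * (real n / real k)" .
  also have "\<dots> \<le> n" using k k0 by (simp add: field_simps)
  finally have "real (2 ^ m) \<le> real n" by simp
  then have mn: "2 ^ m \<le> n" by (simp only: of_nat_le_iff)
  obtain S where S: "integrable M S" "(\<integral>U. S U \<partial>M) \<le> chain_const * (2 ^ m / n) powr (1/6)"
    "\<And>U p q p' q'. p' \<le> p \<Longrightarrow> p \<le> p' + 2 ^ m \<Longrightarrow> p \<le> n \<Longrightarrow> q' \<le> q \<Longrightarrow> q \<le> q' + 2 ^ m \<Longrightarrow> q \<le> n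
       \<Longrightarrow> \<bar>Vp U p q - Vp U p' q'\<bar> \<le> S U"
    using chaining_bound[OF mn] by blast
  have cc: "chain_const \<ge> 0" using chain_const_pos by simp
  have "(2 ^ m / n) powr (1/6) \<le> (4 / real k) powr (1/6)"
    using m2 n k0 by (intro powr_mono2) (auto simp: field_simps)
  then have "chain_const * (2 ^ m / n) powr (1/6) \<le> chain_const * (4 / real k) powr (1/6)"
    using cc by (rule mult_left_mono)
  then have S2: "(\<integral>U. S U \<partial>M) \<le> chain_const * (4 / real k) powr (1/6)" using S(2) by linarith
  have near: "nat \<lfloor>real n * (real (nfloor k s) / real k)\<rfloor> \<le> nfloor n s \<and>
     nfloor n s \<le> nat \<lfloor>real n * (real (nfloor k s) / real k)\<rfloor> + 2 ^ m" if s: "0 \<le> s" for s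
  proof -
    define g where "g = real (nfloor k s) / real k"
    have "0 \<le> real k * s" using s by simp
    then have "real (nfloor k s) \<le> real k * s" "real k * s \<le> real (nfloor k s) + 1" by linarith+
    then have g: "g \<le> s" "s \<le> g + 1 / real k" using k0 by (simp_all add: g_def field_simps)
    have "real n * g \<le> real n * s" using g by (simp add: mult_left_mono)
    moreover have "real n * s \<le> real n * (g + 1 / real k)" using g by (intro mult_left_mono) auto
    then have "real n * s \<le> real n * g + (x - 1)" by (simp add: x_def distrib_left)
    then have "real n * s \<le> real n * g + (real (2 ^ m) - 1)" using m by simp
    moreover have "0 \<le> real n * g" by (simp add: g_def)
    ultimately have "nat \<lfloor>real n * g\<rfloor> \<le> nfloor n s" "real (nfloor n s) \<le> real (nat \<lfloor>real n * g\<rfloor>) + real (2 ^ m)"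
      by (auto intro!: nat_mono floor_mono) linarith
    then show ?thesis by (simp only: g_def of_nat_add[symmetric] of_nat_le_iff)
  qed
  have "\<bar>W_proc n M U z - grid k (W_proc n M U) z\<bar> \<le> S U" if z: "z \<in> unit_sq" for U z
  proof -
    let ?z = "(real (nfloor k (fst z)) / real k, real (nfloor k (snd z)) / real k)"
    have z01: "0 \<le> fst z" "fst z \<le> 1" "0 \<le> snd z" "snd z \<le> 1" using z by (auto simp: unit_sq_def)
    have "?z \<in> unit_sq" using nat_floor_le z01 by (auto simp: unit_sq_def)
    moreover have "grid k (W_proc n M U) z = W_proc n M U ?z" by (cases z) (simp add: grid_def step_def)
    ultimately show ?thesis
      using near[OF z01(1)] near[OF z01(3)] nat_floor_le(1) z01
      by (auto simp: W_proc_eq[OF z] W_proc_eq intro!: S(3))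
  qed
  then show ?thesis unfolding grid_close_def using S(1) S2 by blast
qed

end

context
  fixes \<beta> :: real and M :: "nat \<Rightarrow> cmat measure" and P :: "'a measure" and W :: "real \<times> real \<Rightarrow> 'a \<Rightarrow> real"
  assumes beta: "\<beta> = 1 \<or> \<beta> = 2"
    and haar: "\<And>n. haar_on n (beta_group \<beta> n) (M n)"
    and bridge: "tied_down_bridge P W"
begin

interpretation bridge P W by standard (rule bridge)

text \<open>For fixed coefficients the error is a constant over \<open>sqrt n\<close>, and the
  variances at size \<open>n\<close> converge because relative block sizes converge to the
  coordinates of the points.\<close>

lemma W_proc_char:
  fixes z :: "'k \<Rightarrow> real \<times> real"
  assumes K: "finite K" and z: "\<And>i. z i \<in> unit_sq"
  shows "(\<lambda>n. \<integral>u. exp (\<i> * of_real (\<Sum>j\<in>K. c j * W_proc n (M n) u (z j))) \<partial>M n) \<longlonglongrightarrow>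
       (\<integral>w. exp (\<i> * of_real (\<Sum>j\<in>K. c j * (sqrt (2 / \<beta>) * W (z j) w))) \<partial>P)"
proof -
  let ?\<phi> = "\<lambda>n. \<integral>u. exp (\<i> * of_real (\<Sum>j\<in>K. c j * W_proc n (M n) u (z j))) \<partial>M n"
  define C where "C = (\<Sum>k\<in>K. \<bar>c k\<bar>)"
  define A where "A = (\<lambda>n j. {..<nfloor n (fst (z j))})"
  define B where "B = (\<lambda>n j. {..<nfloor n (snd (z j))})"
  define f where "f = (\<lambda>n s. real (nfloor n s) / real n)"
  define b where "b = (\<lambda>l n. (min (f n (fst (z (fst l)))) (f n (fst (z (snd l)))) - f n (fst (z (fst l))) * f n (fst (z (snd l)))) *
     (min (f n (snd (z (fst l)))) (f n (snd (z (snd l)))) - f n (snd (z (fst l))) * f n (snd (z (snd l)))))"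
  define s where "s = (\<lambda>n. 2 / \<beta> * (\<Sum>l\<in>K. \<Sum>k\<in>K. c l * c k * b (l, k) n))"
  define v where "v = 2 / \<beta> * (\<Sum>l\<in>K. \<Sum>k\<in>K. c l * c k * cov (z l) (z k))"
  have z01: "0 \<le> fst (z i)" "fst (z i) \<le> 1" "0 \<le> snd (z i)" "snd (z i) \<le> 1" for i
    using z[of i] by (auto simp: unit_sq_def)
  have "(b (l, k) \<longlongrightarrow> cov (z l) (z k)) sequentially" for l k
    unfolding b_def f_def cov_def fst_conv snd_conv using z01
    by (intro tendsto_mult tendsto_diff tendsto_min floor_div_tendsto) auto
  then have s: "s \<longlonglongrightarrow> v" unfolding s_def v_def by (intro tendsto_mult tendsto_sum tendsto_const)
  have lim: "(\<lambda>n. exp (- complex_of_real (s n / 2))) \<longlonglongrightarrow> exp (- complex_of_real (v / 2))"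
    by (intro tendsto_exp tendsto_minus tendsto_of_real tendsto_divide s tendsto_const) simp
  define D where "D = exp (C\<^sup>2) * (exp (C\<^sup>2) * (2 * C\<^sup>2 * (7 + 2 * C)))"
  have bound: "cmod (?\<phi> n - exp (- complex_of_real (s n / 2))) \<le> D / sqrt n"
    if n: "n > 0" for n
  proof -
    have sub: "A n j \<subseteq> {..<n}" "B n j \<subseteq> {..<n}" for j
      unfolding A_def B_def using nat_floor_le(1)[of _ n] z01[of j] by (auto intro: less_le_trans)
    interpret haar12 n \<beta> "M n" by unfold_locales (use haar beta n in auto)
    have X: "(\<Sum>j\<in>K. c j * Tc (A n j) (B n j) u) = (\<Sum>j\<in>K. c j * W_proc n (M n) u (z j))" for u
      using z by (simp add: W_proc_eq Vp_def A_def B_def)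
    have "covn (A n l) (B n l) (A n k) (B n k) / n\<^sup>2 = b (l, k) n" for l k
    proof -
      have mn: "real (min p q) / n = min (real p / n) (real q / n)" for p q
        using n by (simp add: min_def divide_le_cancel)
      then have e: "(real (card ({..<p} \<inter> {..<q})) - real (card {..<p}) * real (card {..<q}) / n) / n = min (real p / n) (real q / n) - real p / n * (real q / n)" for p q
      proof -
        have "{..<p} \<inter> {..<q} = {..<min p q}" by auto
        then show ?thesis using mn[of p q] by (simp add: diff_divide_distrib)
      qed
      have "covn (A n l) (B n l) (A n k) (B n k) / n\<^sup>2 = ((real (card (A n l \<inter> A n k)) - real (card (A n l)) * real (card (A n k)) / n) / n) *
         ((real (card (B n l \<inter> B n k)) - real (card (B n l)) * real (card (B n k)) / n) / n)"
        by (simp add: covn_def power2_eq_square)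
      also have "\<dots> = b (l, k) n" unfolding A_def B_def e b_def f_def by simp
      finally show ?thesis .
    qed
    then show ?thesis
      using char_approx[of K "A n" "B n" c] K sub unfolding X C_def[symmetric] by (simp add: s_def D_def)
  qed
  have "(\<lambda>n. D / sqrt (real n)) \<longlonglongrightarrow> 0"
    by (intro tendsto_divide_0[OF tendsto_const] filterlim_at_top_imp_at_infinity filterlim_compose[OF sqrt_at_top filterlim_real_sequentially])
  then have "(\<lambda>n. ?\<phi> n - exp (- complex_of_real (s n / 2))) \<longlonglongrightarrow> 0"
    by (rule Lim_null_comparison[rotated]) (rule eventually_mono[OF eventually_gt_at_top[of 0] bound])
  from tendsto_add[OF this lim] have "?\<phi> \<longlonglongrightarrow> exp (- complex_of_real (v / 2))"
    unfolding diff_add_cancel add_0 .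
  also have "exp (- complex_of_real (v / 2)) = (\<integral>w. exp (\<i> * of_real (\<Sum>j\<in>K. c j * (sqrt (2 / \<beta>) * W (z j) w))) \<partial>P)"
  proof -
    \<comment> \<open>The scaling of the bridge is moved into the coefficients, where it enters
      twice and reproduces the factor \<open>2 / \<beta>\<close>.\<close>
    have "v = (\<Sum>l\<in>K. \<Sum>k\<in>K. (c l * sqrt (2 / \<beta>)) * (c k * sqrt (2 / \<beta>)) * cov (z l) (z k))"
      using beta by (auto simp: v_def sum_distrib_left intro!: sum.cong)
    moreover have "c j * (sqrt (2 / \<beta>) * y) = (c j * sqrt (2 / \<beta>)) * y" for j y
      by (simp only: mult.assoc)
    ultimately show ?thesis
      by (simp only: char_W[OF K z, where c = "\<lambda>j. c j * sqrt (2 / \<beta>)"])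
  qed
  finally show ?thesis .
qed

end

theorem theorem1p1:
  fixes \<beta> :: real
    and M :: "nat \<Rightarrow> cmat measure"
    and P :: "'a measure"
    and W :: "real \<times> real \<Rightarrow> 'a \<Rightarrow> real"
  assumes beta: "\<beta> = 1 \<or> \<beta> = 2"
    and haar: "\<And>n. haar_on n (beta_group \<beta> n) (M n)"
    and bridge: "tied_down_bridge P W"
  shows "conv_distr_D2 M (\<lambda>n U. W_proc n (M n) U) P (\<lambda>\<omega> x. sqrt (2 / \<beta>) * W x \<omega>)"
proof -
  interpret bridge P W by standard (rule bridge)
  have hn: "haar12 n \<beta> (M n)" if "n > 0" for n
    by unfold_locales (use haar beta that in auto)
  have h: "haar n \<beta> (M n)" for n by unfold_locales (rule haar)
  \<comment> \<open>The criterion quantifies over all \<open>n\<close>, whereas the moment bounds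
    presuppose \<open>n > 0\<close>; at \<open>n = 0\<close> the process is identically
    zero.\<close>
  have 0: "W_proc 0 (M 0) u z = 0" for u z
    by (cases z) (simp add: W_proc_def T_pq_def)
  have "D2_convergence M P (\<lambda>n u (p, q). T_pq p q u - (\<integral>V. T_pq p q V \<partial>M n)) (\<lambda>n U. W_proc n (M n) U) (\<lambda>\<omega> x. sqrt (2 / \<beta>) * W x \<omega>) 2"
  proof (rule D2_convergence.intro)
    show "prob_space (M n)" for n using haar[of n] by (simp add: haar_on_def)
    show "prob_space P" by (rule prob_space_P)
    show "W_proc n (M n) u = step n (\<lambda>(p, q). T_pq p q u - (\<integral>V. T_pq p q V \<partial>M n))" for n u
      by (auto simp: fun_eq_iff W_proc_def step_def Let_def)
    show "(\<lambda>u. case i of (p, q) \<Rightarrow> T_pq p q u - (\<integral>V. T_pq p q V \<partial>M n)) \<in> borel_measurable (M n)" for n i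
      using measurable_Tr haar.sets_M[OF h[of n]] by (cases i) (simp add: T_pq_eq_Tr measurable_cong_sets[OF haar.sets_M[OF h[of n]] refl])
    show "(\<lambda>w. sqrt (2 / \<beta>) * W z w) \<in> borel_measurable P" if "z \<in> unit_sq" for z
      using measurable_W[OF that] by simp
    show "continuous_on unit_sq (\<lambda>x. sqrt (2 / \<beta>) * W x w)" if "w \<in> space P" for w
      using bridge that by (auto simp: tied_down_bridge_def intro!: continuous_intros)
    show "(\<lambda>n. \<integral>u. exp (\<i> * of_real (\<Sum>j\<in>K. c j * W_proc n (M n) u (z j))) \<partial>M n) \<longlonglongrightarrow>
       (\<integral>w. exp (\<i> * of_real (\<Sum>j\<in>K. c j * (sqrt (2 / \<beta>) * W (z j) w))) \<partial>P)"
      if "finite K" "\<And>i. z i \<in> unit_sq" for K :: "(nat \<times> nat) set" and z c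
      by (rule W_proc_char[OF beta haar bridge that])
    show "integrable (M n) (\<lambda>u. (W_proc n (M n) u z)\<^sup>2) \<and> (\<integral>u. (W_proc n (M n) u z)\<^sup>2 \<partial>M n) \<le> 2" if "z \<in> unit_sq" for n z
      using haar12.W_proc_moment2[OF hn that] 0 by (cases "n = 0") auto
    show "integrable P (\<lambda>w. (sqrt (2 / \<beta>) * W z w)\<^sup>2) \<and> (\<integral>w. (sqrt (2 / \<beta>) * W z w)\<^sup>2 \<partial>P) \<le> 2" if "z \<in> unit_sq" for z
      using integrable_W_sq[OF that] W_sq_le[OF that] beta by (auto simp: power_mult_distrib)
    fix \<epsilon> :: real assume \<epsilon>: "\<epsilon> > 0"
    note cc = chain_const_pos
    \<comment> \<open>Inverts the chaining bound: once \<open>k\<close> is at least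
      \<open>4 / \<delta>^6\<close>, its value is at most \<epsilon>.\<close>
    define \<delta> where "\<delta> = \<epsilon> / chain_const"
    have \<delta>: "\<delta> > 0" using \<epsilon> cc by (simp add: \<delta>_def)
    show "\<exists>K. \<forall>k\<ge>K. eventually (\<lambda>n. grid_close (M n) (W_proc n (M n)) k \<epsilon>) sequentially"
    proof (intro exI allI impI)
      fix k assume k: "k \<ge> max 4 (nat \<lceil>4 / \<delta> ^ 6\<rceil>)"
      then have "4 / \<delta> ^ 6 \<le> real k" by linarith
      then have "4 / real k \<le> \<delta> ^ 6" using \<delta> k by (simp add: field_simps)
      then have "(4 / real k) powr (1/6) \<le> (\<delta> ^ 6) powr (1/6)" by (intro powr_mono2) auto
      also have "\<dots> = (\<delta> powr 6) powr (1/6)" using \<delta> by simp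
      also have "\<dots> = \<delta>" unfolding powr_powr using \<delta> by simp
      finally have le: "chain_const * (4 / real k) powr (1/6) \<le> \<epsilon>" using cc by (simp add: \<delta>_def field_simps)
      show "eventually (\<lambda>n. grid_close (M n) (W_proc n (M n)) k \<epsilon>) sequentially"
      proof (rule eventually_sequentiallyI[of k])
        fix n assume n: "k \<le> n"
        have "haar12 n \<beta> (M n)" by (rule hn) (use n k in simp)
        then show "grid_close (M n) (W_proc n (M n)) k \<epsilon>"
          by (rule grid_close_mono[OF haar12.W_proc_tight[OF _ _ n] le]) (use k in simp)
      qed
    qed
  qed
  then show ?thesis by (rule D2_convergence.conv_distr)
qed

end
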